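(* Let $n\ge 1$, let $A:\mathbb{R}^n\to\mathbb{M}_n$ be a bounded and elliptic (measurable) matrix-valued function with constants $0<\lambda\le 1\le\Lambda<\infty$, let $p\in[\frac n2,\infty]$ with $p>1$, let $V\in RH_p$ with uniform $RH_p$ constant $C_V$, and let $d_V:\mathbb{R}^n\times\mathbb{R}^n\to\mathbb{R}_{\ge 0}$ denote the Agmon distance function associated to $V$. There exists a constant $\gamma_0=\gamma_0(n,\lambda,\Lambda,p,C_V)>0$, depending only on the indicated quantities, such that the following holds. If $u:\mathbb{R}^n\to\mathbb{R}$ is a weak solution to $-\operatorname{div}(A\nabla u)+Vu=0$ in $\mathbb{R}^n$ and for some $\gamma_1<\gamma_0$ there exists $C_{\gamma_1}>0$ such that for each $x\in\mathbb{R}^n$, $$|u(x)|\le C_{\gamma_1}e^{\gamma_1 d_V(x,0)},$$ then $u\equiv 0$.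
   Context: Bounded and elliptic: $\mathbb{M}_n$ is the set of real $n\times n$ matrices, and for a.e. $x\in\mathbb{R}^n$ and all $\xi,\zeta\in\mathbb{R}^n$, $|A(x)\xi\cdot\zeta|\le\Lambda|\xi||\zeta|$ and $A(x)\xi\cdot\xi\ge\lambda|\xi|^2$ ($A$ need not be symmetric). Reverse Hölder class: for $1<p\le\infty$, $V\in RH_p$ means $V\in L^p_{\mathrm{loc}}(\mathbb{R}^n)$, $V>0$ a.e., and there is a constant $C_V$ such that for every ball $B\subset\mathbb{R}^n$, $\left(\frac1{|B|}\int_B V^p\right)^{1/p}\le C_V\frac1{|B|}\int_B V$ (for $p=\infty$ the left side is $\|V\|_{L^\infty(B)}$); $C_V$ is called the uniform $RH_p$ constant. Weak solution: $u\in H^1_{\mathrm{loc}}(\mathbb{R}^n)$ such that $\int_{\mathbb{R}^n}A\nabla u\cdot\nabla\varphi+Vu\varphi=0$ for every $\varphi\in H^1_0(\mathbb{R}^n)$ with compact support. Agmon distance: with $B_r(x)$ the ball of radius $r$ centered at $x$, set $\psi_V(x,r)=r^2\frac1{|B_r(x)|}\int_{B_r(x)}V(y)\,dy$ and define $m_V:\mathbb{R}^n\to(0,\infty)$ by $\frac1{m_V(x)}=\sup\{r>0:\psi_V(x,r)\le1\}$. (If $p=\frac n2$, Gehring's lemma gives $V\in RH_q$ for some $q>\frac n2$, so $m_V$ is well defined.) Then $d_V(x,y)=\inf_{\sigma}\int_0^1 m_V(\sigma(t))|\sigma'(t)|\,dt$, the infimum being over all absolutely continuous $\sigma:[0,1]\to\mathbb{R}^n$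 with $\sigma(0)=x$, $\sigma(1)=y$. *)

theory Defs
  imports "HOL-Analysis.Analysis" "HOL-Probability.Essential_Supremum"
begin

section \<open>Lebesgue spaces on subsets of Euclidean space\<close>

definition Linfty_norm :: "'a::euclidean_space set \<Rightarrow> ('a \<Rightarrow> 'b::real_normed_vector) \<Rightarrow> ereal" where
  "Linfty_norm S f = esssup (restrict_space lebesgue S) (\<lambda>x. ereal (norm (f x)))"

definition in_Lp :: "ennreal \<Rightarrow> 'a::euclidean_space set \<Rightarrow> ('a \<Rightarrow> 'b::euclidean_space) \<Rightarrow> bool" where
  "in_Lp p S f \<longleftrightarrow> set_borel_measurable lebesgue S f \<and>
     (if p = \<infinity> then Linfty_norm S f < \<infinity>
      else set_integrable lebesgue S (\<lambda>x. norm (f x) powr enn2real p))"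

definition in_Lp_loc :: "ennreal \<Rightarrow> ('a::euclidean_space \<Rightarrow> 'b::euclidean_space) \<Rightarrow> bool" where
  "in_Lp_loc p f \<longleftrightarrow> (\<forall>K. compact K \<longrightarrow> in_Lp p K f)"


section \<open>Sobolev spaces\<close>

definition partial_deriv :: "'n::finite \<Rightarrow> (real^'n \<Rightarrow> real) \<Rightarrow> real^'n \<Rightarrow> real" where
  "partial_deriv i f x = frechet_derivative f (at x) (axis i 1)"

definition grad :: "(real^'n::finite \<Rightarrow> real) \<Rightarrow> real^'n \<Rightarrow> real^'n" where
  "grad f x = (\<chi> i. partial_deriv i f x)"

primrec C_k :: "nat \<Rightarrow> (real^'n::finite \<Rightarrow> real) \<Rightarrow> bool" where
  "C_k 0 f \<longleftrightarrow> continuous_on UNIV f"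
| "C_k (Suc k) f \<longleftrightarrow> f differentiable_on UNIV \<and> (\<forall>i. C_k k (partial_deriv i f))"

definition test_function :: "(real^'n::finite \<Rightarrow> real) \<Rightarrow> bool" where
  "test_function \<phi> \<longleftrightarrow> (\<forall>k. C_k k \<phi>) \<and> compact (closure (support_on UNIV \<phi>))"

text \<open>Weak gradients are determined only almost everywhere, so the notions below relate a
  function \<open>u\<close> to (a representative \<open>Du\<close> of) its weak gradient.\<close>

definition has_weak_grad :: "(real^'n::finite \<Rightarrow> real) \<Rightarrow> (real^'n \<Rightarrow> real^'n) \<Rightarrow> bool" where
  "has_weak_grad u Du \<longleftrightarrow> in_Lp_loc 1 u \<and> in_Lp_loc 1 Du \<and>
     (\<forall>\<phi> i. test_function \<phi> \<longrightarrow>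
        (LINT x|lebesgue. u x * partial_deriv i \<phi> x) = - (LINT x|lebesgue. Du x $ i * \<phi> x))"

definition H1_loc :: "(real^'n::finite \<Rightarrow> real) \<Rightarrow> (real^'n \<Rightarrow> real^'n) \<Rightarrow> bool" where
  "H1_loc u Du \<longleftrightarrow> has_weak_grad u Du \<and> in_Lp_loc 2 u \<and> in_Lp_loc 2 Du"

definition H1 :: "(real^'n::finite \<Rightarrow> real) \<Rightarrow> (real^'n \<Rightarrow> real^'n) \<Rightarrow> bool" where
  "H1 u Du \<longleftrightarrow> has_weak_grad u Du \<and> in_Lp 2 UNIV u \<and> in_Lp 2 UNIV Du"

text \<open>The closure of the test functions in \<open>H1\<close>.\<close>

definition H1_0 :: "(real^'n::finite \<Rightarrow> real) \<Rightarrow> (real^'n \<Rightarrow> real^'n) \<Rightarrow> bool" where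
  "H1_0 u Du \<longleftrightarrow> H1 u Du \<and>
     (\<exists>\<phi> :: nat \<Rightarrow> real^'n \<Rightarrow> real. (\<forall>k. test_function (\<phi> k)) \<and>
        (\<lambda>k. LINT x|lebesgue. (u x - \<phi> k x)\<^sup>2 + (norm (Du x - grad (\<phi> k) x))\<^sup>2)
          \<longlonglongrightarrow> 0)"

definition ess_compact_support :: "(real^'n::finite \<Rightarrow> real) \<Rightarrow> bool" where
  "ess_compact_support u \<longleftrightarrow> (\<exists>K. compact K \<and> (AE x in lebesgue. x \<notin> K \<longrightarrow> u x = 0))"


section \<open>Coefficients and weak solutions\<close>

definition bounded_elliptic :: "real \<Rightarrow> real \<Rightarrow> (real^'n::finite \<Rightarrow> real^'n^'n) \<Rightarrow> bool" where
  "bounded_elliptic lam Lam A \<longleftrightarrow> A \<in> borel_measurable lebesgue \<and>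
     (AE x in lebesgue.
        (\<forall>\<xi> \<zeta>. \<bar>(A x *v \<xi>) \<bullet> \<zeta>\<bar> \<le> Lam * norm \<xi> * norm \<zeta>) \<and>
        (\<forall>\<xi>. lam * (norm \<xi>)\<^sup>2 \<le> (A x *v \<xi>) \<bullet> \<xi>))"

definition ball_average :: "'a::euclidean_space \<Rightarrow> real \<Rightarrow> ('a \<Rightarrow> real) \<Rightarrow> real" where
  "ball_average x r f = (LINT y:ball x r|lebesgue. f y) / measure lebesgue (ball x r)"

definition reverse_Holder :: "ennreal \<Rightarrow> real \<Rightarrow> ('a::euclidean_space \<Rightarrow> real) \<Rightarrow> bool" where
  "reverse_Holder p C V \<longleftrightarrow> in_Lp_loc p V \<and> (AE x in lebesgue. 0 < V x) \<and>
     (\<forall>x r. 0 < r \<longrightarrow>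
        (if p = \<infinity> then Linfty_norm (ball x r) V \<le> ereal (C * ball_average x r V)
         else ball_average x r (\<lambda>y. V y powr enn2real p) powr (1 / enn2real p)
                \<le> C * ball_average x r V))"

text \<open>Using \<open>has_bochner_integral\<close> rules out a value 0 that is only the convention for
  non-integrable functions; for the coefficients considered here the integrand is always
  integrable by the Sobolev embedding.\<close>

definition weak_solution ::
  "(real^'n::finite \<Rightarrow> real^'n^'n) \<Rightarrow> (real^'n \<Rightarrow> real) \<Rightarrow> (real^'n \<Rightarrow> real) \<Rightarrow> bool" where
  "weak_solution A V u \<longleftrightarrow>
     (\<exists>Du. H1_loc u Du \<and>
        (\<forall>\<phi> D\<phi>. H1_0 \<phi> D\<phi> \<and> ess_compact_support \<phi> \<longrightarrow>
           has_bochner_integral lebesgue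
             (\<lambda>x. (A x *v Du x) \<bullet> D\<phi> x + V x * u x * \<phi> x) 0))"


section \<open>The Agmon distance\<close>

definition psi_fun :: "('a::euclidean_space \<Rightarrow> real) \<Rightarrow> 'a \<Rightarrow> real \<Rightarrow> real" where
  "psi_fun V x r = r\<^sup>2 * ball_average x r V"

definition m_fun :: "('a::euclidean_space \<Rightarrow> real) \<Rightarrow> 'a \<Rightarrow> real" where
  "m_fun V x = 1 / Sup {r. 0 < r \<and> psi_fun V x r \<le> 1}"

definition abs_cont_on :: "real \<Rightarrow> real \<Rightarrow> (real \<Rightarrow> 'a::real_normed_vector) \<Rightarrow> bool" where
  "abs_cont_on a b f \<longleftrightarrow>
     (\<forall>\<epsilon>>0. \<exists>\<delta>>0. \<forall>I :: (real \<times> real) set.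
        finite I \<and> (\<forall>(s, t)\<in>I. a \<le> s \<and> s \<le> t \<and> t \<le> b) \<and>
        disjoint_family_on (\<lambda>(s, t). {s<..<t}) I \<and> (\<Sum>(s, t)\<in>I. t - s) < \<delta> \<longrightarrow>
        (\<Sum>(s, t)\<in>I. norm (f t - f s)) < \<epsilon>)"

text \<open>An absolutely continuous curve in Euclidean space is differentiable almost everywhere;
  the unspecified value of \<open>vector_derivative\<close> on the remaining null set does not
  affect the integral.\<close>

definition agmon_distance :: "('a::euclidean_space \<Rightarrow> real) \<Rightarrow> 'a \<Rightarrow> 'a \<Rightarrow> real" where
  "agmon_distance V x y = enn2real
     (INF \<sigma> \<in> {\<sigma>. abs_cont_on 0 1 \<sigma> \<and> \<sigma> 0 = x \<and> \<sigma> 1 = y}.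
        \<integral>\<^sup>+t\<in>{0..1}. ennreal (m_fun V (\<sigma> t) * norm (vector_derivative \<sigma> (at t))) \<partial>lebesgue)"

end

theory Submission
  imports Defs
begin

text \<open>Let \<open>\<rho>\<close> be a radius with \<open>psi_fun V x (\<rho> x) \<approx> T\<close> for a large constant \<open>T\<close>. On \<open>ball x (2 * \<rho> x)\<close>
  the potential is large at the small scale \<open>r = \<epsilon> * \<rho> x\<close>, so comparing \<open>u x\<close> with \<open>u y\<close> for
  \<open>dist x y < r\<close> bounds the square integral of a cut-off solution by \<open>r\<^sup>2\<close> times its energy.
  Together with Caccioppoli's inequality, the integral of \<open>u\<^sup>2\<close> over \<open>ball x (\<rho> x)\<close> is at most
  \<open>C * \<epsilon>\<^sup>2\<close> times the one over the doubled ball. Since \<open>\<rho>\<close> varies slowly, with constants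
  independent of \<open>T\<close>, for \<open>\<epsilon>\<close> small the mean of \<open>u\<^sup>2\<close> over \<open>ball x (\<rho> x)\<close> is at most half of its
  supremum over neighbouring critical balls. After \<open>i\<close> steps the Agmon distance to the origin has
  grown by at most \<open>c * i\<close>, so the growth assumption bounds the mean at \<open>x\<close> by a multiple of
  \<open>(exp (2 * \<gamma> * c) / 2) ^ i\<close>, which tends to 0 for small \<open>\<gamma>\<close>.

  No self-improvement of the reverse Hoelder inequality is needed in the borderline case
  \<open>p = n / 2\<close>: up to constants, the \<open>p\<close>-th power of \<open>psi_fun V x r\<close> is \<open>r powr (2 * p - n)\<close> times
  the mass of \<open>V powr p\<close> on \<open>ball x r\<close>, and a doubling measure is reverse doubling.\<close>

section \<open>Reverse Hoelder weights\<close>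

text \<open>The delicate point is the order of the choices, since the threshold must be fixed before
  \<open>V\<close>. Comparing neighbouring critical radii costs \<open>G (2 * D\<^sup>2)\<close>, a
  constant from which the level \<open>T\<close> has cancelled. So the overlap constant comes first,
  then the number \<open>j\<close> of halvings that makes the energy factor beat it, then
  \<open>T = D ^ Suc j\<close>, and last the cost \<open>c\<close> of one step, which may be as
  large as it likes. A gain of 1/2 per step against a growth of
  \<open>exp (2 * \<gamma> * c)\<close> then yields the threshold \<open>ln 2 / (2 * c)\<close>. The
  growth assumption serves twice: in the iteration, and beforehand to make \<open>u\<close> locally
  bounded, so that the potential energy of the cut-off solution is finite although \<open>V\<close>
  is only known to be locally integrable. The Agmon distance enters through its sign and upper
  bounds, hence through explicit polygons with a bounded cost per segment.\<close>

lemma measure_lebesgue_ball: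
  fixes x :: "'a::euclidean_space"
  assumes "0 \<le> r"
  shows "measure lebesgue (ball x r) = unit_ball_vol (real DIM('a)) * r ^ DIM('a)"
  using content_ball[OF assms, of x] by simp

lemma measure_lebesgue_ball_pos:
  fixes x :: "'a::euclidean_space"
  assumes "0 < r"
  shows "0 < measure lebesgue (ball x r)"
  using assms by (simp add: measure_lebesgue_ball)

lemma measure_lebesgue_ball_scale:
  fixes x y :: "'a::euclidean_space"
  assumes "0 \<le> r" "0 \<le> c"
  shows "measure lebesgue (ball x (c * r)) = c ^ DIM('a) * measure lebesgue (ball y r)"
  using assms by (simp add: content_ball power_mult_distrib)

lemma fmeasurable_ball [simp]: "ball x r \<in> fmeasurable lebesgue"
  by (simp add: lmeasurable_ball)

lemma superlevel_in_ball:
  fixes f :: "'a::euclidean_space \<Rightarrow> real"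
  assumes "f \<in> borel_measurable lebesgue"
  shows "{y \<in> ball x r. q \<le> f y} \<in> sets lebesgue"
proof -
  have "f -` {q..} \<inter> space lebesgue \<in> sets lebesgue"
    by (rule measurable_sets[OF assms]) simp
  then have "ball x r \<inter> (f -` {q..} \<inter> space lebesgue) \<in> sets lebesgue"
    by (rule sets.Int[OF fmeasurableD[OF fmeasurable_ball]])
  also have "ball x r \<inter> (f -` {q..} \<inter> space lebesgue) = {y \<in> ball x r. q \<le> f y}" by auto
  finally show ?thesis .
qed

text \<open>Common target of both cases of \<open>reverse_Holder\<close>: the exponent is a finite
  real, and the inequality is raised to the power \<open>q\<close> so that it compares integrals
  without roots. Integrability on all balls is recorded because a Bochner integral would otherwise
  be 0 by convention.\<close>

definition RHq :: "real \<Rightarrow> real \<Rightarrow> ('a::euclidean_space \<Rightarrow> real) \<Rightarrow> bool" where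
  "RHq q C V \<longleftrightarrow> V \<in> borel_measurable lebesgue \<and> (AE x in lebesgue. 0 < V x) \<and>
     (\<forall>x r. set_integrable lebesgue (ball x r) V) \<and>
     (\<forall>x r. set_integrable lebesgue (ball x r) (\<lambda>y. V y powr q)) \<and>
     (\<forall>x r. 0 < r \<longrightarrow> ball_average x r (\<lambda>y. V y powr q) \<le> (C * ball_average x r V) powr q)"

lemma RHq_D:
  assumes "RHq q C V"
  shows "V \<in> borel_measurable lebesgue" "AE x in lebesgue. 0 < V x"
    "set_integrable lebesgue (ball x r) V" "set_integrable lebesgue (ball x r) (\<lambda>y. V y powr q)"
    "0 < r \<Longrightarrow> ball_average x r (\<lambda>y. V y powr q) \<le> (C * ball_average x r V) powr q"
  using assms unfolding RHq_def by auto

section \<open>Absolute continuity and doubling of the weight\<close>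

abbreviation mass :: "('a::euclidean_space \<Rightarrow> real) \<Rightarrow> 'a set \<Rightarrow> real" where
  "mass V E \<equiv> (LINT y:E|lebesgue. V y)"

lemma mass_subset:
  fixes V :: "'a::euclidean_space \<Rightarrow> real"
  assumes "set_integrable lebesgue B V" "AE x in lebesgue. 0 \<le> V x" "E \<in> sets lebesgue" "E \<subseteq> B"
  shows "set_integrable lebesgue E V" "mass V E \<le> mass V B" "0 \<le> mass V E"
proof -
  show i: "set_integrable lebesgue E V"
    by (rule set_integrable_subset[OF assms(1,3,4)])
  show "mass V E \<le> mass V B"
    unfolding set_lebesgue_integral_def
    using assms(1,2,4) i unfolding set_integrable_def
    by (intro integral_mono_AE) (auto elim!: eventually_mono simp: indicator_def)
  show "0 \<le> mass V E"
    unfolding set_lebesgue_integral_def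
    using assms(2) by (intro integral_nonneg_AE) (auto elim!: eventually_mono)
qed

lemma mass_ball_pos:
  fixes V :: "'a::euclidean_space \<Rightarrow> real"
  assumes "RHq q C V" "0 < r"
  shows "0 < mass V (ball x r)"
proof -
  have ae: "AE x in lebesgue. 0 < V x" and i: "set_integrable lebesgue (ball x r) V"
    using RHq_D[OF assms(1)] by auto
  have nn: "0 \<le> mass V (ball x r)"
    by (rule mass_subset(3)[OF i]) (use ae in \<open>auto elim!: eventually_mono\<close>)
  have "mass V (ball x r) \<noteq> 0"
  proof
    assume "mass V (ball x r) = 0"
    moreover have "AE y in lebesgue. 0 \<le> indicator (ball x r) y *\<^sub>R V y"
      using ae by (auto elim!: eventually_mono)
    ultimately have "AE y in lebesgue. indicator (ball x r) y *\<^sub>R V y = 0"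
      using i unfolding set_lebesgue_integral_def set_integrable_def
      by (subst (asm) integral_nonneg_eq_0_iff_AE) auto
    with ae have "AE y in lebesgue. y \<notin> ball x r"
      by eventually_elim (auto simp: indicator_def split: if_splits)
    then have "ball x r \<in> null_sets lebesgue"
      by (subst (asm) AE_iff_null_sets[symmetric]) auto
    then have "measure lebesgue (ball x r) = 0"
      by (rule measure_eq_0_null_sets)
    with measure_lebesgue_ball_pos[OF assms(2), of x] show False by simp
  qed
  with nn show ?thesis by simp
qed

lemma ball_average_pos:
  assumes "RHq q C V" "0 < r"
  shows "0 < ball_average x r V"
  unfolding ball_average_def
  using mass_ball_pos[OF assms] measure_lebesgue_ball_pos[OF assms(2)] by simp

text \<open>Split \<open>V\<close> at the level \<open>s\<close>: a value \<open>v > s\<close>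
  satisfies \<open>v = v powr (1 - q) * v powr q \<le> s powr (1 - q) * v powr q\<close>. With a
  suitable \<open>s\<close> this plays the role of Hoelder's inequality, at the price of a
  constant.\<close>

lemma mass_le_threshold:
  fixes V :: "'a::euclidean_space \<Rightarrow> real"
  assumes V: "RHq q C V" and q: "1 < q" and s: "0 < s"
    and E: "E \<in> sets lebesgue" "E \<subseteq> ball x r"
  shows "mass V E \<le> s * measure lebesgue E + s powr (1 - q) * mass (\<lambda>y. V y powr q) (ball x r)"
proof -
  note D = RHq_D[OF V]
  have Ef: "E \<in> fmeasurable lebesgue"
    using E by (rule_tac fmeasurableI2[OF fmeasurable_ball]) auto
  have pt: "v \<le> s + s powr (1 - q) * v powr q" if "0 < v" for v
  proof (cases "v \<le> s")
    case True
    then show ?thesis by (simp add: add_increasing2)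
  next
    case False
    have "v powr (1 - q) \<le> s powr (1 - q)"
      using False s q by (intro powr_mono2') auto
    then have "v powr (1 - q) * v powr q \<le> s powr (1 - q) * v powr q"
      by (intro mult_right_mono) auto
    then have "v \<le> s powr (1 - q) * v powr q"
      using that by (simp flip: powr_add)
    with s show ?thesis by simp
  qed
  have iE: "set_integrable lebesgue E V" "set_integrable lebesgue E (\<lambda>y. V y powr q)"
    using set_integrable_subset[OF D(3) E] set_integrable_subset[OF D(4) E] by auto
  have c: "set_integrable lebesgue E (\<lambda>y. s)"
    using Ef by (auto simp: set_integrable_def fmeasurable_def intro!: integrable_mult_left integrable_real_indicator)
  have p: "set_integrable lebesgue E (\<lambda>y. s powr (1 - q) * V y powr q)"
    using iE(2) by (rule set_integrable_mult_right)
  have "mass V E \<le> (LINT y:E|lebesgue. s + s powr (1 - q) * V y powr q)"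
    unfolding set_lebesgue_integral_def
    using iE(1) set_integral_add(1)[OF c p] D(2) pt unfolding set_integrable_def
    by (intro integral_mono_AE) (auto elim!: eventually_mono simp: indicator_def)
  also have "\<dots> = s * measure lebesgue E + s powr (1 - q) * mass (\<lambda>y. V y powr q) E"
    using set_integral_add(2)[OF c p] Ef
    by (simp add: set_lebesgue_integral_def mult_ac fmeasurable_def)
  also have "mass (\<lambda>y. V y powr q) E \<le> mass (\<lambda>y. V y powr q) (ball x r)"
    using mass_subset(2)[OF D(4) _ E] by simp
  finally show ?thesis by (simp add: mult_left_mono)
qed

text \<open>The threshold is \<open>K\<close> times the average of \<open>V\<close> on the ball. By
  the reverse Hoelder inequality both terms then scale like the mass of the ball, and the free
  parameter \<open>K\<close> trades the relative volume of \<open>E\<close> against a term that is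
  small for large \<open>K\<close>.\<close>

lemma mass_subset_le:
  fixes V :: "'a::euclidean_space \<Rightarrow> real"
  assumes V: "RHq q C V" and q: "1 < q" and C: "1 \<le> C" and K: "0 < K" and r: "0 < r"
    and E: "E \<in> sets lebesgue" "E \<subseteq> ball x r"
  shows "mass V E \<le> (K * (measure lebesgue E / measure lebesgue (ball x r))
           + K powr (1 - q) * C powr q) * mass V (ball x r)"
proof -
  define a where "a = ball_average x r V"
  define b where "b = measure lebesgue (ball x r)"
  have a: "0 < a" unfolding a_def by (rule ball_average_pos[OF V r])
  have b: "0 < b" unfolding b_def by (rule measure_lebesgue_ball_pos[OF r])
  have ab: "mass V (ball x r) = a * b"
    using b by (simp add: a_def b_def ball_average_def)
  have "mass (\<lambda>y. V y powr q) (ball x r) = ball_average x r (\<lambda>y. V y powr q) * b"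
    using b by (simp add: b_def ball_average_def)
  also have "\<dots> \<le> (C * a) powr q * b"
    using RHq_D(5)[OF V r, of x] b by (intro mult_right_mono) (auto simp: a_def)
  finally have m: "mass (\<lambda>y. V y powr q) (ball x r) \<le> C powr q * a powr q * b"
    using C a by (simp add: powr_mult)
  have "mass V E \<le> (K * a) * measure lebesgue E + (K * a) powr (1 - q) * mass (\<lambda>y. V y powr q) (ball x r)"
    by (rule mass_le_threshold[OF V q _ E]) (use a K in simp)
  also have "\<dots> \<le> (K * a) * measure lebesgue E + (K * a) powr (1 - q) * (C powr q * a powr q * b)"
    using m by (intro add_left_mono mult_left_mono) auto
  also have "(K * a) powr (1 - q) * (C powr q * a powr q * b) = K powr (1 - q) * C powr q * (a powr (1 - q) * a powr q) * b"
    using K a by (simp add: powr_mult mult_ac)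
  also have "a powr (1 - q) * a powr q = a"
    using a by (simp flip: powr_add)
  also have "K * a * measure lebesgue E + K powr (1 - q) * C powr q * a * b
      = (K * (measure lebesgue E / b) + K powr (1 - q) * C powr q) * (a * b)"
    using b by (simp add: field_simps)
  finally show ?thesis
    unfolding ab b_def[symmetric] .
qed

text \<open>Jensen's inequality with a lossy constant: thresholding at half the average leaves half
  of the average to be controlled by the powers.\<close>

lemma ball_average_powr_le:
  fixes V :: "'a::euclidean_space \<Rightarrow> real"
  assumes V: "RHq q C V" and q: "1 < q" and r: "0 < r"
  shows "ball_average x r V powr q \<le> 2 powr q * ball_average x r (\<lambda>y. V y powr q)"
proof -
  define a where "a = ball_average x r V"
  define b where "b = measure lebesgue (ball x r)"
  define M where "M = ball_average x r (\<lambda>y. V y powr q)"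
  have a: "0 < a" unfolding a_def by (rule ball_average_pos[OF V r])
  have b: "0 < b" unfolding b_def by (rule measure_lebesgue_ball_pos[OF r])
  have ab: "mass V (ball x r) = a * b" "mass (\<lambda>y. V y powr q) (ball x r) = M * b"
    using b by (simp_all add: a_def b_def M_def ball_average_def)
  have "mass V (ball x r) \<le> (a / 2) * b + (a / 2) powr (1 - q) * mass (\<lambda>y. V y powr q) (ball x r)"
    unfolding b_def by (rule mass_le_threshold[OF V q]) (use a in auto)
  then have "a * b \<le> (a / 2 + (a / 2) powr (1 - q) * M) * b"
    unfolding ab by (simp add: algebra_simps)
  then have "a \<le> a / 2 + (a / 2) powr (1 - q) * M" using b by simp
  then have "(a / 2) \<le> (a / 2) powr (1 - q) * M" by simp
  then have "(a / 2) powr (q - 1) * (a / 2) \<le> (a / 2) powr (q - 1) * ((a / 2) powr (1 - q) * M)"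
    by (intro mult_left_mono) auto
  also have "\<dots> = M" using a by (simp add: mult.assoc[symmetric] flip: powr_add)
  also have "(a / 2) powr (q - 1) * (a / 2) = (a / 2) powr q"
    using a powr_add[of "a/2" "q - 1" 1] by simp
  finally show ?thesis using a unfolding a_def[symmetric] M_def[symmetric]
    by (simp add: powr_divide field_simps)
qed

text \<open>The A-infinity property, with \<open>d\<close> chosen before \<open>V\<close>.
  Everything below about the weight follows from it.\<close>

lemma mass_abs_continuous:
  assumes q: "1 < q" and C: "1 \<le> C" and e: "0 < e"
  shows "\<exists>d>0. \<forall>(V :: 'a::euclidean_space \<Rightarrow> real) x r E. RHq q C V \<longrightarrow> 0 < r \<longrightarrow>
     E \<in> sets lebesgue \<longrightarrow> E \<subseteq> ball x r \<longrightarrow> measure lebesgue E \<le> d * measure lebesgue (ball x r) \<longrightarrow>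
     mass V E \<le> e * mass V (ball x r)"
proof -
  \<comment> \<open>Solves \<open>K powr (1 - q) * C powr q = e / 2\<close>; the other half of
    \<open>e\<close> then dictates the admissible relative volume \<open>e / 2 / K\<close>.\<close>
  define K where "K = (e / 2 / C powr q) powr (1 / (1 - q))"
  have K: "0 < K" unfolding K_def using e C by simp
  have K': "K powr (1 - q) * C powr q = e / 2"
    unfolding K_def using q e C by (simp add: powr_powr)
  show ?thesis
  proof (intro exI[of _ "e / 2 / K"] conjI allI impI)
    show "0 < e / 2 / K" using e K by simp
    fix V :: "'a \<Rightarrow> real" and x :: 'a and r :: real and E :: "'a set"
    assume V: "RHq q C V" and r: "0 < r" and E: "E \<in> sets lebesgue" "E \<subseteq> ball x r"
      and m: "measure lebesgue E \<le> e / 2 / K * measure lebesgue (ball x r)"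
    have b: "0 < measure lebesgue (ball x r)" by (rule measure_lebesgue_ball_pos[OF r])
    have "K * (measure lebesgue E / measure lebesgue (ball x r)) \<le> e / 2"
      using m K b by (simp add: field_simps)
    then have "(K * (measure lebesgue E / measure lebesgue (ball x r)) + K powr (1 - q) * C powr q)
        * mass V (ball x r) \<le> e * mass V (ball x r)"
      unfolding K' using mass_ball_pos[OF V r, of x] by (intro mult_right_mono) linarith+
    with mass_subset_le[OF V q C K r E] show "mass V E \<le> e * mass V (ball x r)" by linarith
  qed
qed

text \<open>The points where \<open>V\<close> is below half its average carry at most half of the
  mass. If the remaining points had too little volume, absolute continuity would leave them at most
  a quarter, and the two parts could not add up.\<close>

lemma mass_large_values:
  assumes q: "1 < q" and C: "1 \<le> C"
  shows "\<exists>k>0. \<forall>(V :: 'a::euclidean_space \<Rightarrow> real) x r. RHq q C V \<longrightarrow> 0 < r \<longrightarrow>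
     k * measure lebesgue (ball x r) \<le> measure lebesgue {y \<in> ball x r. ball_average x r V / 2 \<le> V y}"
proof -
  obtain d where d: "0 < d" and dd: "\<And>(V :: 'a \<Rightarrow> real) x r E. RHq q C V \<Longrightarrow> 0 < r \<Longrightarrow>
     E \<in> sets lebesgue \<Longrightarrow> E \<subseteq> ball x r \<Longrightarrow> measure lebesgue E \<le> d * measure lebesgue (ball x r) \<Longrightarrow>
     mass V E \<le> 1/4 * mass V (ball x r)"
    using mass_abs_continuous[OF q C, of "1/4"] by force
  show ?thesis
  proof (intro exI[of _ d] conjI allI impI d)
    fix V :: "'a \<Rightarrow> real" and x :: 'a and r :: real
    assume V: "RHq q C V" and r: "0 < r"
    note D = RHq_D[OF V]
    define a where "a = ball_average x r V"
    define E where "E = {y \<in> ball x r. a / 2 \<le> V y}"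
    define F where "F = ball x r - E"
    have b: "0 < measure lebesgue (ball x r)" by (rule measure_lebesgue_ball_pos[OF r])
    have ab: "mass V (ball x r) = a * measure lebesgue (ball x r)"
      using b by (simp add: a_def ball_average_def)
    have a: "0 < a" unfolding a_def by (rule ball_average_pos[OF V r])
    have E: "E \<in> sets lebesgue" unfolding E_def by (rule superlevel_in_ball[OF D(1)])
    then have "F \<in> sets lebesgue" unfolding F_def by (intro sets.Diff) auto
    with E have EF: "E \<in> sets lebesgue" "F \<in> sets lebesgue" "E \<subseteq> ball x r" "F \<subseteq> ball x r"
      by (auto simp: E_def F_def)
    have u: "ball x r = E \<union> F" "E \<inter> F = {}" by (auto simp: E_def F_def)
    have "d * measure lebesgue (ball x r) \<le> measure lebesgue E"
    proof (rule ccontr)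
      assume "\<not> ?thesis"
      then have 1: "mass V E \<le> 1/4 * mass V (ball x r)"
        by (intro dd[OF V r EF(1,3)]) auto
      have "F \<in> fmeasurable lebesgue" by (rule fmeasurableI2[OF fmeasurable_ball EF(4,2)])
      then have c: "set_integrable lebesgue F (\<lambda>y. a / 2)"
        by (auto simp: set_integrable_def fmeasurable_def intro!: integrable_divide integrable_mult_left integrable_real_indicator)
      have 2: "mass V F \<le> (LINT y:F|lebesgue. a / 2)"
        by (rule set_integral_mono[OF set_integrable_subset[OF D(3) EF(2,4)] c]) (auto simp: E_def F_def)
      also have "\<dots> = a / 2 * measure lebesgue F"
        using \<open>F \<in> fmeasurable lebesgue\<close> by (simp add: set_lebesgue_integral_def fmeasurable_def)
      also have "\<dots> \<le> a / 2 * measure lebesgue (ball x r)"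
        using a EF by (intro mult_left_mono measure_mono_fmeasurable) auto
      finally have 2: "mass V F \<le> 1 / 2 * mass V (ball x r)" by (simp add: ab)
      have "mass V (ball x r) = mass V E + mass V F"
        unfolding u(1) by (rule set_integral_Un[OF u(2)])
          (use set_integrable_subset[OF D(3) EF(1,3)] set_integrable_subset[OF D(3) EF(2,4)] in auto)
      with 1 2 mass_ball_pos[OF V r, of x] show False by linarith
    qed
    then show "d * measure lebesgue (ball x r) \<le> measure lebesgue {y \<in> ball x r. ball_average x r V / 2 \<le> V y}"
      by (simp add: E_def a_def)
  qed
qed

text \<open>A thin outer shell has small relative volume, hence at most half of the mass, so
  shrinking the radius by a factor \<open>t\<close> close to 1 costs a factor 2. Finitely many such
  shrinkings halve the radius.\<close>

lemma mass_doubling: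
  assumes q: "1 < q" and C: "1 \<le> C"
  shows "\<exists>D\<ge>1. \<forall>(V :: 'a::euclidean_space \<Rightarrow> real) x r. RHq q C V \<longrightarrow> 0 < r \<longrightarrow>
     mass V (ball x (2 * r)) \<le> D * mass V (ball x r)"
proof -
  obtain d where d: "0 < d" and dd: "\<And>(V :: 'a \<Rightarrow> real) x r E. RHq q C V \<Longrightarrow> 0 < r \<Longrightarrow>
     E \<in> sets lebesgue \<Longrightarrow> E \<subseteq> ball x r \<Longrightarrow> measure lebesgue E \<le> d * measure lebesgue (ball x r) \<Longrightarrow>
     mass V E \<le> 1/2 * mass V (ball x r)"
    using mass_abs_continuous[OF q C, of "1/2"] by force
  \<comment> \<open>The relative volume of the shell between the radii \<open>t * r\<close> and
    \<open>r\<close> is \<open>1 - t ^ DIM('a)\<close>, which tends to 0 as \<open>t\<close>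
    increases to 1.\<close>
  have "((\<lambda>t::real. 1 - t ^ DIM('a)) \<longlongrightarrow> 1 - 1 ^ DIM('a)) (at_left 1)"
    by (intro tendsto_intros)
  then have "\<forall>\<^sub>F t in at_left (1::real). 1 - t ^ DIM('a) < d"
    using d by (intro order_tendstoD(2)) auto
  moreover have "\<forall>\<^sub>F t in at_left (1::real). t \<in> {0<..<1}"
    by (rule eventually_at_left_real) simp
  ultimately have "\<forall>\<^sub>F t in at_left (1::real). 1 - t ^ DIM('a) < d \<and> t \<in> {0<..<1}"
    by eventually_elim auto
  then obtain t :: real where t: "1 - t ^ DIM('a) < d" "0 < t" "t < 1"
    using eventually_happens[of _ "at_left (1::real)"] by auto
  have step: "mass V (ball x r) \<le> 2 * mass V (ball x (t * r))" if V: "RHq q C V" and r: "0 < r"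
    for V :: "'a \<Rightarrow> real" and x r
  proof -
    note D = RHq_D[OF V]
    define E where "E = ball x r - ball x (t * r)"
    have sub: "ball x (t * r) \<subseteq> ball x r" using t r by (intro subset_ball) auto
    have E: "E \<in> sets lebesgue" "E \<subseteq> ball x r" by (auto simp: E_def)
    have "measure lebesgue E = measure lebesgue (ball x r) - measure lebesgue (ball x (t * r))"
      unfolding E_def by (rule measurable_measure_Diff[OF fmeasurable_ball _ sub]) simp
    also have "\<dots> = (1 - t ^ DIM('a)) * measure lebesgue (ball x r)"
      using measure_lebesgue_ball_scale[of r t x x] r t by (simp only: left_diff_distrib)
    also have "\<dots> \<le> d * measure lebesgue (ball x r)"
      using t by (intro mult_right_mono) auto
    finally have "mass V E \<le> 1/2 * mass V (ball x r)" by (intro dd[OF V r E])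
    moreover have "mass V (ball x r) = mass V (ball x (t * r)) + mass V E"
    proof -
      have u: "ball x r = ball x (t * r) \<union> E" "ball x (t * r) \<inter> E = {}"
        using sub by (auto simp: E_def)
      show ?thesis
        by (subst u(1), rule set_integral_Un[OF u(2) D(3) set_integrable_subset[OF D(3) E]])
    qed
    ultimately show ?thesis by linarith
  qed
  have iter: "mass V (ball x r) \<le> 2 ^ j * mass V (ball x (t ^ j * r))" if V: "RHq q C V" and r: "0 < r"
    for V :: "'a \<Rightarrow> real" and x r j
  proof (induction j)
    case (Suc j)
    have "0 < t ^ j * r" using t r by simp
    from step[OF V this, of x]
    have "mass V (ball x (t ^ j * r)) \<le> 2 * mass V (ball x (t ^ Suc j * r))" by (simp add: mult_ac)
    then have "2 ^ j * mass V (ball x (t ^ j * r)) \<le> 2 ^ Suc j * mass V (ball x (t ^ Suc j * r))"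
      by simp
    with Suc show ?case by linarith
  qed simp
  obtain j where j: "t ^ j < 1 / 2"
    using real_arch_pow_inv[of "1/2" t] t by auto
  show ?thesis
  proof (intro exI[of _ "2 ^ j"] conjI allI impI)
    fix V :: "'a \<Rightarrow> real" and x and r :: real
    assume V: "RHq q C V" and r: "0 < r"
    have "mass V (ball x (2 * r)) \<le> 2 ^ j * mass V (ball x (t ^ j * (2 * r)))"
      by (rule iter[OF V]) (use r in simp)
    also have "mass V (ball x (t ^ j * (2 * r))) \<le> mass V (ball x r)"
    proof (rule mass_subset(2))
      show "AE x in lebesgue. 0 \<le> V x" using RHq_D(2)[OF V] by (auto elim!: eventually_mono)
      show "ball x (t ^ j * (2 * r)) \<subseteq> ball x r"
        using j r by (intro subset_ball) (auto simp: field_simps)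
    qed (use RHq_D(3)[OF V] in auto)
    finally show "mass V (ball x (2 * r)) \<le> 2 ^ j * mass V (ball x r)" by (simp add: mult_left_mono)
  qed simp
qed

lemma mass_ball_mono:
  assumes V: "RHq q C V" and sub: "ball y s \<subseteq> ball x r"
  shows "mass V (ball y s) \<le> mass V (ball x r)"
    "mass (\<lambda>y. V y powr q) (ball y s) \<le> mass (\<lambda>y. V y powr q) (ball x r)"
proof -
  have "AE x in lebesgue. 0 \<le> V x" using RHq_D(2)[OF V] by (auto elim!: eventually_mono)
  then show "mass V (ball y s) \<le> mass V (ball x r)"
    by (intro mass_subset(2)[OF RHq_D(3)[OF V] _ _ sub]) auto
  show "mass (\<lambda>y. V y powr q) (ball y s) \<le> mass (\<lambda>y. V y powr q) (ball x r)"
    by (intro mass_subset(2)[OF RHq_D(4)[OF V] _ _ sub]) auto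
qed

text \<open>The two directions, reverse Hoelder and Jensen, make the mass of \<open>V powr q\<close>
  comparable with the \<open>q\<close>-th power of the average of \<open>V\<close>. Properties of
  the weight \<open>V\<close> can thus be carried over to \<open>V powr q\<close> and back.\<close>

lemma mass_powr_compare:
  fixes V :: "'a::euclidean_space \<Rightarrow> real"
  assumes V: "RHq q C V" and q: "1 < q" and C: "1 \<le> C" and r: "0 < r"
  shows "mass (\<lambda>y. V y powr q) (ball x r) \<le> C powr q * ball_average x r V powr q * measure lebesgue (ball x r)"
    and "ball_average x r V powr q * measure lebesgue (ball x r) \<le> 2 powr q * mass (\<lambda>y. V y powr q) (ball x r)"
proof -
  define b where "b = measure lebesgue (ball x r)"
  have b: "0 < b" unfolding b_def by (rule measure_lebesgue_ball_pos[OF r])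
  have e: "mass (\<lambda>y. V y powr q) (ball x r) = ball_average x r (\<lambda>y. V y powr q) * b"
    using b by (simp add: b_def ball_average_def)
  have "(C * ball_average x r V) powr q = C powr q * ball_average x r V powr q"
    using C ball_average_pos[OF V r, of x] by (simp add: powr_mult)
  then have "ball_average x r (\<lambda>y. V y powr q) \<le> C powr q * ball_average x r V powr q"
    using RHq_D(5)[OF V r, of x] by simp
  then show "mass (\<lambda>y. V y powr q) (ball x r) \<le> C powr q * ball_average x r V powr q * measure lebesgue (ball x r)"
    unfolding e b_def[symmetric] using b by (intro mult_right_mono) auto
  show "ball_average x r V powr q * measure lebesgue (ball x r) \<le> 2 powr q * mass (\<lambda>y. V y powr q) (ball x r)"
    unfolding e b_def[symmetric] mult.assoc[symmetric] using b ball_average_powr_le[OF V q r, of x]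
    by (intro mult_right_mono) auto
qed

lemma ball_average_doubling:
  fixes V :: "'a::euclidean_space \<Rightarrow> real"
  assumes "mass V (ball x (2 * r)) \<le> D * mass V (ball x r)" "0 < r"
  shows "2 ^ DIM('a) * ball_average x (2 * r) V \<le> D * ball_average x r V"
proof -
  define b where "b = measure lebesgue (ball x r)"
  have b: "0 < b" unfolding b_def by (rule measure_lebesgue_ball_pos[OF assms(2)])
  have "measure lebesgue (ball x (2 * r)) = 2 ^ DIM('a) * b"
    unfolding b_def using assms(2) by (intro measure_lebesgue_ball_scale) auto
  then show ?thesis
    using assms b unfolding ball_average_def b_def[symmetric] by (simp add: field_simps)
qed

text \<open>Doubling of \<open>V\<close> passes to \<open>V powr q\<close> through the comparison of
  averages on both balls; the constant collects \<open>C\<close> from reverse Hoelder,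
  \<open>D\<close> from doubling and 2 from the lossy Jensen inequality.\<close>

lemma mass_powr_doubling:
  fixes V :: "'a::euclidean_space \<Rightarrow> real"
  assumes V: "RHq q C V" and q: "1 < q" and C: "1 \<le> C" and r: "0 < r" and D: "1 \<le> D"
    and dbl: "mass V (ball x (2 * r)) \<le> D * mass V (ball x r)"
  shows "mass (\<lambda>y. V y powr q) (ball x (2 * r)) \<le> (2 * C * D) powr q * mass (\<lambda>y. V y powr q) (ball x r)"
proof -
  define N where "N = (2::real) ^ DIM('a)"
  define b where "b = measure lebesgue (ball x r)"
  define a where "a = ball_average x r V"
  define a' where "a' = ball_average x (2 * r) V"
  have b: "0 < b" unfolding b_def by (rule measure_lebesgue_ball_pos[OF r])
  have a: "0 < a" "0 < a'" unfolding a_def a'_def using r by (auto intro!: ball_average_pos[OF V])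
  have N: "1 \<le> N" by (simp add: N_def)
  have b': "measure lebesgue (ball x (2 * r)) = N * b"
    unfolding b_def N_def using r by (intro measure_lebesgue_ball_scale) auto
  have "N * a' \<le> D * a"
    unfolding N_def a'_def a_def by (rule ball_average_doubling[OF dbl r])
  then have "(N * a') powr q \<le> (D * a) powr q"
    using N a q by (intro powr_mono2) auto
  then have 1: "N powr q * a' powr q \<le> D powr q * a powr q"
    using N a D by (simp add: powr_mult)
  \<comment> \<open>Since \<open>N\<close> is at least 1 and \<open>q\<close> exceeds 1, the volume
    factor is absorbed by its own power, so the final constant does not involve the
    dimension.\<close>
  have "N * a' powr q \<le> N powr q * a' powr q"
    using N q powr_mono[of 1 q N] by (intro mult_right_mono) auto
  with 1 have 2: "N * a' powr q \<le> D powr q * a powr q" by linarith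
  have "mass (\<lambda>y. V y powr q) (ball x (2 * r)) \<le> C powr q * a' powr q * (N * b)"
    using mass_powr_compare(1)[OF V q C, of "2 * r" x] r unfolding a'_def b' by simp
  also have "\<dots> = C powr q * (N * a' powr q) * b" by simp
  also have "\<dots> \<le> C powr q * (D powr q * a powr q) * b"
    using 2 b by (intro mult_right_mono mult_left_mono) auto
  also have "\<dots> = C powr q * D powr q * (a powr q * b)" by simp
  also have "\<dots> \<le> C powr q * D powr q * (2 powr q * mass (\<lambda>y. V y powr q) (ball x r))"
    unfolding a_def b_def by (intro mult_left_mono mass_powr_compare(2)[OF V q C r]) auto
  also have "\<dots> = (2 * C * D) powr q * mass (\<lambda>y. V y powr q) (ball x r)"
    using C D by (simp add: powr_mult)
  finally show ?thesis .
qed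

text \<open>Every doubling measure on a Euclidean space is reverse doubling: the annulus between
  the balls of radius \<open>r\<close> and \<open>4 r\<close> contains a ball of radius \<open>r\<close>.\<close>

lemma mass_powr_reverse_doubling:
  fixes V :: "'a::euclidean_space \<Rightarrow> real"
  assumes V: "RHq q C V" and r: "0 < r" and E: "0 < E"
    and dbl: "\<And>x r. 0 < r \<Longrightarrow>
      mass (\<lambda>y. V y powr q) (ball x (2 * r)) \<le> E * mass (\<lambda>y. V y powr q) (ball x r)"
  shows "(1 + 1 / E\<^sup>2) * mass (\<lambda>y. V y powr q) (ball x r) \<le> mass (\<lambda>y. V y powr q) (ball x (4 * r))"
proof -
  define M where "M = (\<lambda>x r. mass (\<lambda>y. V y powr q) (ball x r))"
  obtain e :: 'a where e: "e \<in> Basis" using nonempty_Basis by blast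
  \<comment> \<open>At distance \<open>3 * r\<close> the ball around \<open>y\<close> is disjoint
    from the one around \<open>x\<close> and still inside \<open>ball x (4 * r)\<close>. Conversely
    \<open>ball y (4 * r)\<close> covers \<open>ball x r\<close>, so two doublings at
    \<open>y\<close> bound the mass at \<open>x\<close>; this is the origin of
    \<open>E\<^sup>2\<close>.\<close>
  define y where "y = x + (3 * r) *\<^sub>R e"
  have d: "dist x y = 3 * r" using e r by (simp add: y_def dist_norm)
  have "M x r \<le> M y (4 * r)"
    unfolding M_def
  proof (rule mass_ball_mono(2)[OF V], rule subsetI)
    fix z assume "z \<in> ball x r" then show "z \<in> ball y (4 * r)"
      using d dist_triangle[of y z x] by (simp add: dist_commute)
  qed
  also have "\<dots> \<le> E * M y (2 * r)"
    using dbl[of "2 * r" y] r by (simp add: M_def)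
  also have "\<dots> \<le> E * (E * M y r)"
    using dbl[of r y] r E by (intro mult_left_mono) (auto simp: M_def)
  finally have 1: "M x r \<le> E\<^sup>2 * M y r" by (simp add: power2_eq_square mult_ac)
  have dj: "ball x r \<inter> ball y r = {}"
  proof safe
    fix z assume "z \<in> ball x r" "z \<in> ball y r"
    then show "z \<in> {}" using d dist_triangle[of x y z] r by (simp add: dist_commute)
  qed
  have sub: "ball x r \<union> ball y r \<subseteq> ball x (4 * r)"
  proof safe
    fix z assume "z \<in> ball y r"
    then show "z \<in> ball x (4 * r)" using d dist_triangle[of x z y] by (simp add: dist_commute)
  qed (use r in auto)
  have "M x r + M y r = mass (\<lambda>y. V y powr q) (ball x r \<union> ball y r)"
    unfolding M_def by (rule set_integral_Un[OF dj RHq_D(4)[OF V] RHq_D(4)[OF V], symmetric])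
  also have "\<dots> \<le> M x (4 * r)"
    unfolding M_def by (intro mass_subset(2)[OF RHq_D(4)[OF V] _ _ sub]) auto
  finally have "M x r + M y r \<le> M x (4 * r)" .
  moreover have "M x r / E\<^sup>2 \<le> M y r"
    using 1 E by (simp add: pos_divide_le_eq mult.commute)
  ultimately have "M x r + M x r / E\<^sup>2 \<le> M x (4 * r)" by linarith
  then show ?thesis by (simp add: M_def algebra_simps)
qed

text \<open>The radius occurs with the exponent \<open>2 * q - DIM('a)\<close>, which is
  nonnegative, so passing to the larger radius can only help there. The growth \<open>B ^ k\<close>
  comes from \<open>k\<close> quadruplings of the mass of \<open>V powr q\<close>, and
  \<open>(2 * C) powr q\<close> pays for the two comparisons with averages of
  \<open>V\<close>.\<close>

lemma psi_gain_aux: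
  fixes V :: "'a::euclidean_space \<Rightarrow> real"
  assumes V: "RHq q C V" and q: "1 < q" "real DIM('a) / 2 \<le> q" and C: "1 \<le> C" and r: "0 < r"
    and B: "1 \<le> B"
    and rev: "\<And>x r. 0 < r \<Longrightarrow>
      B * mass (\<lambda>y. V y powr q) (ball x r) \<le> mass (\<lambda>y. V y powr q) (ball x (4 * r))"
    and s: "4 ^ k * r \<le> s"
  shows "B ^ k * psi_fun V x r powr q \<le> (2 * C) powr q * psi_fun V x s powr q"
proof -
  define M where "M = (\<lambda>r. mass (\<lambda>y. V y powr q) (ball x r))"
  define w where "w = unit_ball_vol (real DIM('a))"
  have w: "0 < w" by (simp add: w_def)
  define N where "N = real DIM('a)"
  have "r \<le> 4 ^ k * r" using r by simp
  with s have rs: "r \<le> s" by linarith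
  with r have s0: "0 < s" by simp
  have it: "B ^ j * M r \<le> M (4 ^ j * r)" for j
  proof (induction j)
    case (Suc j)
    have "B ^ Suc j * M r \<le> B * M (4 ^ j * r)"
      using Suc B by simp
    also have "\<dots> \<le> M (4 ^ Suc j * r)"
      using rev[of "4 ^ j * r" x] r by (simp add: M_def mult_ac)
    finally show ?case .
  qed simp
  also have "M (4 ^ k * r) \<le> M s"
    unfolding M_def by (intro mass_ball_mono(2)[OF V] subset_ball s)
  finally have 1: "B ^ k * M r \<le> M s" .
  have vol: "measure lebesgue (ball x t) = w * t powr N" if "0 < t" for t
    using that by (simp add: w_def N_def content_ball powr_realpow)
  have psi: "psi_fun V x t powr q = t powr (2 * q) * ball_average x t V powr q" if "0 < t" for t
  proof -
    have "t\<^sup>2 = t powr 2" using that by (simp add: powr_numeral)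
    then show ?thesis
      using ball_average_pos[OF V that, of x] unfolding psi_fun_def by (simp add: powr_mult powr_powr)
  qed
  have split: "t powr (2 * q) = t powr (2 * q - N) * t powr N" if "0 < t" for t
    using that by (simp flip: powr_add)
  have "w * psi_fun V x r powr q = r powr (2 * q - N) * (ball_average x r V powr q * (w * r powr N))"
    unfolding psi[OF r] split[OF r] by simp
  also have "\<dots> \<le> r powr (2 * q - N) * (2 powr q * M r)"
    using mass_powr_compare(2)[OF V q(1) C r, of x] unfolding vol[OF r] M_def
    by (intro mult_left_mono) auto
  finally have 2: "w * psi_fun V x r powr q \<le> 2 powr q * (r powr (2 * q - N) * M r)"
    by (simp only: mult.left_commute)
  have Mnn: "0 \<le> M t" for t unfolding M_def by (intro mass_subset(3)[OF RHq_D(4)[OF V], of _ x t]) auto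
  have "s powr (2 * q - N) * M s \<le> s powr (2 * q - N) * (C powr q * ball_average x s V powr q * (w * s powr N))"
    using mass_powr_compare(1)[OF V q(1) C s0, of x] unfolding vol[OF s0] M_def
    by (intro mult_left_mono) auto
  also have "\<dots> = w * (C powr q * psi_fun V x s powr q)"
    unfolding psi[OF s0] split[OF s0] by simp
  finally have 3: "s powr (2 * q - N) * M s \<le> w * (C powr q * psi_fun V x s powr q)" .
  have "r powr (2 * q - N) \<le> s powr (2 * q - N)"
    using q(2) r rs by (intro powr_mono2) (auto simp: N_def)
  then have "r powr (2 * q - N) * (B ^ k * M r) \<le> s powr (2 * q - N) * M s"
    using 1 Mnn B by (intro mult_mono) auto
  with 3 have "2 powr q * (r powr (2 * q - N) * (B ^ k * M r)) \<le> 2 powr q * (w * (C powr q * psi_fun V x s powr q))"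
    by (intro mult_left_mono) auto
  moreover have "B ^ k * (w * psi_fun V x r powr q) \<le> B ^ k * (2 powr q * (r powr (2 * q - N) * M r))"
    using 2 B by (intro mult_left_mono) auto
  ultimately have "B ^ k * (w * psi_fun V x r powr q) \<le> 2 powr q * (w * (C powr q * psi_fun V x s powr q))"
    by (simp only: mult_ac)
  then have "w * (B ^ k * psi_fun V x r powr q) \<le> w * ((2 * C) powr q * psi_fun V x s powr q)"
    using C by (simp add: powr_mult mult_ac)
  with w show ?thesis by simp
qed

text \<open>Quantitative growth of \<open>psi_fun\<close> in the radius, with \<open>K\<close>
  uniform in \<open>V\<close>. The case \<open>T = 1\<close> is an almost monotonicity, and large
  \<open>T\<close> shows that \<open>psi_fun\<close> tends to 0 and to infinity at the two
  ends.\<close>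

lemma psi_gain:
  fixes q C T :: real
  assumes q: "1 < q" "real DIM('a::euclidean_space) / 2 \<le> q" and C: "1 \<le> C"
  shows "\<exists>K\<ge>1. \<forall>(V :: 'a \<Rightarrow> real) x r s. RHq q C V \<longrightarrow> 0 < r \<longrightarrow> K * r \<le> s \<longrightarrow>
     T * psi_fun V x r \<le> psi_fun V x s"
proof -
  obtain D where D: "1 \<le> D" and dbl: "\<And>(V :: 'a \<Rightarrow> real) x r. RHq q C V \<Longrightarrow> 0 < r \<Longrightarrow>
     mass V (ball x (2 * r)) \<le> D * mass V (ball x r)"
    using mass_doubling[OF q(1) C] by blast
  define E where "E = (2 * C * D) powr q"
  have E: "0 < E" using C D by (simp add: E_def)
  define B where "B = 1 + 1 / E\<^sup>2"
  have B: "1 < B" using E by (simp add: B_def)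
  \<comment> \<open>The maximum with 1 keeps the base positive, so that the powers can be compared
    and removed at the end even when \<open>T\<close> is not positive.\<close>
  obtain k where k: "(2 * C * max T 1) powr q < B ^ k"
    using real_arch_pow[OF B] by blast
  show ?thesis
  proof (intro exI[of _ "4 ^ k"] conjI allI impI)
    fix V :: "'a \<Rightarrow> real" and x :: 'a and r s :: real
    assume V: "RHq q C V" and r: "0 < r" and s: "4 ^ k * r \<le> s"
    have "r \<le> 4 ^ k * r" using r by simp
    with s r have s0: "0 < s" by linarith
    have rev: "B * mass (\<lambda>y. V y powr q) (ball x r) \<le> mass (\<lambda>y. V y powr q) (ball x (4 * r))"
      if "0 < r" for x r
      unfolding B_def
      by (rule mass_powr_reverse_doubling[OF V that E])
        (use mass_powr_doubling[OF V q(1) C _ D] dbl[OF V] in \<open>auto simp: E_def\<close>)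
    have pos: "0 < psi_fun V x r" "0 < psi_fun V x s"
      using ball_average_pos[OF V r] ball_average_pos[OF V s0] r s0 by (auto simp: psi_fun_def)
    have "(2 * C * max T 1) powr q * psi_fun V x r powr q \<le> B ^ k * psi_fun V x r powr q"
      using k by (intro mult_right_mono) auto
    also have "\<dots> \<le> (2 * C) powr q * psi_fun V x s powr q"
      by (rule psi_gain_aux[OF V q C r _ rev s]) (use B in auto)
    finally have "(2 * C * (max T 1 * psi_fun V x r)) powr q \<le> (2 * C * psi_fun V x s) powr q"
      using C pos by (simp add: powr_mult mult_ac)
    then have "2 * C * (max T 1 * psi_fun V x r) \<le> 2 * C * psi_fun V x s"
      using powr_less_mono2[of q "2 * C * psi_fun V x s" "2 * C * (max T 1 * psi_fun V x r)"] q C pos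
      by (force simp: not_le[symmetric])
    then have "max T 1 * psi_fun V x r \<le> psi_fun V x s" using C by simp
    moreover have "T * psi_fun V x r \<le> max T 1 * psi_fun V x r"
      using pos by (intro mult_right_mono) auto
    ultimately show "T * psi_fun V x r \<le> psi_fun V x s" by linarith
  qed simp
qed

text \<open>The only properties of \<open>V\<close> that the remaining argument uses, with the constants
  isolated so that they can be chosen uniformly in \<open>V\<close>.\<close>

definition psi_regular :: "real \<Rightarrow> (real \<Rightarrow> real) \<Rightarrow> real \<Rightarrow> ('a::euclidean_space \<Rightarrow> real) \<Rightarrow> bool" where
  "psi_regular D G k V \<longleftrightarrow> 1 \<le> D \<and> (\<forall>T. 1 \<le> G T) \<and> 0 < k \<and>
     V \<in> borel_measurable lebesgue \<and> (AE x in lebesgue. 0 < V x) \<and>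
     (\<forall>x r. set_integrable lebesgue (ball x r) V) \<and>
     (\<forall>x r. 0 < r \<longrightarrow> 0 < psi_fun V x r) \<and>
     (\<forall>x r. 0 < r \<longrightarrow> psi_fun V x (2 * r) \<le> D * psi_fun V x r) \<and>
     (\<forall>x y r. 0 < r \<longrightarrow> dist x y < 3 * r \<longrightarrow> psi_fun V y r \<le> D * psi_fun V x r) \<and>
     (\<forall>T x r s. 0 < r \<longrightarrow> G T * r \<le> s \<longrightarrow> T * psi_fun V x r \<le> psi_fun V x s) \<and>
     (\<forall>x r. 0 < r \<longrightarrow>
       k * measure lebesgue (ball x r) \<le> measure lebesgue {y \<in> ball x r. ball_average x r V / 2 \<le> V y})"

text \<open>One constant \<open>4 * D\<^sup>2\<close> serves both comparisons: doubling the radius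
  costs 4 from the squared radius and \<open>D\<close> from the mass, and moving the centre by less
  than \<open>3 * r\<close> costs two doublings, because \<open>ball y r\<close> lies in
  \<open>ball x (4 * r)\<close>.\<close>

lemma RHq_psi_regular:
  fixes q C :: real
  assumes q: "1 < q" "real DIM('a::euclidean_space) / 2 \<le> q" and C: "1 \<le> C"
  shows "\<exists>D G k. \<forall>V :: 'a \<Rightarrow> real. RHq q C V \<longrightarrow> psi_regular D G k V"
proof -
  obtain D where D: "1 \<le> D" and dbl: "\<And>(V :: 'a \<Rightarrow> real) x r. RHq q C V \<Longrightarrow> 0 < r \<Longrightarrow>
     mass V (ball x (2 * r)) \<le> D * mass V (ball x r)"
    using mass_doubling[OF q(1) C] by blast
  obtain k where k: "0 < k" and large: "\<And>(V :: 'a \<Rightarrow> real) x r. RHq q C V \<Longrightarrow> 0 < r \<Longrightarrow>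
     k * measure lebesgue (ball x r) \<le> measure lebesgue {y \<in> ball x r. ball_average x r V / 2 \<le> V y}"
    using mass_large_values[OF q(1) C] by blast
  \<comment> \<open>The gain is made a function \<open>G\<close> of all \<open>T\<close> at once:
    the quantitative arguments use values fixed before \<open>V\<close>, while boundedness and
    nonemptiness of sets of radii use values of \<open>T\<close> that depend on
    \<open>V\<close>.\<close>
  have "\<forall>T. \<exists>K\<ge>1. \<forall>(V :: 'a \<Rightarrow> real) x r s. RHq q C V \<longrightarrow> 0 < r \<longrightarrow> K * r \<le> s \<longrightarrow>
     T * psi_fun V x r \<le> psi_fun V x s"
    using psi_gain[OF q C] by blast
  from choice[OF this] obtain G where GG: "\<forall>T. 1 \<le> G T \<and> (\<forall>(V :: 'a \<Rightarrow> real) x r s. RHq q C V \<longrightarrow> 0 < r \<longrightarrow> G T * r \<le> s \<longrightarrow>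
     T * psi_fun V x r \<le> psi_fun V x s)" ..
  then have G: "\<And>T. 1 \<le> G T" and gain: "\<And>T (V :: 'a \<Rightarrow> real) x r s. RHq q C V \<Longrightarrow> 0 < r \<Longrightarrow>
     G T * r \<le> s \<Longrightarrow> T * psi_fun V x r \<le> psi_fun V x s"
    by blast+
  have D4: "D \<le> 4 * D\<^sup>2" "D * D \<le> 4 * D\<^sup>2" "4 * D \<le> 4 * D\<^sup>2" "1 \<le> 4 * D\<^sup>2"
    using D mult_mono[of 1 D 1 D] mult_right_mono[of 1 D D] by (auto simp: power2_eq_square)
  show ?thesis
  proof (rule exI[of _ "4 * D\<^sup>2"], rule exI[of _ G], rule exI[of _ k], intro allI impI)
    fix V :: "'a \<Rightarrow> real" assume V: "RHq q C V"
    have pos: "0 < psi_fun V x r" if "0 < r" for x r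
      using ball_average_pos[OF V that] that by (auto simp: psi_fun_def)
    have 1: "psi_fun V x (2 * r) \<le> 4 * D\<^sup>2 * psi_fun V x r" if r: "0 < r" for x r
    proof -
      have "ball_average x (2 * r) V \<le> 2 ^ DIM('a) * ball_average x (2 * r) V"
        using ball_average_pos[OF V, of "2 * r" x] r by simp
      also have "\<dots> \<le> D * ball_average x r V"
        by (rule ball_average_doubling[OF dbl[OF V r] r])
      finally have "psi_fun V x (2 * r) \<le> 4 * D * psi_fun V x r"
        using r by (simp add: psi_fun_def power_mult_distrib mult_left_mono mult_ac)
      also have "\<dots> \<le> 4 * D\<^sup>2 * psi_fun V x r"
        using D4 pos[OF r, of x] by (intro mult_right_mono) auto
      finally show ?thesis .
    qed
    have 2: "psi_fun V y r \<le> 4 * D\<^sup>2 * psi_fun V x r" if r: "0 < r" and d: "dist x y < 3 * r" for x y r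
    proof -
      define b where "b = measure lebesgue (ball x r)"
      have b: "0 < b" unfolding b_def by (rule measure_lebesgue_ball_pos[OF r])
      have b': "measure lebesgue (ball y r) = b"
        unfolding b_def using measure_lebesgue_ball_scale[of r 1 y x] r by (simp del: measure_completion)
      have "mass V (ball y r) \<le> mass V (ball x (2 * (2 * r)))"
      proof (rule mass_ball_mono(1)[OF V], rule subsetI)
        fix z assume "z \<in> ball y r" then show "z \<in> ball x (2 * (2 * r))"
          using d dist_triangle[of x z y] by simp
      qed
      also have "\<dots> \<le> D * mass V (ball x (2 * r))" using dbl[OF V, of "2 * r" x] r by simp
      also have "\<dots> \<le> D * (D * mass V (ball x r))"
        using dbl[OF V r, of x] D by (intro mult_left_mono) auto
      finally have "psi_fun V y r \<le> D * D * psi_fun V x r"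
        unfolding psi_fun_def ball_average_def b' b_def[symmetric] using b r
        by (simp add: field_simps)
      also have "\<dots> \<le> 4 * D\<^sup>2 * psi_fun V x r"
        using D4 pos[OF r, of x] by (intro mult_right_mono) auto
      finally show ?thesis .
    qed
    show "psi_regular (4 * D\<^sup>2) G k V"
      unfolding psi_regular_def
      by (intro conjI allI impI D4(4) G k pos 1 2 gain[OF V] large[OF V] RHq_D(1-3)[OF V])
  qed
qed

section \<open>Bounds for \<open>m_fun\<close> and critical radii\<close>

lemma psi_regularD:
  assumes "psi_regular D G k V"
  shows "1 \<le> D" "1 \<le> G T" "0 < k" "V \<in> borel_measurable lebesgue" "AE x in lebesgue. 0 < V x"
    "set_integrable lebesgue (ball x r) V"
    "0 < r \<Longrightarrow> 0 < psi_fun V x r"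
    "0 < r \<Longrightarrow> psi_fun V x (2 * r) \<le> D * psi_fun V x r"
    "0 < r \<Longrightarrow> dist x y < 3 * r \<Longrightarrow> psi_fun V y r \<le> D * psi_fun V x r"
    "0 < r \<Longrightarrow> G T * r \<le> s \<Longrightarrow> T * psi_fun V x r \<le> psi_fun V x s"
    "0 < r \<Longrightarrow>
       k * measure lebesgue (ball x r) \<le> measure lebesgue {y \<in> ball x r. ball_average x r V / 2 \<le> V y}"
  using assms unfolding psi_regular_def by simp_all

text \<open>Moving the centre raises the bound on \<open>psi_fun\<close> at radius \<open>R\<close>
  to \<open>D * T\<close>; shrinking the radius by \<open>G (D * T)\<close> divides it by
  \<open>D * T\<close>. So \<open>R / G (D * T)\<close> belongs to the set whose supremum is the
  reciprocal of \<open>m_fun V z\<close>.\<close>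

lemma m_fun_le:
  assumes reg: "psi_regular D G k V" and T: "0 < T" and R: "0 < R" "psi_fun V x R \<le> T"
    and z: "dist x z < 3 * R"
  shows "m_fun V z \<le> G (D * T) / R"
proof -
  note P = psi_regularD[OF reg]
  define K where "K = G (D * T)"
  have K: "1 \<le> K" using P(2) by (simp add: K_def)
  define S where "S = {r. 0 < r \<and> psi_fun V z r \<le> 1}"
  have DT: "0 < D * T" using P(1) T by simp
  have "psi_fun V z R \<le> D * psi_fun V x R" by (rule P(9)[OF R(1) z])
  also have "\<dots> \<le> D * T" using R P(1) by (intro mult_left_mono) auto
  finally have "psi_fun V z R \<le> D * T" .
  moreover have "D * T * psi_fun V z (R / K) \<le> psi_fun V z R"
    by (rule P(10)) (use R K in \<open>auto simp: K_def\<close>)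
  ultimately have "D * T * psi_fun V z (R / K) \<le> D * T * 1" by simp
  with DT have "psi_fun V z (R / K) \<le> 1" by (simp only: mult_le_cancel_left_pos)
  then have mem: "R / K \<in> S" using R K by (simp add: S_def)
  \<comment> \<open>\<open>Sup\<close> of an unbounded set of reals is unspecified, so boundedness
    is needed before membership gives a lower bound for it. Beyond the stated radius
    \<open>psi_fun\<close> is at least 2.\<close>
  have "bdd_above S"
  proof (rule bdd_aboveI)
    fix r assume r: "r \<in> S"
    show "r \<le> G (2 / psi_fun V z 1)"
    proof (rule ccontr)
      assume "\<not> ?thesis"
      then have "2 / psi_fun V z 1 * psi_fun V z 1 \<le> psi_fun V z r" by (intro P(10)) auto
      with r P(7)[of 1 z] show False by (simp add: S_def)
    qed
  qed
  then have "R / K \<le> Sup S" by (rule cSup_upper[OF mem])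
  moreover have "0 < R / K" using R K by simp
  ultimately have "1 / Sup S \<le> 1 / (R / K)" 
    by (intro divide_left_mono mult_pos_pos) linarith+
  then show ?thesis by (simp add: m_fun_def S_def K_def)
qed

text \<open>A radius of the sublevel set that exceeds half of its supremum has its double outside,
  while doubling raises \<open>psi_fun\<close> by at most \<open>D\<close>. The factor
  \<open>D\<close> between the two bounds is the tolerance of this selection.\<close>

lemma critical_radius_exists:
  assumes reg: "psi_regular D G k V" and T: "0 < T"
  shows "\<exists>R>0. T \<le> psi_fun V x R \<and> psi_fun V x R \<le> D * T"
proof -
  note P = psi_regularD[OF reg]
  define S where "S = {r. 0 < r \<and> psi_fun V x r < T}"
  have p1: "0 < psi_fun V x 1" by (rule P(7)) simp
  \<comment> \<open>Chosen so that \<open>psi_fun V x (1 / K)\<close> is at most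
    \<open>T / 2\<close>, which makes the sublevel set nonempty.\<close>
  define K where "K = G (2 * psi_fun V x 1 / T)"
  have K: "1 \<le> K" using P(2) by (simp add: K_def)
  have "2 * psi_fun V x 1 / T * psi_fun V x (1 / K) \<le> psi_fun V x 1"
    by (rule P(10)) (use K in \<open>auto simp: K_def\<close>)
  then have "2 * psi_fun V x (1 / K) \<le> T" using p1 T by (simp add: field_simps)
  then have "1 / K \<in> S" using K T P(7)[of "1 / K" x] by (auto simp: S_def)
  moreover have bdd: "bdd_above S"
  proof (rule bdd_aboveI)
    fix r assume r: "r \<in> S"
    show "r \<le> G (T / psi_fun V x 1)"
    proof (rule ccontr)
      assume "\<not> ?thesis"
      then have "T / psi_fun V x 1 * psi_fun V x 1 \<le> psi_fun V x r" by (intro P(10)) auto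
      with r p1 show False by (simp add: S_def)
    qed
  qed
  ultimately have "0 < Sup S" using K by (intro less_le_trans[OF _ cSup_upper[of "1/K"]]) auto
  then obtain r where r: "r \<in> S" "Sup S / 2 < r"
    using less_cSupE[of "Sup S / 2" S] \<open>1 / K \<in> S\<close> by auto
  have "2 * r \<notin> S" using cSup_upper[OF _ bdd, of "2 * r"] r by auto
  then have "T \<le> psi_fun V x (2 * r)" using r by (auto simp: S_def)
  moreover have "psi_fun V x (2 * r) \<le> D * T"
  proof -
    have "psi_fun V x (2 * r) \<le> D * psi_fun V x r" using P(8)[of r x] r by (simp add: S_def)
    also have "\<dots> \<le> D * T" using r P(1) by (intro mult_left_mono) (auto simp: S_def)
    finally show ?thesis .
  qed
  ultimately show ?thesis using r by (intro exI[of _ "2 * r"]) (auto simp: S_def)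
qed

text \<open>If one radius were larger by more than the stated factor, \<open>psi_fun\<close> at a
  common centre would gain \<open>2 * D\<^sup>2\<close>, whereas the tolerance and the change of
  centre allow only \<open>D\<^sup>2\<close>. The level \<open>T\<close> cancels, so the factor can
  be fixed before \<open>T\<close>.\<close>

lemma critical_radius_compare:
  assumes reg: "psi_regular D G k V" and T: "0 < T"
    and R: "0 < R" "T \<le> psi_fun V x R" "psi_fun V x R \<le> D * T"
    and S: "0 < S" "T \<le> psi_fun V z S" "psi_fun V z S \<le> D * T"
    and d: "dist x z < 3 * R"
  shows "R \<le> G (2 * D\<^sup>2) * S" "S \<le> G (2 * D\<^sup>2) * R"
proof -
  note P = psi_regularD[OF reg]
  have D: "1 \<le> D" by (rule P(1))
  show "R \<le> G (2 * D\<^sup>2) * S"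
  proof (rule ccontr)
    assume "\<not> ?thesis"
    then have "2 * D\<^sup>2 * psi_fun V z S \<le> psi_fun V z R" by (intro P(10) S) auto
    also have "\<dots> \<le> D * psi_fun V x R" by (rule P(9)[OF R(1) d])
    also have "\<dots> \<le> D * (D * T)" using R D by (intro mult_left_mono) auto
    finally have "D\<^sup>2 * (2 * psi_fun V z S) \<le> D\<^sup>2 * T" by (simp add: power2_eq_square)
    then have "2 * psi_fun V z S \<le> T" using D by (simp add: mult_le_cancel_left)
    with S T show False by linarith
  qed
  show "S \<le> G (2 * D\<^sup>2) * R"
  proof (rule ccontr)
    assume "\<not> ?thesis"
    then have "2 * D\<^sup>2 * psi_fun V z R \<le> psi_fun V z S" by (intro P(10) R) auto
    also have "\<dots> \<le> D * T" by (rule S)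
    finally have "D * (2 * (D * psi_fun V z R)) \<le> D * T" by (simp add: power2_eq_square)
    then have "2 * (D * psi_fun V z R) \<le> T" using D by (simp add: mult_le_cancel_left)
    moreover have "psi_fun V x R \<le> D * psi_fun V z R"
      using P(9)[OF R(1), of z x] d by (simp add: dist_commute)
    ultimately show False using R T by linarith
  qed
qed

section \<open>Reduction of \<open>reverse_Holder\<close> to \<open>RHq\<close>\<close>

lemma in_Lp_loc_measurable:
  assumes "in_Lp_loc p f"
  shows "f \<in> borel_measurable lebesgue"
proof (rule borel_measurable_LIMSEQ_metric)
  fix k :: nat
  show "(\<lambda>x. indicat_real (cball 0 (real k)) x *\<^sub>R f x) \<in> borel_measurable lebesgue"
    using assms unfolding in_Lp_loc_def in_Lp_def set_borel_measurable_def by simp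
next
  fix x
  show "(\<lambda>k. indicat_real (cball 0 (real k)) x *\<^sub>R f x) \<longlonglongrightarrow> f x"
  proof (rule tendsto_eventually)
    obtain k0 :: nat where "norm x \<le> real k0" using real_arch_simple by blast
    then show "\<forall>\<^sub>F k in sequentially. indicat_real (cball 0 (real k)) x *\<^sub>R f x = f x"
      unfolding eventually_sequentially by (intro exI[of _ k0]) (auto simp: indicator_def)
  qed
qed

lemma set_integrable_bounded:
  fixes f :: "'a::euclidean_space \<Rightarrow> 'b::euclidean_space"
  assumes "f \<in> borel_measurable lebesgue" "B \<in> fmeasurable lebesgue"
    and "AE x in lebesgue. x \<in> B \<longrightarrow> norm (f x) \<le> M"
  shows "set_integrable lebesgue B f"
  unfolding set_integrable_def
proof (rule Bochner_Integration.integrable_bound[where f = "\<lambda>x. indicat_real B x * M"])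
  show "integrable lebesgue (\<lambda>x. indicat_real B x * M)"
    using assms(2) by (auto simp: fmeasurable_def)
  show "(\<lambda>x. indicat_real B x *\<^sub>R f x) \<in> borel_measurable lebesgue"
    using assms by (intro borel_measurable_scaleR borel_measurable_indicator) (auto simp: fmeasurable_def)
  show "AE x in lebesgue. norm (indicat_real B x *\<^sub>R f x) \<le> norm (indicat_real B x * M)"
    using assms(3) by eventually_elim (auto simp: indicator_def)
qed

lemma AE_restrict_lebesgue:
  assumes "S \<in> sets lebesgue"
  shows "(AE x in restrict_space lebesgue S. P x) \<longleftrightarrow> (AE x in lebesgue. x \<in> S \<longrightarrow> P x)"
  by (rule AE_restrict_space_iff) (use assms in simp)

lemma Linfty_norm_AE:
  assumes "Linfty_norm S f < \<infinity>" "S \<in> sets lebesgue"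
  obtains M where "AE x in lebesgue. x \<in> S \<longrightarrow> norm (f x) \<le> M"
proof -
  obtain M where "Linfty_norm S f \<le> ereal M"
    using assms(1) by (cases "Linfty_norm S f") auto
  moreover have "AE x in lebesgue. x \<in> S \<longrightarrow> ereal (norm (f x)) \<le> Linfty_norm S f"
    using esssup_AE[of "\<lambda>x. ereal (norm (f x))" "restrict_space lebesgue S"]
    unfolding AE_restrict_lebesgue[OF assms(2)] Linfty_norm_def .
  ultimately show thesis
    by (intro that[of M]) (auto elim!: eventually_mono intro: order_trans simp flip: ereal_less_eq(3))
qed

text \<open>An essential bound of \<open>V\<close> by a multiple of its average bounds the average
  of every finite power with the same multiple, so \<open>q\<close> is free here.\<close>

lemma reverse_Holder_infinity:
  fixes V :: "'a::euclidean_space \<Rightarrow> real"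
  assumes V: "reverse_Holder \<infinity> C V" and q: "1 < q"
  shows "RHq q (max 1 C) V"
proof -
  have loc: "in_Lp_loc \<infinity> V" and pos: "AE x in lebesgue. 0 < V x"
    and H: "\<And>x r. 0 < r \<Longrightarrow> Linfty_norm (ball x r) V \<le> ereal (C * ball_average x r V)"
    using V by (auto simp: reverse_Holder_def)
  have meas: "V \<in> borel_measurable lebesgue" by (rule in_Lp_loc_measurable[OF loc])
  then have measq: "(\<lambda>y. V y powr q) \<in> borel_measurable lebesgue" by simp
  have bd: "\<exists>M. AE y in lebesgue. y \<in> ball x r \<longrightarrow> norm (V y) \<le> M" for x r
  proof -
    have "Linfty_norm (cball x r) V < \<infinity>"
      using loc by (simp add: in_Lp_loc_def in_Lp_def)
    then obtain M where "AE y in lebesgue. y \<in> cball x r \<longrightarrow> norm (V y) \<le> M"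
      by (rule Linfty_norm_AE) auto
    then show ?thesis by (intro exI[of _ M]) (auto elim!: eventually_mono)
  qed
  have i1: "set_integrable lebesgue (ball x r) V" for x r
    using bd[of x r] by (elim exE) (rule set_integrable_bounded[OF meas fmeasurable_ball])
  have i2: "set_integrable lebesgue (ball x r) (\<lambda>y. V y powr q)" for x r
  proof -
    obtain M where "AE y in lebesgue. y \<in> ball x r \<longrightarrow> norm (V y) \<le> M" using bd by blast
    with pos have "AE y in lebesgue. y \<in> ball x r \<longrightarrow> norm (V y powr q) \<le> M powr q"
      by eventually_elim (use q in \<open>auto intro!: powr_mono2\<close>)
    then show ?thesis by (intro set_integrable_bounded measq) auto
  qed
  have "ball_average x r (\<lambda>y. V y powr q) \<le> (max 1 C * ball_average x r V) powr q" if r: "0 < r" for x r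
  proof -
    define a where "a = ball_average x r V"
    have b: "0 < measure lebesgue (ball x r)" by (rule measure_lebesgue_ball_pos[OF r])
    have a: "0 \<le> a" unfolding a_def ball_average_def set_lebesgue_integral_def using pos
      by (intro divide_nonneg_nonneg integral_nonneg_AE) (auto elim!: eventually_mono)
    have "AE y in lebesgue. y \<in> ball x r \<longrightarrow> ereal (norm (V y)) \<le> Linfty_norm (ball x r) V"
      using esssup_AE[of "\<lambda>x. ereal (norm (V x))" "restrict_space lebesgue (ball x r)"]
      by (subst (asm) AE_restrict_lebesgue) (auto simp: Linfty_norm_def)
    then have "AE y in lebesgue. y \<in> ball x r \<longrightarrow> norm (V y) \<le> C * a"
      using H[OF r, of x] unfolding a_def
      by (auto elim!: eventually_mono intro: order_trans simp flip: ereal_less_eq(3))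
    then have *: "AE y in lebesgue. y \<in> ball x r \<longrightarrow> norm (V y) \<le> max 1 C * a"
      by eventually_elim (use a in \<open>auto intro: order_trans[OF _ mult_right_mono]\<close>)
    have "mass (\<lambda>y. V y powr q) (ball x r) \<le> (LINT y:ball x r|lebesgue. (max 1 C * a) powr q)"
      unfolding set_lebesgue_integral_def
    proof (rule integral_mono_AE)
      show "integrable lebesgue (\<lambda>y. indicat_real (ball x r) y *\<^sub>R (max 1 C * a) powr q)"
        using fmeasurable_ball[of x r]
        by (intro integrable_scaleR_left integrable_real_indicator) (auto simp: fmeasurable_def)
      show "AE y in lebesgue. indicat_real (ball x r) y *\<^sub>R V y powr q
          \<le> indicat_real (ball x r) y *\<^sub>R (max 1 C * a) powr q"
        using * pos by eventually_elim (use q in \<open>auto simp: indicator_def intro!: powr_mono2\<close>)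
    qed (use i2 in \<open>auto simp: set_integrable_def\<close>)
    also have "\<dots> = (max 1 C * a) powr q * measure lebesgue (ball x r)"
      by (simp add: set_lebesgue_integral_def)
    finally show ?thesis
      using b unfolding a_def[symmetric] by (simp add: ball_average_def pos_divide_le_eq)
  qed
  then show ?thesis
    unfolding RHq_def using meas pos i1 i2 by blast
qed

text \<open>Local integrability of \<open>V\<close> itself follows from
  \<open>V \<le> 1 + V powr q\<close>; the reverse Hoelder inequality is raised to the power
  \<open>q\<close>.\<close>

lemma reverse_Holder_finite:
  fixes V :: "'a::euclidean_space \<Rightarrow> real"
  assumes V: "reverse_Holder p C V" and p: "p \<noteq> \<infinity>" and q: "q = enn2real p" "1 < q"
  shows "RHq q (max 1 C) V"
proof -
  have loc: "in_Lp_loc p V" and pos: "AE x in lebesgue. 0 < V x"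
    and H: "\<And>x r. 0 < r \<Longrightarrow> ball_average x r (\<lambda>y. V y powr q) powr (1 / q) \<le> C * ball_average x r V"
    using V p by (auto simp: reverse_Holder_def q)
  have meas[measurable]: "V \<in> borel_measurable lebesgue" by (rule in_Lp_loc_measurable[OF loc])
  have i: "set_integrable lebesgue (cball x r) (\<lambda>y. norm (V y) powr q)" for x r
    using loc p by (simp add: in_Lp_loc_def in_Lp_def q)
  have i2: "set_integrable lebesgue (ball x r) (\<lambda>y. V y powr q)" for x r
  proof -
    have "set_integrable lebesgue (ball x r) (\<lambda>y. norm (V y) powr q)"
      by (rule set_integrable_subset[OF i[of x r]]) auto
    then show ?thesis
      unfolding set_integrable_def
    proof (rule integrable_cong_AE_imp)
      show "(\<lambda>y. indicat_real (ball x r) y *\<^sub>R V y powr q) \<in> borel_measurable lebesgue"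
        by (intro borel_measurable_scaleR borel_measurable_indicator powr_real_measurable meas) auto
    qed (use pos in \<open>auto elim!: eventually_mono\<close>)
  qed
  have i1: "set_integrable lebesgue (ball x r) V" for x r
  proof -
    have "set_integrable lebesgue (ball x r) (\<lambda>y. 1 + V y powr q)"
      by (intro set_integral_add(1) i2 set_integrable_bounded[where M = 1]) auto
    then show ?thesis
      unfolding set_integrable_def
    proof (rule Bochner_Integration.integrable_bound)
      show "AE y in lebesgue. norm (indicat_real (ball x r) y *\<^sub>R V y)
          \<le> norm (indicat_real (ball x r) y *\<^sub>R (1 + V y powr q))"
        using pos
      proof eventually_elim
        case (elim y)
        have "V y \<le> 1 + V y powr q"
        proof (cases "V y \<le> 1")
          case False
          then have "V y powr 1 \<le> V y powr q" using q by (intro powr_mono) auto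
          with elim show ?thesis by simp
        qed (simp add: add_increasing2)
        with elim show ?case by (auto simp: indicator_def)
      qed
      show "(\<lambda>y. indicat_real (ball x r) y *\<^sub>R V y) \<in> borel_measurable lebesgue"
        by (intro borel_measurable_scaleR borel_measurable_indicator meas) auto
    qed
  qed
  have "ball_average x r (\<lambda>y. V y powr q) \<le> (max 1 C * ball_average x r V) powr q" if r: "0 < r" for x r
  proof -
    define a where "a = ball_average x r V"
    define M where "M = ball_average x r (\<lambda>y. V y powr q)"
    have a: "0 \<le> a" unfolding a_def ball_average_def set_lebesgue_integral_def using pos
      by (intro divide_nonneg_nonneg integral_nonneg_AE) (auto elim!: eventually_mono)
    have M: "0 \<le> M" unfolding M_def ball_average_def set_lebesgue_integral_def
      by (intro divide_nonneg_nonneg integral_nonneg_AE) auto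
    have "C * a \<le> max 1 C * a" using a by (intro mult_right_mono) auto
    with H[OF r, of x] have "M powr (1 / q) \<le> max 1 C * a" by (simp add: a_def M_def)
    then have "(M powr (1 / q)) powr q \<le> (max 1 C * a) powr q"
      using q by (intro powr_mono2) auto
    with M q show ?thesis by (simp add: powr_powr M_def a_def)
  qed
  then show ?thesis
    unfolding RHq_def using meas pos i1 i2 by blast
qed

text \<open>For an infinite exponent, \<open>max 2 (DIM('a))\<close> is an exponent that exceeds 1,
  is at least half the dimension and depends on the dimension alone. Replacing \<open>C\<close> by
  \<open>max 1 C\<close> meets the convention of the previous lemmas.\<close>

lemma reverse_Holder_regular:
  fixes C :: real and p :: ennreal
  assumes "ennreal (real DIM('a::euclidean_space) / 2) \<le> p" "1 < p"
  shows "\<exists>D G k. \<forall>V :: 'a \<Rightarrow> real. reverse_Holder p C V \<longrightarrow> psi_regular D G k V"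
proof (cases "p = \<infinity>")
  case True
  have "\<exists>D G k. \<forall>V :: 'a \<Rightarrow> real. RHq (max 2 (real DIM('a))) (max 1 C) V \<longrightarrow> psi_regular D G k V"
    by (rule RHq_psi_regular) auto
  moreover have "RHq (max 2 (real DIM('a))) (max 1 C) V" if "reverse_Holder p C V" for V :: "'a \<Rightarrow> real"
    using that True by (intro reverse_Holder_infinity) auto
  ultimately show ?thesis by blast
next
  case False
  have q: "1 < enn2real p" "real DIM('a) / 2 \<le> enn2real p"
    using assms False by (cases p; simp add: ennreal_less_iff flip: ennreal_1)+
  have "\<exists>D G k. \<forall>V :: 'a \<Rightarrow> real. RHq (enn2real p) (max 1 C) V \<longrightarrow> psi_regular D G k V"
    by (rule RHq_psi_regular) (use q in auto)
  moreover have "RHq (enn2real p) (max 1 C) V" if "reverse_Holder p C V" for V :: "'a \<Rightarrow> real"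
    using that False q by (intro reverse_Holder_finite) auto
  ultimately show ?thesis by blast
qed

section \<open>Smooth functions\<close>

lemma partial_deriv_eq:
  assumes "(f has_derivative f') (at x)"
  shows "partial_deriv i f x = f' (axis i 1)"
  using frechet_derivative_at[OF assms] by (simp add: partial_deriv_def)

lemma has_derivative_grad:
  fixes f :: "real^'n::finite \<Rightarrow> real"
  assumes "f differentiable (at x)"
  shows "(f has_derivative (\<lambda>h. grad f x \<bullet> h)) (at x)"
proof -
  let ?F = "frechet_derivative f (at x)"
  have d: "(f has_derivative ?F) (at x)" using assms frechet_derivative_works by blast
  then interpret bounded_linear ?F by (rule has_derivative_bounded_linear)
  have "?F h = grad f x \<bullet> h" for h
  proof -
    have "?F h = ?F (\<Sum>i\<in>UNIV. h $ i *\<^sub>R axis i 1)"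
      using basis_expansion[of h] by (simp add: scalar_mult_eq_scaleR)
    also have "\<dots> = (\<Sum>i\<in>UNIV. h $ i * partial_deriv i f x)"
      by (simp add: sum scaleR partial_deriv_def)
    also have "\<dots> = grad f x \<bullet> h" by (simp add: grad_def inner_vec_def mult.commute)
    finally show ?thesis .
  qed
  then have "?F = (\<lambda>h. grad f x \<bullet> h)" by auto
  with d show ?thesis by simp
qed

lemma C_k_Suc_imp: "C_k (Suc k) f \<Longrightarrow> C_k k f"
proof (induction k arbitrary: f)
  case 0
  then show ?case by (simp add: differentiable_imp_continuous_on)
qed simp

lemma C_k_const: "C_k k (\<lambda>x. c)"
proof (induction k arbitrary: c)
  case (Suc k)
  have "partial_deriv i (\<lambda>x. c) = (\<lambda>x. 0)" for i :: 'a
    by (rule ext, subst partial_deriv_eq[OF has_derivative_const]) simp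
  with Suc show ?case by simp
qed simp

lemma differentiable_on_UNIV_D: "f differentiable_on UNIV \<Longrightarrow> f differentiable (at x)"
  by (simp add: differentiable_on_def)

lemma partial_deriv_add:
  assumes "f differentiable_on UNIV" "g differentiable_on UNIV"
  shows "partial_deriv i (\<lambda>x. f x + g x) = (\<lambda>x. partial_deriv i f x + partial_deriv i g x)"
proof
  fix x
  have "(f has_derivative frechet_derivative f (at x)) (at x)"
    "(g has_derivative frechet_derivative g (at x)) (at x)"
    using assms frechet_derivative_works by (auto dest: differentiable_on_UNIV_D)
  from has_derivative_add[OF this]
  show "partial_deriv i (\<lambda>x. f x + g x) x = partial_deriv i f x + partial_deriv i g x"
    by (subst partial_deriv_eq) (auto simp: partial_deriv_def)
qed

lemma partial_deriv_mult:
  assumes "f differentiable_on UNIV" "g differentiable_on UNIV"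
  shows "partial_deriv i (\<lambda>x. f x * g x) = (\<lambda>x. partial_deriv i f x * g x + f x * partial_deriv i g x)"
proof
  fix x
  have "(f has_derivative frechet_derivative f (at x)) (at x)"
    "(g has_derivative frechet_derivative g (at x)) (at x)"
    using assms frechet_derivative_works by (auto dest: differentiable_on_UNIV_D)
  from partial_deriv_eq[OF has_derivative_mult[OF this]]
  show "partial_deriv i (\<lambda>x. f x * g x) x = partial_deriv i f x * g x + f x * partial_deriv i g x"
    by (simp add: partial_deriv_def)
qed

lemma C_k_add: "C_k k f \<Longrightarrow> C_k k g \<Longrightarrow> C_k k (\<lambda>x. f x + g x)"
  by (induction k arbitrary: f g) (auto simp: partial_deriv_add intro!: continuous_intros)

lemma C_k_mult: "C_k k f \<Longrightarrow> C_k k g \<Longrightarrow> C_k k (\<lambda>x. f x * g x)"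
proof (induction k arbitrary: f g)
  case (Suc k)
  then show ?case
    using C_k_Suc_imp[OF Suc.prems(1)] C_k_Suc_imp[OF Suc.prems(2)]
    by (auto simp: partial_deriv_mult intro!: C_k_add Suc.IH)
qed (auto intro!: continuous_intros)

lemma C_k_component: "C_k k (\<lambda>x :: real^'n::finite. x $ i - c)"
proof (cases k)
  case (Suc k)
  have d: "((\<lambda>x. x $ i - c) has_derivative (\<lambda>h. h $ i)) (at x)" for x :: "real^'n"
    by (auto intro!: derivative_eq_intros bounded_linear_vec_nth bounded_linear_imp_has_derivative)
  have "partial_deriv j (\<lambda>x :: real^'n. x $ i - c) = (\<lambda>x. axis j 1 $ i)" for j
    by (rule ext, subst partial_deriv_eq[OF d]) simp
  moreover have "(\<lambda>x :: real^'n. x $ i - c) differentiable_on UNIV"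
    using d by (auto simp: differentiable_on_def differentiable_def)
  ultimately show ?thesis using Suc C_k_const by auto
qed (auto intro!: continuous_intros)

text \<open>The polynomial factor makes the family closed under differentiation, so smoothness
  follows by one induction with \<open>p\<close> arbitrary. The case \<open>p = 1\<close> is the
  classical flat function.\<close>

definition exp_bump :: "real poly \<Rightarrow> real \<Rightarrow> real" where
  "exp_bump p t = (if 0 < t then poly p (1 / t) * exp (- (1 / t)) else 0)"

lemma poly_exp_tendsto_0: "((\<lambda>s. poly p s * exp (- s)) \<longlongrightarrow> 0) (at_top :: real filter)"
proof -
  have mon: "((\<lambda>s. s ^ k * exp (- s)) \<longlongrightarrow> 0) (at_top :: real filter)" for k
    using tendsto_power_div_exp_0[of k] by (simp add: exp_minus field_simps)
  have "((\<lambda>s. \<Sum>i\<le>degree p. coeff p i * (s ^ i * exp (- s))) \<longlongrightarrow> (\<Sum>i\<le>degree p. coeff p i * 0)) (at_top :: real filter)"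
    by (intro tendsto_sum tendsto_mult tendsto_const mon)
  then show ?thesis by (simp add: poly_altdef sum_distrib_right mult.assoc)
qed

lemma exp_bump_tendsto_0: "((\<lambda>t. exp_bump p t) \<longlongrightarrow> 0) (at 0)"
proof -
  have "((\<lambda>t. poly p (1 / t) * exp (- (1 / t))) \<longlongrightarrow> 0) (at_right 0)"
    using filterlim_compose[OF poly_exp_tendsto_0[of p] filterlim_inverse_at_top_right]
    by (simp add: inverse_eq_divide)
  moreover have "\<forall>\<^sub>F t in at_right (0::real). poly p (1 / t) * exp (- (1 / t)) = exp_bump p t"
    using eventually_at_right_less[of "0::real"] by eventually_elim (simp add: exp_bump_def)
  ultimately have "((\<lambda>t. exp_bump p t) \<longlongrightarrow> 0) (at_right 0)"
    by (rule Lim_transform_eventually)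
  moreover have "((\<lambda>t. exp_bump p t) \<longlongrightarrow> 0) (at_left 0)"
  proof (rule tendsto_eventually)
    show "\<forall>\<^sub>F t in at_left (0::real). exp_bump p t = 0"
      by (auto simp: exp_bump_def eventually_at_left_field intro!: exI[of _ "-1"])
  qed
  ultimately show ?thesis by (simp add: filterlim_at_split)
qed

text \<open>With \<open>s = 1 / t\<close> one has \<open>ds/dt = - s^2\<close>, so
  \<open>p(s) exp(-s)\<close> has derivative \<open>s^2 (p(s) - p'(s)) exp(-s)\<close>. At 0 the
  difference quotient is the profile with polynomial \<open>X * p\<close>, which tends to 0.\<close>

lemma exp_bump_has_derivative:
  "(exp_bump p has_real_derivative exp_bump ([:0, 0, 1:] * (p - pderiv p)) t) (at t)"
proof -
  consider "0 < t" | "t < 0" | "t = 0" by linarith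
  then show ?thesis
  proof cases
    case 1
    have "((\<lambda>t. poly p (1 / t) * exp (- (1 / t))) has_real_derivative
        exp_bump ([:0, 0, 1:] * (p - pderiv p)) t) (at t)"
      using 1 by (auto intro!: derivative_eq_intros simp: exp_bump_def field_simps power2_eq_square)
    then show ?thesis
      by (rule has_field_derivative_transform_within_open[where S = "{0<..}"])
        (use 1 in \<open>auto simp: exp_bump_def\<close>)
  next
    case 2
    have "((\<lambda>t. 0) has_real_derivative exp_bump ([:0, 0, 1:] * (p - pderiv p)) t) (at t)"
      using 2 by (simp add: exp_bump_def)
    then show ?thesis
      by (rule has_field_derivative_transform_within_open[where S = "{..<0}"])
        (use 2 in \<open>auto simp: exp_bump_def\<close>)
  next
    case 3
    have "(\<lambda>h. (exp_bump p (0 + h) - exp_bump p 0) / h) = exp_bump ([:0, 1:] * p)"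
      by (auto simp: exp_bump_def fun_eq_iff)
    then have "(\<lambda>h. (exp_bump p (0 + h) - exp_bump p 0) / h) \<midarrow>0\<rightarrow> 0"
      using exp_bump_tendsto_0[of "[:0, 1:] * p"] by simp
    then show ?thesis unfolding 3 DERIV_def by (simp add: exp_bump_def)
  qed
qed

lemma exp_bump_has_derivative_compose:
  assumes "(g has_derivative g') (at x)"
  shows "((\<lambda>x. exp_bump p (g x)) has_derivative
    (\<lambda>h. exp_bump ([:0, 0, 1:] * (p - pderiv p)) (g x) * g' h)) (at x)"
  using DERIV_compose_FDERIV[OF exp_bump_has_derivative assms] by (simp add: mult_ac)

text \<open>The squared norm keeps the function smooth at the centre. It vanishes where the squared
  distance to \<open>a\<close> is at least \<open>c * R\<^sup>2\<close>: \<open>c = 1\<close> gives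
  the mollifier, and \<open>c = 4\<close> a cut-off that lives on the doubled ball.\<close>

definition rbump :: "real poly \<Rightarrow> real \<Rightarrow> real \<Rightarrow> real^'n::finite \<Rightarrow> real^'n \<Rightarrow> real" where
  "rbump p c R a x = exp_bump p (c - (norm (x - a))\<^sup>2 / R\<^sup>2)"

lemma rbump_has_derivative:
  "(rbump p c R a has_derivative
    (\<lambda>h. rbump ([:0, 0, 1:] * (p - pderiv p)) c R a x * (- (2 * ((x - a) \<bullet> h) / R\<^sup>2)))) (at x)"
proof -
  have "((\<lambda>x. c - (norm (x - a))\<^sup>2 / R\<^sup>2) has_derivative (\<lambda>h. - (2 * ((x - a) \<bullet> h) / R\<^sup>2))) (at x)"
    unfolding power2_norm_eq_inner divide_inverse
    by (auto intro!: derivative_eq_intros simp: inner_commute algebra_simps)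
  from exp_bump_has_derivative_compose[OF this] show ?thesis
    unfolding rbump_def .
qed

lemma partial_deriv_rbump:
  "partial_deriv i (rbump p c R a) =
    (\<lambda>x. rbump ([:0, 0, 1:] * (p - pderiv p)) c R a x * (- 2 / R\<^sup>2 * (x $ i - a $ i)))"
  by (rule ext, subst partial_deriv_eq[OF rbump_has_derivative]) (simp add: inner_axis)

lemma C_k_rbump: "C_k k (rbump p c R a)"
proof (induction k arbitrary: p)
  case 0
  have "rbump p c R a differentiable_on UNIV"
    unfolding differentiable_on_def differentiable_def using rbump_has_derivative by blast
  then show ?case by (simp add: differentiable_imp_continuous_on)
next
  case (Suc k)
  have "rbump p c R a differentiable_on UNIV"
    unfolding differentiable_on_def differentiable_def using rbump_has_derivative by blast
  then show ?case
    unfolding C_k.simps partial_deriv_rbump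
    by (intro conjI allI C_k_mult C_k_const C_k_component Suc.IH)
qed

section \<open>Test functions: closure properties and uniform bounds\<close>

lemma test_function_altdef:
  "test_function f \<longleftrightarrow> (\<forall>k. C_k k f) \<and> (\<exists>R. \<forall>x. R < norm x \<longrightarrow> f x = 0)"
proof -
  have "compact (closure (support_on UNIV f)) \<longleftrightarrow> bounded (support_on UNIV f)"
    by simp
  also have "\<dots> \<longleftrightarrow> (\<exists>R. \<forall>x. R < norm x \<longrightarrow> f x = 0)"
    unfolding bounded_iff support_on_def by (auto simp: not_less[symmetric])
  finally show ?thesis by (simp add: test_function_def)
qed

lemma test_function_rbump:
  assumes "0 < R"
  shows "test_function (rbump p c R a)"
  unfolding test_function_altdef
proof (intro conjI allI C_k_rbump exI[of _ "norm a + R * (1 + \<bar>c\<bar>)"] impI)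
  fix x :: "real^'a" assume x: "norm a + R * (1 + \<bar>c\<bar>) < norm x"
  then have "R * (1 + \<bar>c\<bar>) \<le> norm (x - a)" using norm_triangle_ineq2[of x a] by linarith
  then have "1 + \<bar>c\<bar> \<le> norm (x - a) / R" using assms by (simp add: field_simps)
  then have "(1 + \<bar>c\<bar>)\<^sup>2 \<le> (norm (x - a) / R)\<^sup>2" by (intro power_mono) auto
  moreover have "\<bar>c\<bar> \<le> (1 + \<bar>c\<bar>)\<^sup>2" by (simp add: power2_eq_square algebra_simps)
  ultimately have "c \<le> (norm (x - a))\<^sup>2 / R\<^sup>2" by (simp add: power_divide)
  then show "rbump p c R a x = 0" by (simp add: rbump_def exp_bump_def)
qed

lemma test_functionD:
  assumes "test_function f"
  shows "C_k k f" "f differentiable_on UNIV" "f differentiable (at x)" "continuous_on UNIV f"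
    "test_function (partial_deriv i f)" "\<exists>R. \<forall>x. R < norm x \<longrightarrow> f x = 0"
proof -
  have C: "C_k k f" for k using assms by (simp add: test_function_def)
  show "C_k k f" "f differentiable_on UNIV" "f differentiable (at x)" "continuous_on UNIV f"
    using C[of k] C[of 1] C[of 0] by (auto simp: differentiable_on_def)
  obtain R where R: "\<And>x. R < norm x \<Longrightarrow> f x = 0" using assms by (auto simp: test_function_altdef)
  then show "\<exists>R. \<forall>x. R < norm x \<longrightarrow> f x = 0" by blast
  show "test_function (partial_deriv i f)"
    unfolding test_function_altdef
  proof (intro conjI allI exI[of _ R] impI)
    fix k show "C_k k (partial_deriv i f)" using C[of "Suc k"] by simp
  next
    fix x :: "real^'a" assume x: "R < norm x"
    have "((\<lambda>x. 0) has_derivative (\<lambda>h. 0)) (at x)" by simp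
    then have "(f has_derivative (\<lambda>h. 0)) (at x)"
    proof (rule has_derivative_transform_within_open)
      show "open {x :: real^'a. R < norm x}" by (intro open_Collect_less continuous_intros)
    qed (use x R in auto)
    then show "partial_deriv i f x = 0" by (simp add: partial_deriv_eq)
  qed
qed

lemma test_function_mult:
  assumes "test_function f" "test_function g"
  shows "test_function (\<lambda>x. f x * g x)"
proof -
  obtain R where "\<And>x. R < norm x \<Longrightarrow> f x = 0" using assms by (auto simp: test_function_altdef)
  then show ?thesis using assms unfolding test_function_altdef
    by (auto intro!: C_k_mult exI[of _ R])
qed

lemma test_function_cmult: "test_function f \<Longrightarrow> test_function (\<lambda>x. c * f x)"
  unfolding test_function_altdef by (auto intro!: C_k_mult C_k_const)

lemma test_function_bounded:
  assumes "test_function f"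
  shows "\<exists>B>0. \<forall>x. \<bar>f x\<bar> \<le> B"
proof -
  obtain R where R: "\<And>x. R < norm x \<Longrightarrow> f x = 0" using test_functionD(6)[OF assms] by blast
  have "compact (f ` cball 0 R)"
    using test_functionD(4)[OF assms] by (intro compact_continuous_image) (auto intro: continuous_on_subset)
  then obtain B where B: "\<And>x. x \<in> cball 0 R \<Longrightarrow> \<bar>f x\<bar> \<le> B"
    using compact_imp_bounded by (force simp: bounded_iff)
  show ?thesis
  proof (intro exI[of _ "max 1 B"] conjI allI)
    fix x show "\<bar>f x\<bar> \<le> max 1 B"
      using B[of x] R[of x] by (cases "R < norm x") auto
  qed simp
qed

lemma test_function_Lipschitz:
  assumes "test_function f"
  shows "\<exists>L>0. \<forall>x y. \<bar>f x - f y\<bar> \<le> L * norm (x - y)"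
proof -
  have "\<forall>i. \<exists>B. \<forall>x. \<bar>partial_deriv i f x\<bar> \<le> B"
    using test_function_bounded[OF test_functionD(5)[OF assms]] by blast
  then obtain B where B: "\<And>i x. \<bar>partial_deriv i f x\<bar> \<le> B i" by metis
  define L where "L = max 1 (\<Sum>i\<in>UNIV. B i)"
  have g: "norm (grad f x) \<le> L" for x
  proof -
    have "norm (grad f x) \<le> (\<Sum>i\<in>UNIV. \<bar>grad f x $ i\<bar>)" by (rule norm_le_l1_cart)
    also have "\<dots> \<le> (\<Sum>i\<in>UNIV. B i)" by (intro sum_mono) (simp add: grad_def B)
    finally show ?thesis by (simp add: L_def)
  qed
  have "norm (f x - f y) \<le> L * norm (x - y)" for x y
  proof (rule differentiable_bound)
    fix z show "(f has_derivative (\<lambda>h. grad f z \<bullet> h)) (at z within UNIV)"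
      by (rule has_derivative_grad[OF test_functionD(3)[OF assms]])
    have "onorm (\<lambda>h. grad f z \<bullet> h) \<le> norm (grad f z)"
      by (rule onorm_le) (rule Cauchy_Schwarz_ineq2[simplified real_norm_def[symmetric]])
    with g[of z] show "onorm (\<lambda>h. grad f z \<bullet> h) \<le> L" by linarith
  qed auto
  then show ?thesis by (intro exI[of _ L]) (auto simp: L_def)
qed

text \<open>The partial derivatives are again test functions and hence Lipschitz. A quadratic
  remainder that is uniform in \<open>x\<close> allows differentiation of a convolution under the
  integral by a direct estimate.\<close>

lemma test_function_Taylor:
  assumes "test_function f"
  shows "\<exists>L>0. \<forall>x h. \<bar>f (x + h) - f x - grad f x \<bullet> h\<bar> \<le> L * (norm h)\<^sup>2"
proof -
  have "\<forall>i. \<exists>L. \<forall>x y. \<bar>partial_deriv i f x - partial_deriv i f y\<bar> \<le> L * norm (x - y)"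
    using test_function_Lipschitz[OF test_functionD(5)[OF assms]] by blast
  then obtain L where L: "\<And>i x y. \<bar>partial_deriv i f x - partial_deriv i f y\<bar> \<le> L i * norm (x - y)"
    by metis
  define M where "M = max 1 (\<Sum>i\<in>UNIV. L i)"
  have g: "norm (grad f x - grad f y) \<le> M * norm (x - y)" for x y
  proof -
    have "norm (grad f x - grad f y) \<le> (\<Sum>i\<in>UNIV. \<bar>(grad f x - grad f y) $ i\<bar>)"
      by (rule norm_le_l1_cart)
    also have "\<dots> \<le> (\<Sum>i\<in>UNIV. L i * norm (x - y))"
      by (intro sum_mono) (simp add: grad_def L)
    also have "\<dots> \<le> M * norm (x - y)"
      unfolding sum_distrib_right[symmetric] by (intro mult_right_mono) (auto simp: M_def)
    finally show ?thesis .
  qed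
  \<comment> \<open>The mean value inequality is applied to \<open>f\<close> minus its linear part
    at \<open>x\<close>, whose gradient on the segment is at most \<open>M * norm h\<close>.\<close>
  have "norm ((f (x + h) - grad f x \<bullet> (x + h)) - (f x - grad f x \<bullet> x)) \<le> (M * norm h) * norm ((x + h) - x)" for x h
  proof (rule differentiable_bound[where S = "closed_segment x (x + h)"])
    fix z assume z: "z \<in> closed_segment x (x + h)"
    have "(f has_derivative (\<lambda>h. grad f z \<bullet> h)) (at z within closed_segment x (x + h))"
      by (rule has_derivative_at_withinI[OF has_derivative_grad[OF test_functionD(3)[OF assms]]])
    then show "((\<lambda>z. f z - grad f x \<bullet> z) has_derivative (\<lambda>h. (grad f z - grad f x) \<bullet> h)) (at z within closed_segment x (x + h))"
      by (auto intro!: derivative_eq_intros simp: inner_diff_left)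
    have "onorm (\<lambda>h. (grad f z - grad f x) \<bullet> h) \<le> norm (grad f z - grad f x)"
      by (rule onorm_le) (rule Cauchy_Schwarz_ineq2[simplified real_norm_def[symmetric]])
    also have "\<dots> \<le> M * norm (z - x)" by (rule g)
    also have "\<dots> \<le> M * norm h"
      using segment_bound(1)[OF z] by (intro mult_left_mono) (auto simp: M_def)
    finally show "onorm (\<lambda>h. (grad f z - grad f x) \<bullet> h) \<le> M * norm h" .
  qed auto
  then show ?thesis
    by (intro exI[of _ M]) (auto simp: M_def power2_eq_square inner_add_right algebra_simps)
qed

section \<open>Mollification\<close>

lemma lborel_distr_isometry:
  fixes t :: "'a::euclidean_space"
  assumes "\<bar>c\<bar> = 1"
  shows "distr lborel borel (\<lambda>x. t + c *\<^sub>R x) = lborel"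
  using lborel_affine[of c t] assms by (simp add: density_1)

lemma nn_integral_lborel_isometry:
  fixes t :: "'a::euclidean_space"
  assumes [measurable]: "f \<in> borel_measurable borel" and "\<bar>c\<bar> = 1"
  shows "(\<integral>\<^sup>+x. f (t + c *\<^sub>R x) \<partial>lborel) = (\<integral>\<^sup>+x. f x \<partial>lborel)"
proof -
  have "(\<integral>\<^sup>+x. f x \<partial>distr lborel borel (\<lambda>x. t + c *\<^sub>R x)) = (\<integral>\<^sup>+x. f (t + c *\<^sub>R x) \<partial>lborel)"
    by (rule nn_integral_distr) measurable
  then show ?thesis by (simp add: lborel_distr_isometry[OF assms(2)])
qed

lemma integral_lborel_isometry:
  fixes t :: "'a::euclidean_space" and f :: "'a \<Rightarrow> real"
  assumes [measurable]: "f \<in> borel_measurable borel" and "\<bar>c\<bar> = 1"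
  shows "(LINT x|lborel. f (t + c *\<^sub>R x)) = (LINT x|lborel. f x)"
proof -
  have "(LINT x|distr lborel borel (\<lambda>x. t + c *\<^sub>R x). f x) = (LINT x|lborel. f (t + c *\<^sub>R x))"
    by (rule integral_distr) measurable
  then show ?thesis by (simp add: lborel_distr_isometry[OF assms(2)])
qed

lemma continuous_on_UNIV_borel: "continuous_on UNIV f \<Longrightarrow> f \<in> borel_measurable borel"
  by (rule borel_measurable_continuous_onI)

lemma borel_imp_lebesgue:
  fixes f :: "'a::euclidean_space \<Rightarrow> 'b::topological_space"
  shows "f \<in> borel_measurable borel \<Longrightarrow> f \<in> borel_measurable lebesgue"
  by (rule measurable_completion) simp

lemma test_function_borel:
  assumes "test_function f"
  shows "f \<in> borel_measurable borel" "f \<in> borel_measurable lebesgue"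
  using continuous_on_UNIV_borel[OF test_functionD(4)[OF assms]] borel_imp_lebesgue by auto

lemma integrable_lborel_compact_support:
  fixes f :: "'a::euclidean_space \<Rightarrow> real"
  assumes "continuous_on UNIV f" "\<And>x. R < norm x \<Longrightarrow> f x = 0"
  shows "integrable lborel f"
proof -
  have "integrable lborel (\<lambda>x. indicator (cball 0 R) x *\<^sub>R f x)"
    by (rule borel_integrable_compact) (auto intro: continuous_on_subset[OF assms(1)])
  also have "(\<lambda>x. indicator (cball 0 R) x *\<^sub>R f x) = f"
    using assms(2) by (auto simp: indicator_def fun_eq_iff)
  finally show ?thesis .
qed

text \<open>Tonelli's theorem and the translation formulas are used on \<open>lborel\<close>,
  whereas the Sobolev notions live on its completion; Borel functions are moved between the
  two.\<close>

lemma integrable_lebesgue_lborel: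
  fixes f :: "'a::euclidean_space \<Rightarrow> 'b::{banach, second_countable_topology}"
  assumes "f \<in> borel_measurable borel"
  shows "integrable lebesgue f \<longleftrightarrow> integrable lborel f"
  by (rule integrable_completion) (use assms in simp)

lemma integral_lebesgue_lborel:
  fixes f :: "'a::euclidean_space \<Rightarrow> 'b::{banach, second_countable_topology}"
  assumes "f \<in> borel_measurable borel"
  shows "integral\<^sup>L lebesgue f = integral\<^sup>L lborel f"
  by (rule integral_completion) (use assms in simp)

section \<open>Convolution with test functions and the mollifier\<close>

definition conv :: "(real^'n::finite \<Rightarrow> real) \<Rightarrow> (real^'n \<Rightarrow> real) \<Rightarrow> real^'n \<Rightarrow> real" where
  "conv J w x = (LINT y|lebesgue. J (x - y) * w y)"

lemma test_function_shift_measurable: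
  assumes "test_function J"
  shows "(\<lambda>y. J (x - y)) \<in> borel_measurable borel"
  by (intro continuous_on_UNIV_borel continuous_on_compose2[OF test_functionD(4)[OF assms]] continuous_intros) auto

lemma integrable_bounded_mult:
  fixes w :: "'a::euclidean_space \<Rightarrow> real"
  assumes "integrable M w" "h \<in> borel_measurable M" "\<And>y. \<bar>h y\<bar> \<le> (B::real)"
  shows "integrable M (\<lambda>y. h y * w y)"
proof (rule Bochner_Integration.integrable_bound)
  show "integrable M (\<lambda>y. B * w y)" using assms by simp
  have "0 \<le> B" using assms(3)[of undefined] by linarith
  then show "AE y in M. norm (h y * w y) \<le> norm (B * w y)"
    using assms(3) by (auto simp: abs_mult intro!: mult_right_mono AE_I2)
qed (use assms in simp)

lemma conv_integrable:
  assumes "test_function J" "integrable lebesgue w"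
  shows "integrable lebesgue (\<lambda>y. J (x - y) * w y)"
proof -
  obtain B where "\<And>x. \<bar>J x\<bar> \<le> B" using test_function_bounded[OF assms(1)] by blast
  then show ?thesis
    using test_function_shift_measurable[OF assms(1)] borel_imp_lebesgue
    by (intro integrable_bounded_mult[OF assms(2), of _ B]) auto
qed

text \<open>The uniform Taylor remainder of \<open>J\<close>, integrated against
  \<open>\<bar>w y\<bar>\<close>, gives an error of at most
  \<open>L * W * (norm h)\<^sup>2\<close>.\<close>

lemma conv_has_derivative:
  fixes w :: "real^'n::finite \<Rightarrow> real"
  assumes J: "test_function J" and w: "integrable lebesgue w"
  shows "(conv J w has_derivative (\<lambda>h. \<Sum>i\<in>UNIV. h $ i * conv (partial_deriv i J) w x)) (at x)"
proof -
  obtain L where L: "0 < L" "\<And>x h. \<bar>J (x + h) - J x - grad J x \<bullet> h\<bar> \<le> L * (norm h)\<^sup>2"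
    using test_function_Taylor[OF J] by blast
  define W where "W = (LINT y|lebesgue. \<bar>w y\<bar>)"
  have W: "0 \<le> W" by (simp add: W_def)
  define F where "F = (\<lambda>h. \<Sum>i\<in>UNIV. h $ i * conv (partial_deriv i J) w x)"
  have bl: "bounded_linear F"
    unfolding F_def by (intro bounded_linear_sum bounded_linear_mult_left[THEN bounded_linear_compose] bounded_linear_vec_nth)
  note ci = conv_integrable[OF J w] conv_integrable[OF test_functionD(5)[OF J] w]
  have est: "norm (conv J w (x + h) - conv J w x - F h) \<le> L * W * (norm h)\<^sup>2" for h
  proof -
    have "F h = (\<Sum>i\<in>UNIV. (LINT y|lebesgue. h $ i * (partial_deriv i J (x - y) * w y)))"
      using ci by (simp add: F_def conv_def)
    also have "\<dots> = (LINT y|lebesgue. (\<Sum>i\<in>UNIV. h $ i * (partial_deriv i J (x - y) * w y)))"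
      by (rule Bochner_Integration.integral_sum[symmetric]) (use ci in simp)
    also have "(\<lambda>y. \<Sum>i\<in>UNIV. h $ i * (partial_deriv i J (x - y) * w y)) = (\<lambda>y. (grad J (x - y) \<bullet> h) * w y)"
      by (simp add: fun_eq_iff grad_def inner_vec_def sum_distrib_left sum_distrib_right mult_ac)
    finally have F: "F h = (LINT y|lebesgue. (grad J (x - y) \<bullet> h) * w y)" .
    have iF: "integrable lebesgue (\<lambda>y. (grad J (x - y) \<bullet> h) * w y)"
    proof -
      have "integrable lebesgue (\<lambda>y. \<Sum>i\<in>UNIV. h $ i * (partial_deriv i J (x - y) * w y))"
        using ci by (intro Bochner_Integration.integrable_sum) simp
      then show ?thesis
        by (simp add: fun_eq_iff grad_def inner_vec_def sum_distrib_left sum_distrib_right mult_ac)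
    qed
    have "conv J w (x + h) - conv J w x - F h
      = (LINT y|lebesgue. J (x + h - y) * w y - J (x - y) * w y - (grad J (x - y) \<bullet> h) * w y)"
      unfolding F conv_def using ci iF by simp
    also have "norm \<dots> \<le> (LINT y|lebesgue. (L * (norm h)\<^sup>2) * \<bar>w y\<bar>)"
    proof (rule Bochner_Integration.integral_norm_bound_integral)
      show "integrable lebesgue (\<lambda>y. J (x + h - y) * w y - J (x - y) * w y - (grad J (x - y) \<bullet> h) * w y)"
        using ci iF by simp
      show "integrable lebesgue (\<lambda>y. (L * (norm h)\<^sup>2) * \<bar>w y\<bar>)" using w by simp
      fix y
      have "J (x + h - y) * w y - J (x - y) * w y - (grad J (x - y) \<bullet> h) * w y
        = (J ((x - y) + h) - J (x - y) - grad J (x - y) \<bullet> h) * w y"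
        by (simp add: algebra_simps)
      then show "norm (J (x + h - y) * w y - J (x - y) * w y - (grad J (x - y) \<bullet> h) * w y)
          \<le> (L * (norm h)\<^sup>2) * \<bar>w y\<bar>"
        using L(2)[of "x - y" h] by (simp add: abs_mult mult_right_mono)
    qed
    also have "\<dots> = L * W * (norm h)\<^sup>2" by (simp add: W_def)
    finally show ?thesis .
  qed
  have "(\<lambda>h. norm (conv J w (x + h) - conv J w x - F h) / norm h) \<midarrow>0\<rightarrow> 0"
  proof (rule Lim_null_comparison)
    show "\<forall>\<^sub>F h in at 0. norm (norm (conv J w (x + h) - conv J w x - F h) / norm h) \<le> L * W * norm h"
    proof (rule always_eventually, rule allI)
      fix h
      show "norm (norm (conv J w (x + h) - conv J w x - F h) / norm h) \<le> L * W * norm h"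
        using est[of h] L(1) W by (cases "h = 0") (auto simp: power2_eq_square pos_divide_le_eq mult_ac)
    qed
    show "(\<lambda>h. L * W * norm h) \<midarrow>0\<rightarrow> 0" by (auto intro!: tendsto_eq_intros)
  qed
  with bl show ?thesis unfolding F_def[symmetric] by (simp add: has_derivative_at)
qed

lemma partial_deriv_conv:
  fixes w :: "real^'n::finite \<Rightarrow> real"
  assumes J: "test_function J" and w: "integrable lebesgue w"
  shows "partial_deriv i (conv J w) = conv (partial_deriv i J) w"
proof
  fix x
  have "partial_deriv i (conv J w) x = (\<Sum>j\<in>UNIV. axis i 1 $ j * conv (partial_deriv j J) w x)"
    by (rule partial_deriv_eq[OF conv_has_derivative[OF J w]])
  also have "\<dots> = (\<Sum>j\<in>UNIV. if j = i then conv (partial_deriv j J) w x else 0)"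
    by (intro sum.cong) (auto simp: axis_def)
  finally show "partial_deriv i (conv J w) x = conv (partial_deriv i J) w x" by simp
qed

lemma conv_differentiable:
  assumes "test_function J" "integrable lebesgue w"
  shows "conv J w differentiable_on UNIV"
  unfolding differentiable_on_def differentiable_def using conv_has_derivative[OF assms] by blast

lemma conv_continuous:
  assumes "test_function J" "integrable lebesgue w"
  shows "continuous_on UNIV (conv J w)"
  by (rule differentiable_imp_continuous_on[OF conv_differentiable[OF assms]])

lemma C_k_conv:
  assumes "test_function J" "integrable lebesgue w"
  shows "C_k k (conv J w)"
  using assms(1)
proof (induction k arbitrary: J)
  case 0
  then show ?case using conv_continuous[OF _ assms(2)] by simp
next
  case (Suc k)
  then show ?case
    using conv_differentiable[OF Suc.prems assms(2)] Suc.IH[OF test_functionD(5)[OF Suc.prems]]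
    unfolding C_k.simps partial_deriv_conv[OF Suc.prems assms(2)] by blast
qed

lemma conv_eq_0:
  assumes "\<And>x. r < norm x \<Longrightarrow> J x = 0" "AE y in lebesgue. R < norm y \<longrightarrow> w y = 0" "R + r < norm x"
  shows "conv J w x = 0"
proof -
  have "AE y in lebesgue. J (x - y) * w y = 0"
    using assms(2)
  proof eventually_elim
    case (elim y)
    show ?case
    proof (cases "R < norm y")
      case False
      then have "r < norm (x - y)" using assms(3) norm_triangle_ineq2[of x y] by linarith
      then show ?thesis using assms(1) by simp
    qed (use elim in simp)
  qed
  then show ?thesis unfolding conv_def by (rule integral_eq_zero_AE)
qed

lemma test_function_conv:
  assumes "test_function J" "integrable lebesgue w" "AE y in lebesgue. R < norm y \<longrightarrow> w y = 0"
  shows "test_function (conv J w)"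
proof -
  obtain r where r: "\<And>x. r < norm x \<Longrightarrow> J x = 0" using test_functionD(6)[OF assms(1)] by blast
  show ?thesis
    unfolding test_function_altdef
    using C_k_conv[OF assms(1,2)] conv_eq_0[where J = J, OF r assms(3)] by blast
qed

definition moll :: "real \<Rightarrow> real^'n::finite \<Rightarrow> real" where
  "moll e x = rbump 1 1 e 0 x / (LINT x|lborel. rbump 1 1 e (0 :: real^'n) x)"

lemma rbump_1_nonneg: "0 \<le> rbump 1 c e a x"
  by (simp add: rbump_def exp_bump_def)

lemma rbump_integral_pos:
  assumes "0 < e"
  shows "0 < (LINT x|lborel. rbump 1 1 e (0 :: real^'n::finite) x)"
proof -
  let ?f = "rbump 1 1 e (0 :: real^'n)"
  have t: "test_function ?f" by (rule test_function_rbump[OF assms])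
  obtain R where "\<And>x. R < norm x \<Longrightarrow> ?f x = 0" using test_functionD(6)[OF t] by blast
  then have i: "integrable lborel ?f"
    by (rule integrable_lborel_compact_support[OF test_functionD(4)[OF t]])
  have nn: "0 \<le> (LINT x|lborel. ?f x)" by (intro integral_nonneg_AE) (simp add: rbump_1_nonneg)
  have "(LINT x|lborel. ?f x) \<noteq> 0"
  proof
    assume "(LINT x|lborel. ?f x) = 0"
    then have ae: "AE x in lborel. ?f x = 0"
      by (subst (asm) integral_nonneg_eq_0_iff_AE[OF i]) (auto simp: rbump_1_nonneg)
    have pos: "?f x \<noteq> 0" if "x \<in> ball 0 e" for x
    proof -
      have "(norm x)\<^sup>2 < e\<^sup>2" using that by (intro power_strict_mono) auto
      then show ?thesis using assms by (simp add: rbump_def exp_bump_def)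
    qed
    have "AE x in lborel. x \<notin> ball (0 :: real^'n) e"
      using ae by eventually_elim (use pos in blast)
    then have "ball (0 :: real^'n) e \<in> null_sets lborel"
      by (subst (asm) AE_iff_null_sets[symmetric]) auto
    then have "measure lborel (ball (0 :: real^'n) e) = 0"
      by (rule measure_eq_0_null_sets)
    with assms show False by simp
  qed
  with nn show ?thesis by simp
qed

lemma moll_props:
  assumes "0 < e"
  shows "test_function (moll e :: real^'n \<Rightarrow> real)" "0 \<le> moll e (x :: real^'n)"
    "e \<le> norm (x :: real^'n) \<Longrightarrow> moll e x = 0"
    "integrable lborel (moll e :: real^'n::finite \<Rightarrow> real)" "(LINT x|lborel. moll e (x :: real^'n)) = 1"
proof -
  have t: "test_function (rbump 1 1 e (0 :: real^'n))" by (rule test_function_rbump[OF assms])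
  show tm: "test_function (moll e :: real^'n \<Rightarrow> real)"
    using test_function_cmult[OF test_function_rbump[OF assms], of "1 / (LINT x|lborel. rbump 1 1 e (0 :: real^'n) x)" 1 1 "0 :: real^'n"]
    by (simp add: moll_def[abs_def])
  show "0 \<le> moll e (x :: real^'n)"
    using rbump_integral_pos[OF assms] by (simp add: moll_def rbump_1_nonneg)
  show z: "moll e x = 0" if "e \<le> norm (x :: real^'n)" for x :: "real^'n"
  proof -
    have "\<not> (norm x)\<^sup>2 < e\<^sup>2" using power_mono[OF that, of 2] assms by linarith
    then have "rbump 1 1 e 0 x = 0" using assms by (simp add: rbump_def exp_bump_def)
    then show ?thesis by (simp add: moll_def)
  qed
  show "integrable lborel (moll e :: real^'n \<Rightarrow> real)"
    by (rule integrable_lborel_compact_support[OF test_functionD(4)[OF tm], where R = e]) (simp add: z)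
  show "(LINT x|lborel. moll e (x :: real^'n)) = 1"
    using rbump_integral_pos[where 'n = 'n, OF assms] by (simp add: moll_def)
qed

lemma conv_diff:
  assumes "test_function J" "integrable lebesgue f" "integrable lebesgue g"
  shows "conv J f x - conv J g x = conv J (\<lambda>y. f y - g y) x"
  unfolding conv_def using conv_integrable[OF assms(1,2), of x] conv_integrable[OF assms(1,3), of x]
  by (simp add: right_diff_distrib)

lemma conv_cong_AE:
  assumes "test_function J" "f \<in> borel_measurable lebesgue" "g \<in> borel_measurable lebesgue"
    "AE x in lebesgue. f x = g x"
  shows "conv J f = conv J g"
proof
  fix x
  have "(\<lambda>y. J (x - y)) \<in> borel_measurable lebesgue"
    using test_function_shift_measurable[OF assms(1)] borel_imp_lebesgue by blast
  then show "conv J f x = conv J g x"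
    unfolding conv_def using assms(2-4)
    by (intro integral_cong_AE) (auto intro!: borel_measurable_times elim!: eventually_mono)
qed

section \<open>Mean-square convergence of mollifications\<close>

lemma integrable_of_square_integrable:
  fixes f :: "'a::euclidean_space \<Rightarrow> real"
  assumes "f \<in> borel_measurable borel" "integrable lborel (\<lambda>x. (f x)\<^sup>2)" "\<And>x. R < norm x \<Longrightarrow> f x = 0"
  shows "integrable lborel f"
proof (rule Bochner_Integration.integrable_bound)
  have "integrable lborel (indicat_real (cball (0 :: 'a) R))"
    by (intro integrable_real_indicator) (use emeasure_lborel_cball_finite in auto)
  then show "integrable lborel (\<lambda>x. indicat_real (cball 0 R) x + (f x)\<^sup>2)" using assms(2) by simp
  show "AE x in lborel. norm (f x) \<le> norm (indicat_real (cball 0 R) x + (f x)\<^sup>2)"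
  proof (rule AE_I2)
    fix x
    have "\<bar>f x\<bar> \<le> 1 + (f x)\<^sup>2"
      using sum_power2_ge_zero[of "\<bar>f x\<bar> - 1/2" 0] by (simp add: power2_eq_square algebra_simps)
    then show "norm (f x) \<le> norm (indicat_real (cball 0 R) x + (f x)\<^sup>2)"
      using assms(3)[of x] by (auto simp: indicator_def not_le)
  qed
qed (use assms in simp)

text \<open>Nonnegativity of the variance under the probability density \<open>w\<close>. It is used
  with the mollifier as weight and with the uniform weight on the unit interval.\<close>

lemma weighted_square_integral_le:
  fixes w g :: "'a \<Rightarrow> real"
  assumes w: "integrable M w" "integral\<^sup>L M w = 1" "\<And>y. 0 \<le> w y"
    and i: "integrable M (\<lambda>y. w y * g y)" "integrable M (\<lambda>y. w y * (g y)\<^sup>2)"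
  shows "(LINT y|M. w y * g y)\<^sup>2 \<le> (LINT y|M. w y * (g y)\<^sup>2)"
proof -
  define a where "a = (LINT y|M. w y * g y)"
  have "0 \<le> (LINT y|M. w y * (g y - a)\<^sup>2)"
    using w(3) by (intro integral_nonneg_AE) auto
  also have "(\<lambda>y. w y * (g y - a)\<^sup>2) = (\<lambda>y. w y * (g y)\<^sup>2 - 2 * a * (w y * g y) + a\<^sup>2 * w y)"
    by (simp add: fun_eq_iff power2_eq_square algebra_simps)
  also have "(LINT y|M. \<dots> y) = (LINT y|M. w y * (g y)\<^sup>2) - 2 * a * a + a\<^sup>2 * 1"
    using i w(1,2) by (simp add: a_def[symmetric])
  finally show ?thesis by (simp add: a_def[symmetric] power2_eq_square)
qed

lemma moll_shift:
  fixes x :: "real^'n::finite"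
  assumes e: "0 < e"
  shows "(LINT y|lborel. moll e (x - y)) = 1" "integrable lborel (\<lambda>y. moll e (x - y))"
proof -
  show 1: "(LINT y|lborel. moll e (x - y)) = 1"
    using integral_lborel_isometry[of "moll e" "-1" x] moll_props[OF e, where 'n = 'n] test_function_borel(1) by simp
  then show "integrable lborel (\<lambda>y. moll e (x - y))"
    using not_integrable_integral_eq by fastforce
qed

text \<open>The mollifier is a probability density, so Jensen's inequality holds pointwise; Tonelli
  and translation invariance then integrate it out.\<close>

lemma conv_L2_bound:
  fixes g :: "real^'n::finite \<Rightarrow> real"
  assumes e: "0 < e" and g: "g \<in> borel_measurable borel" "integrable lborel g" "integrable lborel (\<lambda>x. (g x)\<^sup>2)"
  shows "(\<integral>\<^sup>+x. ennreal ((conv (moll e) g x)\<^sup>2) \<partial>lborel) \<le> (\<integral>\<^sup>+x. ennreal ((g x)\<^sup>2) \<partial>lborel)"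
proof -
  let ?J = "moll e :: real^'n \<Rightarrow> real"
  note M = moll_props[OF e, where 'n = 'n]
  note [measurable] = g(1) test_function_borel(1)[OF M(1)]
  obtain B where B: "\<And>x. \<bar>?J x\<bar> \<le> B" using test_function_bounded[OF M(1)] by blast
  have pt: "ennreal ((conv ?J g x)\<^sup>2) \<le> (\<integral>\<^sup>+y. ennreal (?J (x - y) * (g y)\<^sup>2) \<partial>lborel)" for x
  proof -
    have a: "conv ?J g x = (LINT y|lborel. ?J (x - y) * g y)"
      unfolding conv_def by (rule integral_lebesgue_lborel) measurable
    have i1: "integrable lborel (\<lambda>y. ?J (x - y) * g y)"
      by (rule integrable_bounded_mult[OF g(2) _ B]) measurable
    have i2: "integrable lborel (\<lambda>y. ?J (x - y) * (g y)\<^sup>2)"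
      by (rule integrable_bounded_mult[OF g(3) _ B]) measurable
    have "ennreal ((conv ?J g x)\<^sup>2) \<le> ennreal (LINT y|lborel. ?J (x - y) * (g y)\<^sup>2)"
      unfolding a using M(2) i1 i2 moll_shift[OF e]
      by (intro ennreal_leI weighted_square_integral_le) auto
    also have "\<dots> = (\<integral>\<^sup>+y. ennreal (?J (x - y) * (g y)\<^sup>2) \<partial>lborel)"
      using M(2) by (intro nn_integral_eq_integral[symmetric] i2) auto
    finally show ?thesis .
  qed
  have "(\<integral>\<^sup>+x. ennreal ((conv ?J g x)\<^sup>2) \<partial>lborel)
    \<le> (\<integral>\<^sup>+x. (\<integral>\<^sup>+y. ennreal (?J (x - y) * (g y)\<^sup>2) \<partial>lborel) \<partial>lborel)"
    by (intro nn_integral_mono pt)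
  also have "\<dots> = (\<integral>\<^sup>+y. (\<integral>\<^sup>+x. ennreal (?J (x - y) * (g y)\<^sup>2) \<partial>lborel) \<partial>lborel)"
    by (rule lborel_pair.Fubini'[symmetric]) measurable
  also have "\<dots> = (\<integral>\<^sup>+y. ennreal ((g y)\<^sup>2) \<partial>lborel)"
  proof (rule nn_integral_cong)
    fix y
    have "(\<integral>\<^sup>+x. ennreal (?J (x - y) * (g y)\<^sup>2) \<partial>lborel) = (\<integral>\<^sup>+x. ennreal (?J (x - y)) \<partial>lborel) * ennreal ((g y)\<^sup>2)"
      using M(2) by (simp add: ennreal_mult nn_integral_multc)
    also have "(\<integral>\<^sup>+x. ennreal (?J (x - y)) \<partial>lborel) = (\<integral>\<^sup>+x. ennreal (?J x) \<partial>lborel)"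
      using nn_integral_lborel_isometry[of "\<lambda>x. ennreal (?J x)" 1 "- y"] by simp
    also have "\<dots> = 1"
      using M by (simp add: nn_integral_eq_integral)
    finally show "(\<integral>\<^sup>+x. ennreal (?J (x - y) * (g y)\<^sup>2) \<partial>lborel) = ennreal ((g y)\<^sup>2)" by simp
  qed
  finally show ?thesis .
qed

lemma conv_uniform:
  fixes g :: "real^'n::finite \<Rightarrow> real"
  assumes g: "continuous_on UNIV g" "\<And>x. R < norm x \<Longrightarrow> g x = 0" and r: "0 < r"
  shows "\<exists>d>0. \<forall>e. 0 < e \<longrightarrow> e < d \<longrightarrow> (\<forall>x. \<bar>g x - conv (moll e) g x\<bar> \<le> r)"
proof -
  have "uniformly_continuous_on (cball 0 (R + 2)) g"
    by (intro compact_uniformly_continuous continuous_on_subset[OF g(1)]) auto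
  then obtain d where d: "0 < d" and dd: "\<And>x y. x \<in> cball 0 (R + 2) \<Longrightarrow> y \<in> cball 0 (R + 2) \<Longrightarrow> dist y x < d \<Longrightarrow> dist (g y) (g x) < r"
    using r unfolding uniformly_continuous_on_def by metis
  \<comment> \<open>Uniform continuity is available on a compact ball only. Limiting the distance to
    1 makes both values vanish when \<open>x\<close> lies outside the ball of radius
    \<open>R + 1\<close>.\<close>
  have near: "\<bar>g y - g x\<bar> \<le> r" if "norm (x - y) < min d 1" for x y
  proof (cases "norm x \<le> R + 1")
    case True
    then have "norm y \<le> R + 2" using that norm_triangle_ineq2[of y x] by (simp add: norm_minus_commute)
    with True that dd[of x y] show ?thesis by (simp add: dist_norm norm_minus_commute)
  next
    case False
    then have "R < norm y" using that norm_triangle_ineq2[of x y] by simp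
    with False g(2)[of x] g(2)[of y] r show ?thesis by simp
  qed
  have gb[measurable]: "g \<in> borel_measurable borel" by (rule continuous_on_UNIV_borel[OF g(1)])
  have gi: "integrable lborel g" by (rule integrable_lborel_compact_support[OF g])
  show ?thesis
  proof (intro exI[of _ "min d 1"] conjI allI impI)
    show "0 < min d 1" using d by simp
    fix e :: real and x :: "real^'n" assume e: "0 < e" "e < min d 1"
    let ?J = "moll e :: real^'n \<Rightarrow> real"
    note M = moll_props[OF e(1), where 'n = 'n]
    note [measurable] = test_function_borel(1)[OF M(1)]
    obtain B where B: "\<And>x. \<bar>?J x\<bar> \<le> B" using test_function_bounded[OF M(1)] by blast
    note sh = moll_shift(1)[OF e(1), of x] and shi = moll_shift(2)[OF e(1), of x]
    have i1: "integrable lborel (\<lambda>y. ?J (x - y) * g y)"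
      by (rule integrable_bounded_mult[OF gi _ B]) measurable
    have c: "conv ?J g x = (LINT y|lborel. ?J (x - y) * g y)"
      unfolding conv_def by (rule integral_lebesgue_lborel) measurable
    have "g x - conv ?J g x = (LINT y|lborel. g x * ?J (x - y) - ?J (x - y) * g y)"
      using i1 shi by (simp add: c sh)
    also have "norm \<dots> \<le> (LINT y|lborel. r * ?J (x - y))"
    proof (rule Bochner_Integration.integral_norm_bound_integral)
      fix y
      have "norm (g x * ?J (x - y) - ?J (x - y) * g y) = \<bar>g y - g x\<bar> * ?J (x - y)"
        using M(2)[of "x - y"] by (simp add: abs_mult abs_minus_commute left_diff_distrib[symmetric] mult.commute[of "?J _"])
      also have "\<dots> \<le> r * ?J (x - y)"
      proof (cases "norm (x - y) < e")
        case True
        then show ?thesis using near[of x y] e M(2) by (intro mult_right_mono) auto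
      qed (use M(3) in simp)
      finally show "norm (g x * ?J (x - y) - ?J (x - y) * g y) \<le> r * ?J (x - y)" .
    qed (use i1 shi in auto)
    also have "\<dots> = r" by (simp add: sh)
    finally show "\<bar>g x - conv ?J g x\<bar> \<le> r" by simp
  qed
qed

lemma L2_approx_bounded:
  fixes f :: "'a::euclidean_space \<Rightarrow> real"
  assumes [measurable]: "f \<in> borel_measurable borel" and "integrable lborel (\<lambda>x. (f x)\<^sup>2)" and e: "0 < e"
  shows "\<exists>M>0. (LINT x|lborel. (f x - max (- M) (min M (f x)))\<^sup>2) < e"
proof -
  have "(\<lambda>k. LINT x|lborel. (f x - max (- real k) (min (real k) (f x)))\<^sup>2) \<longlonglongrightarrow> integral\<^sup>L lborel (\<lambda>x :: 'a. 0::real)"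
  proof (rule Bochner_Integration.integral_dominated_convergence[OF _ _ assms(2)])
    show "AE x in lborel. (\<lambda>k. (f x - max (- real k) (min (real k) (f x)))\<^sup>2) \<longlonglongrightarrow> 0"
    proof (rule AE_I2, rule tendsto_eventually)
      fix x
      obtain k0 :: nat where "\<bar>f x\<bar> \<le> real k0" using real_arch_simple by blast
      then show "\<forall>\<^sub>F k in sequentially. (f x - max (- real k) (min (real k) (f x)))\<^sup>2 = 0"
        unfolding eventually_sequentially by (intro exI[of _ k0]) auto
    qed
    show "AE x in lborel. norm ((f x - max (- real k) (min (real k) (f x)))\<^sup>2) \<le> (f x)\<^sup>2" for k
      by (rule AE_I2) (auto simp: abs_le_square_iff[symmetric])
  qed (use assms in auto)
  then have "\<forall>\<^sub>F k in sequentially. (LINT x|lborel. (f x - max (- real k) (min (real k) (f x)))\<^sup>2) < e"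
    using e by (intro order_tendstoD(2)) auto
  moreover have "\<forall>\<^sub>F k in sequentially. 0 < real k" using eventually_gt_at_top[of "0::nat"] by eventually_elim simp
  ultimately have "\<forall>\<^sub>F k in sequentially. 0 < real k \<and> (LINT x|lborel. (f x - max (- real k) (min (real k) (f x)))\<^sup>2) < e"
    by eventually_elim simp
  then show ?thesis using eventually_happens'[OF sequentially_bot] by blast
qed

text \<open>A measurable function is almost everywhere a limit of continuous functions. Truncating
  values at \<open>M\<close> and multiplying by a continuous cut-off that is 1 on the support
  supplies a common integrable majorant, so the limit holds in mean square.\<close>

lemma L2_approx_continuous:
  fixes f :: "'a::euclidean_space \<Rightarrow> real"
  assumes f[measurable]: "f \<in> borel_measurable borel" and f2: "integrable lborel (\<lambda>x. (f x)\<^sup>2)"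
    and R: "\<And>x. R < norm x \<Longrightarrow> f x = 0" and e: "0 < e"
  shows "\<exists>g. continuous_on UNIV g \<and> (\<forall>x. R + 1 < norm x \<longrightarrow> g x = 0) \<and>
    integrable lborel (\<lambda>x. (f x - g x)\<^sup>2) \<and> (LINT x|lborel. (f x - g x)\<^sup>2) < e"
proof -
  obtain M where M: "0 < M" and fM: "(LINT x|lborel. (f x - max (- M) (min M (f x)))\<^sup>2) < e / 4"
    using L2_approx_bounded[OF f f2, of "e / 4"] e by auto
  define s where "s = (\<lambda>x. max (- M) (min M (f x)))"
  have [measurable]: "s \<in> borel_measurable borel" unfolding s_def by measurable
  have "f measurable_on UNIV"
    by (rule lebesgue_measurable_imp_measurable_on) (auto intro: borel_imp_lebesgue f)
  then obtain N G where N: "negligible N" and G: "\<And>n. continuous_on UNIV (G n)"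
    and lim: "\<And>x. x \<notin> N \<Longrightarrow> (\<lambda>n. G n x) \<longlonglongrightarrow> f x"
    unfolding measurable_on_def by auto
  have "AE x in lebesgue. x \<notin> N"
    using N by (simp add: negligible_iff_null_sets AE_not_in)
  then have aeN: "AE x in lborel. x \<notin> N" by (simp add: AE_completion_iff)
  define ct where "ct = (\<lambda>x :: 'a. max 0 (min 1 (R + 1 - norm x)))"
  define h where "h = (\<lambda>n x. ct x * max (- M) (min M (G n x)))"
  have hc: "continuous_on UNIV (h n)" for n
    unfolding h_def ct_def by (intro continuous_intros G)
  have [measurable]: "h n \<in> borel_measurable borel" for n by (rule continuous_on_UNIV_borel[OF hc])
  have h0: "h n x = 0" if "R + 1 < norm x" for n x using that by (simp add: h_def ct_def)
  have ct: "0 \<le> ct x" "ct x \<le> 1" for x by (auto simp: ct_def)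
  have hM: "\<bar>h n x\<bar> \<le> M" for n x
  proof -
    have "\<bar>h n x\<bar> \<le> 1 * M" unfolding h_def abs_mult using ct[of x] M by (intro mult_mono) auto
    then show ?thesis by simp
  qed
  have sM: "\<bar>s x\<bar> \<le> M" "R < norm x \<Longrightarrow> s x = 0" for x using M R by (auto simp: s_def)
  have dom: "(s x - h n x)\<^sup>2 \<le> (2 * M)\<^sup>2 * indicator (cball 0 (R + 1)) x" for n x
  proof (cases "R + 1 < norm x")
    case False
    have "\<bar>s x - h n x\<bar> \<le> 2 * M" using hM[of n x] sM(1)[of x] by linarith
    then have "\<bar>s x - h n x\<bar>\<^sup>2 \<le> (2 * M)\<^sup>2" by (intro power_mono) auto
    then have "(s x - h n x)\<^sup>2 \<le> (2 * M)\<^sup>2" by (simp only: power2_abs)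
    with False show ?thesis by simp
  qed (use h0 sM(2) in simp)
  have idom: "integrable lborel (\<lambda>x :: 'a. (2 * M)\<^sup>2 * indicat_real (cball 0 (R + 1)) x)"
    by (intro integrable_mult_right integrable_real_indicator) (use emeasure_lborel_cball_finite in auto)
  have ish: "integrable lborel (\<lambda>x. (s x - h n x)\<^sup>2)" for n
    by (rule Bochner_Integration.integrable_bound[OF idom]) (use dom in \<open>auto intro!: AE_I2\<close>)
  have "(\<lambda>n. LINT x|lborel. (s x - h n x)\<^sup>2) \<longlonglongrightarrow> integral\<^sup>L lborel (\<lambda>x :: 'a. 0::real)"
  proof (rule Bochner_Integration.integral_dominated_convergence[OF _ _ idom])
    show "AE x in lborel. (\<lambda>n. (s x - h n x)\<^sup>2) \<longlonglongrightarrow> 0"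
      using aeN
    proof eventually_elim
      case (elim x)
      have "(\<lambda>n. h n x) \<longlonglongrightarrow> ct x * s x"
        unfolding h_def s_def by (intro tendsto_intros lim[OF elim])
      moreover have "ct x * s x = s x" using sM(2)[of x] by (cases "R < norm x") (auto simp: ct_def)
      ultimately have "(\<lambda>n. (s x - h n x)\<^sup>2) \<longlonglongrightarrow> (s x - s x)\<^sup>2"
        by (intro tendsto_intros) simp
      then show ?case by simp
    qed
    show "AE x in lborel. norm ((s x - h n x)\<^sup>2) \<le> (2 * M)\<^sup>2 * indicat_real (cball 0 (R + 1)) x" for n
      using dom by (auto intro!: AE_I2)
  qed auto
  then have "\<forall>\<^sub>F n in sequentially. (LINT x|lborel. (s x - h n x)\<^sup>2) < e / 4"
    using e by (intro order_tendstoD(2)) auto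
  then obtain n where n: "(LINT x|lborel. (s x - h n x)\<^sup>2) < e / 4"
    using eventually_happens'[OF sequentially_bot] by blast
  have ifs: "integrable lborel (\<lambda>x. (f x - s x)\<^sup>2)"
    by (rule Bochner_Integration.integrable_bound[OF f2])
      (use M in \<open>auto simp: s_def abs_le_square_iff[symmetric]\<close>)
  have bd: "(f x - h n x)\<^sup>2 \<le> 2 * (f x - s x)\<^sup>2 + 2 * (s x - h n x)\<^sup>2" for x
    using sum_squares_bound[of "f x - s x" "s x - h n x"] by (simp add: power2_eq_square algebra_simps)
  have isum: "integrable lborel (\<lambda>x. 2 * (f x - s x)\<^sup>2 + 2 * (s x - h n x)\<^sup>2)"
    using ifs ish by simp
  have ifh: "integrable lborel (\<lambda>x. (f x - h n x)\<^sup>2)"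
    by (rule Bochner_Integration.integrable_bound[OF isum]) (use bd in \<open>auto intro!: AE_I2\<close>)
  have "(LINT x|lborel. (f x - h n x)\<^sup>2) \<le> (LINT x|lborel. 2 * (f x - s x)\<^sup>2 + 2 * (s x - h n x)\<^sup>2)"
    by (rule integral_mono[OF ifh isum bd])
  also have "\<dots> = 2 * (LINT x|lborel. (f x - s x)\<^sup>2) + 2 * (LINT x|lborel. (s x - h n x)\<^sup>2)"
    using ifs ish by simp
  also have "\<dots> < e" using fM n by (simp add: s_def)
  finally show ?thesis using hc h0 ifh by blast
qed

lemma conv_square_integrable:
  fixes f :: "real^'n::finite \<Rightarrow> real"
  assumes e: "0 < e" and f: "integrable lebesgue f" and R: "AE x in lebesgue. R < norm x \<longrightarrow> f x = 0"
  shows "integrable lborel (\<lambda>x. (conv (moll e) f x)\<^sup>2)"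
proof (rule integrable_lborel_compact_support[where R = "R + e"])
  show "continuous_on UNIV (\<lambda>x. (conv (moll e) f x)\<^sup>2)"
    by (intro continuous_intros conv_continuous moll_props e f)
  show "(conv (moll e) f x)\<^sup>2 = 0" if "R + e < norm x" for x
  proof -
    have "conv (moll e) f x = 0"
      by (rule conv_eq_0[OF _ R that]) (simp add: moll_props(3)[OF e])
    then show ?thesis by simp
  qed
qed

lemma conv_L2_bound':
  fixes g :: "real^'n::finite \<Rightarrow> real"
  assumes e: "0 < e" and g: "g \<in> borel_measurable borel" "integrable lborel g" "integrable lborel (\<lambda>x. (g x)\<^sup>2)"
    and R: "\<And>x. R < norm x \<Longrightarrow> g x = 0"
  shows "(LINT x|lborel. (conv (moll e) g x)\<^sup>2) \<le> (LINT x|lborel. (g x)\<^sup>2)"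
proof -
  have "integrable lborel (\<lambda>x. (conv (moll e) g x)\<^sup>2)"
    using g R integrable_lebesgue_lborel[OF g(1)] by (intro conv_square_integrable[OF e, of _ R]) auto
  then have "ennreal (LINT x|lborel. (conv (moll e) g x)\<^sup>2) \<le> ennreal (LINT x|lborel. (g x)\<^sup>2)"
    using conv_L2_bound[OF e g] g(3) by (simp add: nn_integral_eq_integral)
  then show ?thesis by (subst (asm) ennreal_le_iff) auto
qed

lemma square_sum3: "((a::real) + b + c)\<^sup>2 \<le> 3 * a\<^sup>2 + 3 * b\<^sup>2 + 3 * c\<^sup>2"
  using sum_squares_bound[of a b] sum_squares_bound[of a c] sum_squares_bound[of b c]
  by (simp add: power2_eq_square algebra_simps)

text \<open>With a continuous approximation \<open>g\<close>, the error splits into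
  \<open>f - g\<close>, the mollification error of \<open>g\<close>, and the mollification of
  \<open>g - f\<close>. The first and third are small in mean square, the second uniformly on a
  bounded set.\<close>

lemma moll_L2_borel:
  fixes f :: "real^'n::finite \<Rightarrow> real"
  assumes f[measurable]: "f \<in> borel_measurable borel" and f2: "integrable lborel (\<lambda>x. (f x)\<^sup>2)"
    and R: "\<And>x. R < norm x \<Longrightarrow> f x = 0"
  shows "0 < e \<Longrightarrow> integrable lborel (\<lambda>x. (f x - conv (moll e) f x)\<^sup>2)"
    and "(\<lambda>k. LINT x|lborel. (f x - conv (moll (1 / Suc k)) f x)\<^sup>2) \<longlonglongrightarrow> 0"
proof -
  have fi: "integrable lborel f" by (rule integrable_of_square_integrable[OF f f2 R])
  have fl: "integrable lebesgue f" using fi integrable_lebesgue_lborel[OF f] by simp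
  have cm: "conv (moll e) f \<in> borel_measurable borel" if "0 < e" for e
    by (intro continuous_on_UNIV_borel conv_continuous moll_props that fl)
  have i: "integrable lborel (\<lambda>x. (f x - conv (moll e) f x)\<^sup>2)" if e: "0 < e" for e
  proof (rule Bochner_Integration.integrable_bound)
    show "integrable lborel (\<lambda>x. 3 * (f x)\<^sup>2 + 3 * (conv (moll e) f x)\<^sup>2)"
      using f2 conv_square_integrable[OF e fl, of R] R by auto
    show "(\<lambda>x. (f x - conv (moll e) f x)\<^sup>2) \<in> borel_measurable lborel" using cm[OF e] by simp
    show "AE x in lborel. norm ((f x - conv (moll e) f x)\<^sup>2) \<le> norm (3 * (f x)\<^sup>2 + 3 * (conv (moll e) f x)\<^sup>2)"
      using square_sum3[of "f _" "- conv (moll e) f _" 0] by (auto intro!: AE_I2)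
  qed
  then show "0 < e \<Longrightarrow> integrable lborel (\<lambda>x. (f x - conv (moll e) f x)\<^sup>2)" .
  show "(\<lambda>k. LINT x|lborel. (f x - conv (moll (1 / Suc k)) f x)\<^sup>2) \<longlonglongrightarrow> 0"
  proof (rule LIMSEQ_I)
    fix r :: real assume r: "0 < r"
    obtain g where g: "continuous_on UNIV g" "\<And>x. R + 1 < norm x \<Longrightarrow> g x = 0"
      and fg: "integrable lborel (\<lambda>x. (f x - g x)\<^sup>2)" "(LINT x|lborel. (f x - g x)\<^sup>2) < r / 12"
      using L2_approx_continuous[of f R "r / 12"] f f2 R r by auto
    have gb[measurable]: "g \<in> borel_measurable borel" by (rule continuous_on_UNIV_borel[OF g(1)])
    have gi: "integrable lborel g" by (rule integrable_lborel_compact_support[OF g])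
    have gl: "integrable lebesgue g" using gi integrable_lebesgue_lborel[OF gb] by simp
    define v where "v = measure lborel (cball (0 :: real^'n) (R + 2))"
    have v: "0 \<le> v" by (simp add: v_def)
    \<comment> \<open>The uniform accuracy is tuned to the volume \<open>v\<close> of the ball that
      contains the support: each of the three squared errors is at most \<open>r / 12\<close>, and
      expanding the square of the sum costs a factor 3.\<close>
    define s where "s = sqrt (r / (12 * (v + 1)))"
    have s: "0 < s" "s\<^sup>2 = r / (12 * (v + 1))" using r v by (auto simp: s_def)
    have sv: "s\<^sup>2 * v \<le> r / 12" using r v unfolding s(2) by (simp add: field_simps)
    obtain d where d: "0 < d" and dd: "\<And>e x. 0 < e \<Longrightarrow> e < d \<Longrightarrow> \<bar>g x - conv (moll e) g x\<bar> \<le> s"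
      using conv_uniform[OF g s(1)] by blast
    obtain K :: nat where K: "1 / Suc K < min d 1"
      using reals_Archimedean[of "min d 1"] d by (auto simp: inverse_eq_divide)
    show "\<exists>no. \<forall>k\<ge>no. norm ((LINT x|lborel. (f x - conv (moll (1 / Suc k)) f x)\<^sup>2) - 0) < r"
    proof (intro exI[of _ K] allI impI)
      fix k assume k: "K \<le> k"
      define e where "e = 1 / real (Suc k)"
      have "e \<le> 1 / Suc K" unfolding e_def using k by (intro divide_left_mono) auto
      with K have "e < min d 1" by linarith
      then have e: "0 < e" "e < d" "e < 1" by (simp_all add: e_def)
      define A where "A = (\<lambda>x. f x - g x)"
      define B where "B = (\<lambda>x. g x - conv (moll e) g x)"
      define C where "C = conv (moll e) (\<lambda>y. g y - f y)"
      have iA: "integrable lborel (\<lambda>x. (A x)\<^sup>2)" using fg by (simp add: A_def)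
      have g0: "R + 1 < norm x \<Longrightarrow> g x - f x = 0" for x using g(2) R by simp
      have gf2: "integrable lborel (\<lambda>x. (g x - f x)\<^sup>2)" using fg(1) by (simp add: power2_commute)
      have gfl: "integrable lebesgue (\<lambda>x. g x - f x)" using gl fl by simp
      have cgm[measurable]: "conv (moll e) g \<in> borel_measurable borel"
        by (intro continuous_on_UNIV_borel conv_continuous moll_props e gl)
      have iC: "integrable lborel (\<lambda>x. (C x)\<^sup>2)"
        unfolding C_def by (rule conv_square_integrable[OF e(1) gfl, of "R + 1"]) (use g0 in auto)
      have C: "(LINT x|lborel. (C x)\<^sup>2) < r / 12"
      proof -
        have "(LINT x|lborel. (C x)\<^sup>2) \<le> (LINT x|lborel. (g x - f x)\<^sup>2)"
          unfolding C_def using gi fi gf2 by (intro conv_L2_bound'[OF e(1), of _ "R + 1"] g0) auto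
        with fg(2) show ?thesis by (simp add: power2_commute)
      qed
      have idom: "integrable lborel (\<lambda>x :: real^'n. s\<^sup>2 * indicat_real (cball 0 (R + 2)) x)"
        by (intro integrable_mult_right integrable_real_indicator) (use emeasure_lborel_cball_finite in auto)
      have Bd: "(B x)\<^sup>2 \<le> s\<^sup>2 * indicat_real (cball 0 (R + 2)) x" for x
      proof (cases "R + 2 < norm x")
        case True
        then have "conv (moll e) g x = 0"
          by (intro conv_eq_0[where r = e and R = "R + 1"]) (use g(2) e in \<open>auto simp: moll_props(3)\<close>)
        with True g(2) show ?thesis by (simp add: B_def)
      next
        case False
        have "\<bar>B x\<bar>\<^sup>2 \<le> s\<^sup>2" unfolding B_def using dd[OF e(1,2)] by (intro power_mono) auto
        with False show ?thesis by simp
      qed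
      have iB: "integrable lborel (\<lambda>x. (B x)\<^sup>2)"
        by (rule Bochner_Integration.integrable_bound[OF idom]) (use Bd in \<open>auto simp: B_def intro!: AE_I2\<close>)
      have "(LINT x|lborel. (B x)\<^sup>2) \<le> (LINT x|lborel. s\<^sup>2 * indicat_real (cball 0 (R + 2)) (x :: real^'n))"
        by (rule integral_mono[OF iB idom Bd])
      also have "\<dots> = s\<^sup>2 * v" by (simp add: v_def)
      finally have B: "(LINT x|lborel. (B x)\<^sup>2) \<le> r / 12" using sv by simp
      have "(f x - conv (moll e) f x)\<^sup>2 \<le> 3 * (A x)\<^sup>2 + 3 * (B x)\<^sup>2 + 3 * (C x)\<^sup>2" for x
      proof -
        have "f x - conv (moll e) f x = A x + B x + C x"
          using conv_diff[OF moll_props(1)[OF e(1)] gl fl, of x] by (simp add: A_def B_def C_def)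
        then show ?thesis using square_sum3 by simp
      qed
      then have "(LINT x|lborel. (f x - conv (moll e) f x)\<^sup>2) \<le> (LINT x|lborel. 3 * (A x)\<^sup>2 + 3 * (B x)\<^sup>2 + 3 * (C x)\<^sup>2)"
        using iA iB iC by (intro integral_mono i e) auto
      also have "\<dots> = 3 * (LINT x|lborel. (A x)\<^sup>2) + 3 * (LINT x|lborel. (B x)\<^sup>2) + 3 * (LINT x|lborel. (C x)\<^sup>2)"
        using iA iB iC by simp
      also have "\<dots> < r" using fg(2) B C r unfolding A_def by linarith
      finally show "norm ((LINT x|lborel. (f x - conv (moll (1 / Suc k)) f x)\<^sup>2) - 0) < r"
        by (simp add: e_def)
    qed
  qed
qed

lemma borel_representative:
  fixes f :: "'a::euclidean_space \<Rightarrow> real"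
  assumes f: "f \<in> borel_measurable lebesgue" and R: "AE x in lebesgue. R < norm x \<longrightarrow> f x = 0"
  shows "\<exists>g. g \<in> borel_measurable borel \<and> (\<forall>x. R < norm x \<longrightarrow> g x = 0) \<and> (AE x in lebesgue. f x = g x)"
proof -
  obtain h where h: "h \<in> borel_measurable lborel" "AE x in lborel. f x = h x"
    using completion_ex_borel_measurable_real[OF f] by blast
  define g where "g = (\<lambda>x. indicat_real (cball 0 R) x * h x)"
  have "AE x in lebesgue. f x = h x" using h(2) by (rule AE_completion)
  with R have "AE x in lebesgue. f x = g x"
    by eventually_elim (auto simp: g_def indicator_def not_le)
  moreover have "g \<in> borel_measurable borel" using h(1) unfolding g_def
    by (intro borel_measurable_times borel_measurable_indicator) auto
  moreover have "\<forall>x. R < norm x \<longrightarrow> g x = 0" by (simp add: g_def)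
  ultimately show ?thesis by blast
qed

text \<open>A Borel representative reduces this to the previous lemma: the convolution does not see
  a change on a null set.\<close>

lemma moll_L2:
  fixes f :: "real^'n::finite \<Rightarrow> real"
  assumes f: "f \<in> borel_measurable lebesgue" and f2: "integrable lebesgue (\<lambda>x. (f x)\<^sup>2)"
    and R: "AE x in lebesgue. R < norm x \<longrightarrow> f x = 0"
  shows "integrable lebesgue f"
    and "0 < e \<Longrightarrow> integrable lebesgue (\<lambda>x. (f x - conv (moll e) f x)\<^sup>2)"
    and "(\<lambda>k. LINT x|lebesgue. (f x - conv (moll (1 / Suc k)) f x)\<^sup>2) \<longlonglongrightarrow> 0"
proof -
  obtain g where g[measurable]: "g \<in> borel_measurable borel" and gR: "\<And>x. R < norm x \<Longrightarrow> g x = 0"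
    and ae: "AE x in lebesgue. f x = g x"
    using borel_representative[OF f R] by blast
  have gl: "g \<in> borel_measurable lebesgue" by (rule borel_imp_lebesgue[OF g])
  have "integrable lebesgue (\<lambda>x. (g x)\<^sup>2)"
    by (rule integrable_cong_AE_imp[OF f2]) (use gl ae in \<open>auto elim!: eventually_mono\<close>)
  then have g2: "integrable lborel (\<lambda>x. (g x)\<^sup>2)" by (subst (asm) integrable_lebesgue_lborel) auto
  have gi: "integrable lborel g" by (rule integrable_of_square_integrable[OF g g2 gR])
  then have gi': "integrable lebesgue g" by (subst integrable_lebesgue_lborel) auto
  show fi: "integrable lebesgue f"
    by (rule integrable_cong_AE_imp[OF gi' f]) (use ae in \<open>auto elim!: eventually_mono\<close>)
  have cm: "conv (moll e) g \<in> borel_measurable borel" if "0 < e" for e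
    by (intro continuous_on_UNIV_borel conv_continuous moll_props that gi')
  have cc: "conv (moll e) f = conv (moll e) g" if "0 < e" for e
    by (rule conv_cong_AE[OF moll_props(1)[OF that] f gl ae])
  have i: "integrable lebesgue (\<lambda>x. (g x - conv (moll e) g x)\<^sup>2)" if e: "0 < e" for e
    using moll_L2_borel(1)[OF g g2 gR e] cm[OF e] by (subst integrable_lebesgue_lborel) auto
  have ml: "(\<lambda>x. (f x - conv (moll e) f x)\<^sup>2) \<in> borel_measurable lebesgue" if "0 < e" for e
    using f borel_imp_lebesgue[OF cm[OF that]] unfolding cc[OF that] by simp
  show "integrable lebesgue (\<lambda>x. (f x - conv (moll e) f x)\<^sup>2)" if e: "0 < e"
    by (rule integrable_cong_AE_imp[OF i[OF e] ml[OF e]]) (use ae cc[OF e] in \<open>auto elim!: eventually_mono\<close>)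
  have "(LINT x|lebesgue. (f x - conv (moll e) f x)\<^sup>2) = (LINT x|lborel. (g x - conv (moll e) g x)\<^sup>2)" if e: "0 < e" for e
  proof -
    have "(LINT x|lebesgue. (f x - conv (moll e) f x)\<^sup>2) = (LINT x|lebesgue. (g x - conv (moll e) g x)\<^sup>2)"
      using i[OF e] ml[OF e] ae cc[OF e] by (intro integral_cong_AE) (auto elim!: eventually_mono)
    also have "\<dots> = (LINT x|lborel. (g x - conv (moll e) g x)\<^sup>2)"
      using cm[OF e] by (intro integral_lebesgue_lborel) simp
    finally show ?thesis .
  qed
  then show "(\<lambda>k. LINT x|lebesgue. (f x - conv (moll (1 / Suc k)) f x)\<^sup>2) \<longlonglongrightarrow> 0"
    using moll_L2_borel(2)[OF g g2 gR] by simp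
qed

text \<open>Differentiating a mollification tests the weak gradient with the reflected kernel.
  Writing the sign as a factor \<open>- 1\<close> lets the induction close through
  \<open>C_k_mult\<close> and \<open>C_k_const\<close>.\<close>

lemma C_k_reflect: "C_k k f \<Longrightarrow> C_k k (\<lambda>y. f (x - y))"
  and partial_deriv_reflect: "f differentiable_on UNIV \<Longrightarrow>
    partial_deriv i (\<lambda>y. f (x - y)) = (\<lambda>y. - 1 * partial_deriv i f (x - y))"
proof -
  have d: "((\<lambda>y. f (x - y)) has_derivative (\<lambda>h. frechet_derivative f (at (x - y)) (- h))) (at y)"
    if "f differentiable_on UNIV" for f :: "real^'a \<Rightarrow> real" and y
  proof -
    have "(f has_derivative frechet_derivative f (at (x - y))) (at (x - y))"
      using that frechet_derivative_works by (auto dest: differentiable_on_UNIV_D)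
    moreover have "((\<lambda>y. x - y) has_derivative (\<lambda>h. - h)) (at y)"
      by (auto intro!: derivative_eq_intros)
    ultimately show ?thesis using has_derivative_compose by blast
  qed
  have p: "partial_deriv i (\<lambda>y. f (x - y)) = (\<lambda>y. - 1 * partial_deriv i f (x - y))"
    if "f differentiable_on UNIV" for f :: "real^'a \<Rightarrow> real" and i
  proof
    fix y
    have "linear (frechet_derivative f (at (x - y)))"
      using that linear_frechet_derivative by (auto dest: differentiable_on_UNIV_D)
    then show "partial_deriv i (\<lambda>y. f (x - y)) y = - 1 * partial_deriv i f (x - y)"
      unfolding partial_deriv_eq[OF d[OF that]] by (simp add: partial_deriv_def linear_neg)
  qed
  show "f differentiable_on UNIV \<Longrightarrow>
    partial_deriv i (\<lambda>y. f (x - y)) = (\<lambda>y. - 1 * partial_deriv i f (x - y))" by (rule p)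
  show "C_k k f \<Longrightarrow> C_k k (\<lambda>y. f (x - y))"
  proof (induction k arbitrary: f)
    case 0
    then show ?case by (auto intro!: continuous_on_compose2[of UNIV f] continuous_intros)
  next
    case (Suc k)
    have "(\<lambda>y. f (x - y)) differentiable_on UNIV"
      unfolding differentiable_on_def differentiable_def using d Suc.prems by fastforce
    moreover have "C_k k (\<lambda>y. - 1 * partial_deriv i f (x - y))" for i
      using Suc by (intro C_k_mult C_k_const) auto
    ultimately show ?case using p Suc.prems by (simp only: C_k.simps) blast
  qed
qed

lemma test_function_reflect:
  assumes "test_function f"
  shows "test_function (\<lambda>y. f (x - y))"
proof -
  obtain R where R: "\<And>x. R < norm x \<Longrightarrow> f x = 0" using test_functionD(6)[OF assms] by blast
  have "f (x - y) = 0" if "R + norm x < norm y" for y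
    using that norm_triangle_ineq2[of y x] by (intro R) (simp add: norm_minus_commute)
  then show ?thesis
    using test_functionD(1)[OF assms] C_k_reflect unfolding test_function_altdef by blast
qed

lemma in_Lp2_UNIV:
  fixes f :: "'a::euclidean_space \<Rightarrow> 'b::euclidean_space"
  shows "in_Lp 2 UNIV f \<longleftrightarrow> f \<in> borel_measurable lebesgue \<and> integrable lebesgue (\<lambda>x. (norm (f x))\<^sup>2)"
  by (simp add: in_Lp_def set_borel_measurable_def set_integrable_def)

text \<open>Mollification commutes with weak differentiation.\<close>

lemma H1_0_compact_support:
  fixes w :: "real^'n::finite \<Rightarrow> real"
  assumes H: "H1 w Dw" and R: "AE x in lebesgue. R < norm x \<longrightarrow> w x = 0 \<and> Dw x = 0"
  shows "H1_0 w Dw"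
proof -
  have wm: "w \<in> borel_measurable lebesgue" and w2: "integrable lebesgue (\<lambda>x. (w x)\<^sup>2)"
    and Dm: "Dw \<in> borel_measurable lebesgue" and D2: "integrable lebesgue (\<lambda>x. (norm (Dw x))\<^sup>2)"
    using H by (auto simp: H1_def in_Lp2_UNIV)
  have wg: "(LINT x|lebesgue. w x * partial_deriv i \<phi> x) = - (LINT x|lebesgue. Dw x $ i * \<phi> x)"
    if "test_function \<phi>" for \<phi> i using H that by (auto simp: H1_def has_weak_grad_def)
  have R1: "AE x in lebesgue. R < norm x \<longrightarrow> w x = 0" using R by eventually_elim auto
  note W = moll_L2[OF wm w2 R1]
  have Dim: "(\<lambda>x. Dw x $ i) \<in> borel_measurable lebesgue" for i
    by (rule measurable_compose[OF Dm]) (intro continuous_on_UNIV_borel continuous_intros)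
  have Di2: "integrable lebesgue (\<lambda>x. (Dw x $ i)\<^sup>2)" for i
  proof (rule Bochner_Integration.integrable_bound[OF D2])
    show "AE x in lebesgue. norm ((Dw x $ i)\<^sup>2) \<le> norm ((norm (Dw x))\<^sup>2)"
      using component_le_norm_cart by (auto intro!: AE_I2 simp: abs_le_square_iff[symmetric])
  qed (use Dim in simp)
  have Ri: "AE x in lebesgue. R < norm x \<longrightarrow> Dw x $ i = 0" for i
    using R by eventually_elim auto
  note D = moll_L2[OF Dim Di2 Ri]
  define J where "J = (\<lambda>k. moll (1 / Suc k) :: real^'n \<Rightarrow> real)"
  have J: "test_function (J k)" for k unfolding J_def by (rule moll_props) simp
  define \<phi> where "\<phi> = (\<lambda>k. conv (J k) w)"
  have t: "test_function (\<phi> k)" for k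
    unfolding \<phi>_def by (rule test_function_conv[OF J W(1) R1])
  have g: "grad (\<phi> k) x $ i = conv (J k) (\<lambda>y. Dw y $ i) x" for k x i
  proof -
    have "grad (\<phi> k) x $ i = (LINT y|lebesgue. partial_deriv i (J k) (x - y) * w y)"
      unfolding grad_def \<phi>_def partial_deriv_conv[OF J W(1)] by (simp add: conv_def)
    \<comment> \<open>The minus sign from reflecting the kernel cancels the one in the definition of
      the weak gradient.\<close>
    also have "\<dots> = - (LINT y|lebesgue. w y * partial_deriv i (\<lambda>y. J k (x - y)) y)"
      unfolding partial_deriv_reflect[OF test_functionD(2)[OF J]] by (simp add: mult.commute)
    also have "\<dots> = (LINT y|lebesgue. Dw y $ i * J k (x - y))"
      using wg[OF test_function_reflect[OF J]] by simp
    finally show ?thesis by (simp add: conv_def mult.commute)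
  qed
  have e: "(w x - \<phi> k x)\<^sup>2 + (norm (Dw x - grad (\<phi> k) x))\<^sup>2
      = (w x - conv (J k) w x)\<^sup>2 + (\<Sum>i\<in>UNIV. (Dw x $ i - conv (J k) (\<lambda>y. Dw y $ i) x)\<^sup>2)" for k x
    by (simp add: \<phi>_def norm_vec_def L2_set_def sum_nonneg g[unfolded \<phi>_def])
  have "(LINT x|lebesgue. (w x - \<phi> k x)\<^sup>2 + (norm (Dw x - grad (\<phi> k) x))\<^sup>2)
      = (LINT x|lebesgue. (w x - conv (J k) w x)\<^sup>2)
        + (\<Sum>i\<in>UNIV. (LINT x|lebesgue. (Dw x $ i - conv (J k) (\<lambda>y. Dw y $ i) x)\<^sup>2))" for k
    unfolding e J_def using W(2) D(2) by (simp add: Bochner_Integration.integral_sum)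
  moreover have "(\<lambda>k. (LINT x|lebesgue. (w x - conv (J k) w x)\<^sup>2)
        + (\<Sum>i\<in>UNIV. (LINT x|lebesgue. (Dw x $ i - conv (J k) (\<lambda>y. Dw y $ i) x)\<^sup>2))) \<longlonglongrightarrow> 0 + (\<Sum>i\<in>(UNIV::'n set). 0)"
    unfolding J_def by (intro tendsto_add tendsto_sum W(3) D(3))
  ultimately have "(\<lambda>k. LINT x|lebesgue. (w x - \<phi> k x)\<^sup>2 + (norm (Dw x - grad (\<phi> k) x))\<^sup>2) \<longlonglongrightarrow> 0"
    by simp
  with H t show ?thesis unfolding H1_0_def by blast
qed

section \<open>A Fefferman--Phong inequality at a fixed scale\<close>

lemma grad_continuous:
  assumes "test_function \<phi>"
  shows "continuous_on UNIV (grad \<phi>)"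
  unfolding grad_def by (intro continuous_on_vec_lambda test_functionD(4)[OF test_functionD(5)[OF assms]])

lemma grad_eq_0:
  assumes "test_function \<phi>"
  shows "\<exists>R. \<forall>x. R < norm x \<longrightarrow> grad \<phi> x = 0"
proof -
  have "\<forall>i. \<exists>R. \<forall>x. R < norm x \<longrightarrow> partial_deriv i \<phi> x = 0"
    using test_functionD(6)[OF test_functionD(5)[OF assms]] by blast
  then obtain R where R: "\<And>i x. R i < norm x \<Longrightarrow> partial_deriv i \<phi> x = 0" by metis
  have "grad \<phi> x = 0" if "Max (range R) < norm x" for x
    using R Max_ge[of "range R"] that by (auto simp: grad_def vec_eq_iff intro: le_less_trans)
  then show ?thesis by blast
qed

lemma grad_square_integrable:
  assumes "test_function \<phi>"
  shows "integrable lborel (\<lambda>x. (norm (grad \<phi> x))\<^sup>2)"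
proof -
  obtain R where "\<And>x. R < norm x \<Longrightarrow> grad \<phi> x = 0" using grad_eq_0[OF assms] by blast
  then show ?thesis
    by (intro integrable_lborel_compact_support[where R = R] continuous_intros grad_continuous assms) auto
qed

lemma test_function_square_integrable:
  assumes "test_function \<phi>"
  shows "integrable lborel (\<lambda>x. (\<phi> x)\<^sup>2)"
proof -
  obtain R where "\<And>x. R < norm x \<Longrightarrow> \<phi> x = 0" using test_functionD(6)[OF assms] by blast
  then show ?thesis
    by (intro integrable_lborel_compact_support[where R = R] continuous_intros test_functionD(4) assms) auto
qed

text \<open>Fundamental theorem of calculus along the segment, then Jensen's inequality on the unit
  interval. Stated with nonnegative integrals, so that integrating over \<open>x\<close> next
  requires no integrability.\<close>

lemma difference_square_le:
  fixes \<phi> :: "real^'n::finite \<Rightarrow> real"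
  assumes \<phi>: "test_function \<phi>"
  shows "ennreal ((\<phi> (x + h) - \<phi> x)\<^sup>2) \<le>
    (\<integral>\<^sup>+t. indicator {0..1} t * ennreal ((norm h)\<^sup>2 * (norm (grad \<phi> (x + t *\<^sub>R h)))\<^sup>2) \<partial>lborel)"
proof -
  define f where "f = (\<lambda>t. grad \<phi> (x + t *\<^sub>R h) \<bullet> h)"
  have fc: "continuous_on UNIV f"
    unfolding f_def by (intro continuous_intros continuous_on_compose2[OF grad_continuous[OF \<phi>]]) auto
  have d: "((\<lambda>t. \<phi> (x + t *\<^sub>R h)) has_vector_derivative f t) (at t within {0..1})" for t
  proof -
    have "((\<lambda>t. x + t *\<^sub>R h) has_derivative (\<lambda>s. s *\<^sub>R h)) (at t)"
      by (auto intro!: derivative_eq_intros)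
    from has_derivative_compose[OF this has_derivative_grad[OF test_functionD(3)[OF \<phi>]]]
    have "((\<lambda>t. \<phi> (x + t *\<^sub>R h)) has_derivative (\<lambda>s. s *\<^sub>R f t)) (at t)"
      by (simp add: f_def)
    then show ?thesis by (simp add: has_vector_derivative_def has_derivative_at_withinI)
  qed
  define a where "a = \<phi> (x + h) - \<phi> x"
  have "(LINT t|lborel. indicator {0..1} t *\<^sub>R f t) = \<phi> (x + 1 *\<^sub>R h) - \<phi> (x + 0 *\<^sub>R h)"
    by (rule integral_FTC_Icc[OF _ d]) (auto intro: continuous_on_subset[OF fc])
  then have a: "(LINT t|lborel. indicator {0..1} t *\<^sub>R f t) = a" by (simp add: a_def)
  have i1: "integrable lborel (\<lambda>t. indicator {0..1} t *\<^sub>R f t)"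
    by (rule borel_integrable_compact) (auto intro: continuous_on_subset[OF fc])
  have i2: "integrable lborel (\<lambda>t. indicator {0..1} t *\<^sub>R (f t)\<^sup>2)"
    by (rule borel_integrable_compact) (auto intro!: continuous_intros continuous_on_subset[OF fc])
  have "a\<^sup>2 \<le> (LINT t|lborel. indicator {0..1} t *\<^sub>R (f t)\<^sup>2)"
    using weighted_square_integral_le[of lborel "indicat_real {0..1}" f] i1 i2 a by simp
  then have "ennreal (a\<^sup>2) \<le> ennreal (LINT t|lborel. indicator {0..1} t *\<^sub>R (f t)\<^sup>2)" by (rule ennreal_leI)
  also have "\<dots> = (\<integral>\<^sup>+t. ennreal (indicator {0..1} t *\<^sub>R (f t)\<^sup>2) \<partial>lborel)"
    by (rule nn_integral_eq_integral[symmetric, OF i2]) (auto intro!: AE_I2)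
  also have "\<dots> \<le> (\<integral>\<^sup>+t. indicator {0..1} t * ennreal ((norm h)\<^sup>2 * (norm (grad \<phi> (x + t *\<^sub>R h)))\<^sup>2) \<partial>lborel)"
  proof (rule nn_integral_mono)
    fix t
    have "\<bar>f t\<bar>\<^sup>2 \<le> (norm (grad \<phi> (x + t *\<^sub>R h)) * norm h)\<^sup>2"
      unfolding f_def by (intro power_mono Cauchy_Schwarz_ineq2) auto
    then have "(f t)\<^sup>2 \<le> (norm h)\<^sup>2 * (norm (grad \<phi> (x + t *\<^sub>R h)))\<^sup>2"
      by (simp add: power_mult_distrib mult.commute)
    then show "ennreal (indicator {0..1} t *\<^sub>R (f t)\<^sup>2) \<le> indicator {0..1} t * ennreal ((norm h)\<^sup>2 * (norm (grad \<phi> (x + t *\<^sub>R h)))\<^sup>2)"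
      by (auto simp: indicator_def intro!: ennreal_leI)
  qed
  finally show ?thesis by (simp add: a_def)
qed

text \<open>After exchanging the integrals, translation invariance makes the inner integral
  independent of \<open>t\<close>.\<close>

lemma translation_L2:
  fixes \<phi> :: "real^'n::finite \<Rightarrow> real"
  assumes \<phi>: "test_function \<phi>"
  shows "(\<integral>\<^sup>+x. ennreal ((\<phi> (x + h) - \<phi> x)\<^sup>2) \<partial>lborel)
    \<le> ennreal ((norm h)\<^sup>2) * (\<integral>\<^sup>+x. ennreal ((norm (grad \<phi> x))\<^sup>2) \<partial>lborel)"
proof -
  define G where "G = (\<lambda>x. ennreal ((norm h)\<^sup>2 * (norm (grad \<phi> x))\<^sup>2))"
  have [measurable]: "G \<in> borel_measurable borel"
    unfolding G_def using continuous_on_UNIV_borel[OF grad_continuous[OF \<phi>]] by measurable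
  have "(\<integral>\<^sup>+x. ennreal ((\<phi> (x + h) - \<phi> x)\<^sup>2) \<partial>lborel)
    \<le> (\<integral>\<^sup>+x. (\<integral>\<^sup>+t. indicator {0..1} t * G (x + t *\<^sub>R h) \<partial>lborel) \<partial>lborel)"
    unfolding G_def by (intro nn_integral_mono difference_square_le \<phi>)
  also have "\<dots> = (\<integral>\<^sup>+t. (\<integral>\<^sup>+x. indicator {0..1} t * G (x + t *\<^sub>R h) \<partial>lborel) \<partial>(lborel :: real measure))"
    by (rule lborel_pair.Fubini') measurable
  also have "\<dots> = (\<integral>\<^sup>+t. indicator {0..1 :: real} t * (\<integral>\<^sup>+x. G x \<partial>lborel) \<partial>lborel)"
  proof (rule nn_integral_cong)
    fix t :: real
    have "(\<integral>\<^sup>+x. indicator {0..1} t * G (x + t *\<^sub>R h) \<partial>lborel) = indicator {0..1} t * (\<integral>\<^sup>+x. G (x + t *\<^sub>R h) \<partial>lborel)"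
      by (rule nn_integral_cmult) measurable
    also have "(\<integral>\<^sup>+x. G (x + t *\<^sub>R h) \<partial>lborel) = (\<integral>\<^sup>+x. G x \<partial>lborel)"
      using nn_integral_lborel_isometry[of G 1 "t *\<^sub>R h"] by (simp add: add.commute)
    finally show "(\<integral>\<^sup>+x. indicator {0..1} t * G (x + t *\<^sub>R h) \<partial>lborel) = indicator {0..1} t * (\<integral>\<^sup>+x. G x \<partial>lborel)" .
  qed
  also have "\<dots> = (\<integral>\<^sup>+x. G x \<partial>lborel)" by (simp add: nn_integral_multc)
  also have "\<dots> = ennreal ((norm h)\<^sup>2) * (\<integral>\<^sup>+x. ennreal ((norm (grad \<phi> x))\<^sup>2) \<partial>lborel)"
    unfolding G_def using continuous_on_UNIV_borel[OF grad_continuous[OF \<phi>]]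
    by (simp add: ennreal_mult nn_integral_cmult)
  finally show ?thesis .
qed

text \<open>Integrate \<open>(\<phi> x)\<^sup>2 \<le> 2 * (\<phi> x - \<phi> y)\<^sup>2 + 2 *
  (\<phi> y)\<^sup>2\<close> over the pairs with \<open>x\<close> in \<open>S\<close>,
  \<open>y\<close> in \<open>E\<close> and distance below \<open>r\<close>. The left side sees at
  least the fraction \<open>k\<close> of each ball, the differences are controlled by translations,
  and each \<open>y\<close> is counted with at most one ball volume.\<close>

lemma fixed_scale_test:
  fixes \<phi> :: "real^'n::finite \<Rightarrow> real"
  assumes \<phi>: "test_function \<phi>" and r: "0 < r" and k: "0 \<le> k"
    and E[measurable]: "E \<in> sets borel" and S[measurable]: "S \<in> sets borel"
    and large: "\<And>x. x \<in> S \<Longrightarrow> k * measure lborel (ball x r) \<le> measure lborel (E \<inter> ball x r)"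
  shows "k * (LINT x|lborel. indicator S x * (\<phi> x)\<^sup>2)
    \<le> 2 * r\<^sup>2 * (LINT x|lborel. (norm (grad \<phi> x))\<^sup>2) + 2 * (LINT x|lborel. indicator E x * (\<phi> x)\<^sup>2)"
proof -
  note [measurable] = test_function_borel(1)[OF \<phi>] continuous_on_UNIV_borel[OF grad_continuous[OF \<phi>]]
  define b where "b = measure lborel (ball (0 :: real^'n) r)"
  have b: "0 < b" using r by (simp add: b_def)
  have bx: "measure lborel (ball x r) = b" for x :: "real^'n"
    using r by (simp add: b_def content_ball)
  have eb: "emeasure lborel (ball x r) = ennreal b" for x :: "real^'n"
    using emeasure_lborel_ball_finite[of x r] by (subst emeasure_eq_ennreal_measure) (auto simp: bx)
  \<comment> \<open>The symmetric kernel of pairs at distance below \<open>r\<close>. Its integral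
    in either variable is the ball volume \<open>b\<close>, which finally cancels.\<close>
  define Q where "Q = (\<lambda>x y :: real^'n. if dist x y < r then 1 else 0 :: ennreal)"
  have [measurable]: "case_prod Q \<in> borel_measurable (lborel \<Otimes>\<^sub>M lborel)"
    unfolding Q_def by measurable
  have Qm: "Q x \<in> borel_measurable borel" for x
  proof -
    have "Q x = indicator (ball x r)" by (auto simp: Q_def indicator_def)
    moreover have "indicator (ball x r) \<in> borel_measurable borel"
      by (intro borel_measurable_indicator) auto
    ultimately show ?thesis by simp
  qed
  have \<phi>m: "(\<lambda>y. ennreal ((\<phi> x - \<phi> y)\<^sup>2)) \<in> borel_measurable borel" for x
    by measurable
  have Qi: "(\<integral>\<^sup>+y. Q x y \<partial>lborel) = ennreal b" for x
  proof -
    have "(\<integral>\<^sup>+y. Q x y \<partial>lborel) = (\<integral>\<^sup>+y. indicator (ball x r) y \<partial>lborel)"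
      by (intro nn_integral_cong) (auto simp: Q_def indicator_def)
    then show ?thesis by (simp add: eb)
  qed
  have Qi': "(\<integral>\<^sup>+x. Q x y \<partial>lborel) = ennreal b" for y
    using Qi[of y] by (simp add: Q_def dist_commute)
  define X where "X = (LINT x|lborel. indicator S x * (\<phi> x)\<^sup>2)"
  define Y where "Y = (LINT x|lborel. indicator E x * (\<phi> x)\<^sup>2)"
  define G where "G = (LINT x|lborel. (norm (grad \<phi> x))\<^sup>2)"
  have iS: "integrable lborel (\<lambda>x. indicator T x * (\<phi> x)\<^sup>2)" if "T \<in> sets borel" for T
    using integrable_mult_indicator[of T lborel, OF _ test_function_square_integrable[OF \<phi>]] that by simp
  have nn: "0 \<le> X" "0 \<le> Y" "0 \<le> G" unfolding X_def Y_def G_def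
    by (intro integral_nonneg_AE AE_I2; simp)+
  have X: "(\<integral>\<^sup>+x. ennreal (indicator S x * (\<phi> x)\<^sup>2) \<partial>lborel) = ennreal X"
    unfolding X_def by (rule nn_integral_eq_integral[OF iS[OF S]]) simp
  have Y: "(\<integral>\<^sup>+x. ennreal (indicator E x * (\<phi> x)\<^sup>2) \<partial>lborel) = ennreal Y"
    unfolding Y_def by (rule nn_integral_eq_integral[OF iS[OF E]]) simp
  have G: "(\<integral>\<^sup>+x. ennreal ((norm (grad \<phi> x))\<^sup>2) \<partial>lborel) = ennreal G"
    unfolding G_def by (rule nn_integral_eq_integral[OF grad_square_integrable[OF \<phi>]]) simp
  have "b * (k * X) = (k * b) * X" by (simp add: mult_ac)
  then have "ennreal (b * (k * X)) = ennreal (k * b) * ennreal X"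
    using k b nn by (simp only: ennreal_mult mult_nonneg_nonneg less_imp_le)
  also have "\<dots> = (\<integral>\<^sup>+x. ennreal (k * b) * ennreal (indicator S x * (\<phi> x)\<^sup>2) \<partial>lborel)"
    unfolding X[symmetric] by (rule nn_integral_cmult[symmetric]) measurable
  also have "\<dots> \<le> (\<integral>\<^sup>+x. (\<integral>\<^sup>+y. Q x y * (2 * ennreal ((\<phi> x - \<phi> y)\<^sup>2) + 2 * ennreal (indicator E y * (\<phi> y)\<^sup>2)) \<partial>lborel) \<partial>lborel)"
  proof (rule nn_integral_mono)
    fix x :: "real^'n"
    show "ennreal (k * b) * ennreal (indicator S x * (\<phi> x)\<^sup>2) \<le>
      (\<integral>\<^sup>+y. Q x y * (2 * ennreal ((\<phi> x - \<phi> y)\<^sup>2) + 2 * ennreal (indicator E y * (\<phi> y)\<^sup>2)) \<partial>lborel)"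
    proof (cases "x \<in> S")
      case True
      have fin: "emeasure lborel (E \<inter> ball x r) \<noteq> \<infinity>"
        using emeasure_mono[of "E \<inter> ball x r" "ball x r" lborel] by (auto simp: eb top_unique)
      have "ennreal (k * b) \<le> emeasure lborel (E \<inter> ball x r)"
        using large[OF True] fin unfolding bx by (subst emeasure_eq_ennreal_measure) (auto intro: ennreal_leI)
      also have "\<dots> = (\<integral>\<^sup>+y. indicator (E \<inter> ball x r) y \<partial>lborel)" by simp
      finally have "ennreal (k * b) * ennreal ((\<phi> x)\<^sup>2) \<le> (\<integral>\<^sup>+y. indicator (E \<inter> ball x r) y \<partial>lborel) * ennreal ((\<phi> x)\<^sup>2)"
        by (rule mult_right_mono) simp
      also have "\<dots> = (\<integral>\<^sup>+y. indicator (E \<inter> ball x r) y * ennreal ((\<phi> x)\<^sup>2) \<partial>lborel)"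
        using E by (intro nn_integral_multc[symmetric] borel_measurable_indicator) auto
      also have "\<dots> \<le> (\<integral>\<^sup>+y. Q x y * (2 * ennreal ((\<phi> x - \<phi> y)\<^sup>2) + 2 * ennreal (indicator E y * (\<phi> y)\<^sup>2)) \<partial>lborel)"
      proof (rule nn_integral_mono)
        fix y
        have "(\<phi> x)\<^sup>2 \<le> 2 * (\<phi> x - \<phi> y)\<^sup>2 + 2 * (\<phi> y)\<^sup>2"
          using zero_le_power2[of "\<phi> x - 2 * \<phi> y"] by (simp add: power2_eq_square algebra_simps)
        then have "ennreal ((\<phi> x)\<^sup>2) \<le> ennreal (2 * (\<phi> x - \<phi> y)\<^sup>2 + 2 * (\<phi> y)\<^sup>2)" by (rule ennreal_leI)
        also have "\<dots> = 2 * ennreal ((\<phi> x - \<phi> y)\<^sup>2) + 2 * ennreal ((\<phi> y)\<^sup>2)"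
          by (simp add: ennreal_plus ennreal_mult')
        finally show "indicator (E \<inter> ball x r) y * ennreal ((\<phi> x)\<^sup>2)
          \<le> Q x y * (2 * ennreal ((\<phi> x - \<phi> y)\<^sup>2) + 2 * ennreal (indicator E y * (\<phi> y)\<^sup>2))"
          by (auto simp: Q_def indicator_def)
      qed
      finally show ?thesis using True by simp
    qed simp
  qed
  also have "\<dots> = 2 * (\<integral>\<^sup>+x. (\<integral>\<^sup>+y. Q x y * ennreal ((\<phi> x - \<phi> y)\<^sup>2) \<partial>lborel) \<partial>lborel)
      + 2 * (\<integral>\<^sup>+x. (\<integral>\<^sup>+y. Q x y * ennreal (indicator E y * (\<phi> y)\<^sup>2) \<partial>lborel) \<partial>lborel)"
  proof -
    have "(\<integral>\<^sup>+y. Q x y * (2 * ennreal ((\<phi> x - \<phi> y)\<^sup>2) + 2 * ennreal (indicator E y * (\<phi> y)\<^sup>2)) \<partial>lborel)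
      = 2 * (\<integral>\<^sup>+y. Q x y * ennreal ((\<phi> x - \<phi> y)\<^sup>2) \<partial>lborel)
        + 2 * (\<integral>\<^sup>+y. Q x y * ennreal (indicator E y * (\<phi> y)\<^sup>2) \<partial>lborel)" for x
    proof -
      have "(\<integral>\<^sup>+y. Q x y * (2 * ennreal ((\<phi> x - \<phi> y)\<^sup>2) + 2 * ennreal (indicator E y * (\<phi> y)\<^sup>2)) \<partial>lborel)
        = (\<integral>\<^sup>+y. 2 * (Q x y * ennreal ((\<phi> x - \<phi> y)\<^sup>2)) + 2 * (Q x y * ennreal (indicator E y * (\<phi> y)\<^sup>2)) \<partial>lborel)"
        by (intro nn_integral_cong) (simp add: distrib_left mult_ac)
      then show ?thesis by (simp add: nn_integral_add nn_integral_cmult)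
    qed
    then show ?thesis by (simp add: nn_integral_add nn_integral_cmult)
  qed
  also have "(\<integral>\<^sup>+x. (\<integral>\<^sup>+y. Q x y * ennreal (indicator E y * (\<phi> y)\<^sup>2) \<partial>lborel) \<partial>lborel) = ennreal b * ennreal Y"
  proof -
    have "(\<integral>\<^sup>+x. (\<integral>\<^sup>+y. Q x y * ennreal (indicator E y * (\<phi> y)\<^sup>2) \<partial>lborel) \<partial>lborel)
      = (\<integral>\<^sup>+y. (\<integral>\<^sup>+x. Q x y * ennreal (indicator E y * (\<phi> y)\<^sup>2) \<partial>lborel) \<partial>lborel)"
      by (rule lborel_pair.Fubini'[symmetric]) measurable
    also have "\<dots> = (\<integral>\<^sup>+y. ennreal b * ennreal (indicator E y * (\<phi> y)\<^sup>2) \<partial>lborel)"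
      by (intro nn_integral_cong) (simp add: nn_integral_multc Qi')
    also have "\<dots> = ennreal b * ennreal Y" unfolding Y[symmetric] by (rule nn_integral_cmult) measurable
    finally show ?thesis .
  qed
  \<comment> \<open>Substituting \<open>y = x + h\<close> turns the constraint into one on
    \<open>h\<close> alone, so that the translation estimate applies for each fixed
    \<open>h\<close>.\<close>
  also have "(\<integral>\<^sup>+x. (\<integral>\<^sup>+y. Q x y * ennreal ((\<phi> x - \<phi> y)\<^sup>2) \<partial>lborel) \<partial>lborel)
      = (\<integral>\<^sup>+x. (\<integral>\<^sup>+h. Q 0 h * ennreal ((\<phi> (x + h) - \<phi> x)\<^sup>2) \<partial>lborel) \<partial>lborel)"
  proof (rule nn_integral_cong)
    fix x :: "real^'n"
    have "(\<integral>\<^sup>+h. Q x (x + 1 *\<^sub>R h) * ennreal ((\<phi> x - \<phi> (x + 1 *\<^sub>R h))\<^sup>2) \<partial>lborel)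
      = (\<integral>\<^sup>+y. Q x y * ennreal ((\<phi> x - \<phi> y)\<^sup>2) \<partial>lborel)"
      by (rule nn_integral_lborel_isometry[where f = "\<lambda>y. Q x y * ennreal ((\<phi> x - \<phi> y)\<^sup>2)"])
        (use Qm[of x] \<phi>m[of x] in auto)
    then show "(\<integral>\<^sup>+y. Q x y * ennreal ((\<phi> x - \<phi> y)\<^sup>2) \<partial>lborel) = (\<integral>\<^sup>+h. Q 0 h * ennreal ((\<phi> (x + h) - \<phi> x)\<^sup>2) \<partial>lborel)"
      by (simp add: Q_def dist_norm power2_commute)
  qed
  also have "\<dots> = (\<integral>\<^sup>+h. (\<integral>\<^sup>+x. Q 0 h * ennreal ((\<phi> (x + h) - \<phi> x)\<^sup>2) \<partial>lborel) \<partial>lborel)"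
    by (rule lborel_pair.Fubini') measurable
  also have "\<dots> \<le> (\<integral>\<^sup>+h. Q 0 h * ennreal (r\<^sup>2 * G) \<partial>lborel)"
  proof (rule nn_integral_mono)
    fix h :: "real^'n"
    have "(\<integral>\<^sup>+x. Q 0 h * ennreal ((\<phi> (x + h) - \<phi> x)\<^sup>2) \<partial>lborel) = Q 0 h * (\<integral>\<^sup>+x. ennreal ((\<phi> (x + h) - \<phi> x)\<^sup>2) \<partial>lborel)"
      by (rule nn_integral_cmult) measurable
    also have "\<dots> \<le> Q 0 h * (ennreal ((norm h)\<^sup>2) * ennreal G)"
      using translation_L2[OF \<phi>, of h] unfolding G by (intro mult_left_mono) auto
    also have "\<dots> \<le> Q 0 h * ennreal (r\<^sup>2 * G)"
    proof (cases "norm h < r")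
      case True
      then have "(norm h)\<^sup>2 * G \<le> r\<^sup>2 * G" using nn by (intro mult_right_mono power_mono) auto
      then show ?thesis using nn by (intro mult_left_mono) (auto simp: ennreal_mult[symmetric] intro!: ennreal_leI)
    qed (simp add: Q_def)
    finally show "(\<integral>\<^sup>+x. Q 0 h * ennreal ((\<phi> (x + h) - \<phi> x)\<^sup>2) \<partial>lborel) \<le> Q 0 h * ennreal (r\<^sup>2 * G)" .
  qed
  also have "\<dots> = ennreal b * ennreal (r\<^sup>2 * G)"
    by (subst nn_integral_multc) (auto simp: Qi)
  finally have "ennreal (b * (k * X)) \<le> 2 * (ennreal b * ennreal (r\<^sup>2 * G)) + 2 * (ennreal b * ennreal Y)"
    by (simp add: mult_left_mono add_right_mono)
  also have "\<dots> = ennreal (b * (2 * r\<^sup>2 * G + 2 * Y))"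
  proof -
    have "2 * (ennreal b * ennreal (r\<^sup>2 * G)) = ennreal (2 * (b * (r\<^sup>2 * G)))"
      "2 * (ennreal b * ennreal Y) = ennreal (2 * (b * Y))"
      using b nn by (simp_all add: ennreal_mult)
    moreover have "ennreal (2 * (b * (r\<^sup>2 * G))) + ennreal (2 * (b * Y)) = ennreal (2 * (b * (r\<^sup>2 * G)) + 2 * (b * Y))"
      using b nn by (intro ennreal_plus[symmetric]) auto
    ultimately show ?thesis by (simp add: algebra_simps)
  qed
  finally have "b * (k * X) \<le> b * (2 * r\<^sup>2 * G + 2 * Y)"
    using b nn by (subst (asm) ennreal_le_iff) auto
  then show ?thesis using b by (simp add: X_def Y_def G_def)
qed

lemma norm_diff_square_le:
  fixes a b :: "'a::real_inner"
  shows "(norm (a - b))\<^sup>2 \<le> 2 * (norm a)\<^sup>2 + 2 * (norm b)\<^sup>2"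
  using zero_le_power2[of "norm (a + b)"] unfolding power2_norm_eq_inner
  by (simp add: inner_diff inner_add inner_commute)

text \<open>Passage to the limit along approximating test functions. The factors grow from 2 to 8
  because squares are compared twice, once on each side, at the cost of a factor 2 each
  time.\<close>

lemma fixed_scale_H1_0:
  fixes w :: "real^'n::finite \<Rightarrow> real"
  assumes w: "H1_0 w Dw" and r: "0 < r" and k: "0 \<le> k" "k \<le> 1"
    and E: "E \<in> sets lebesgue" and S: "S \<in> sets borel"
    and large: "\<And>x. x \<in> S \<Longrightarrow> k * measure lebesgue (ball x r) \<le> measure lebesgue (E \<inter> ball x r)"
  shows "k * (LINT x|lebesgue. indicator S x * (w x)\<^sup>2)
    \<le> 8 * r\<^sup>2 * (LINT x|lebesgue. (norm (Dw x))\<^sup>2) + 8 * (LINT x|lebesgue. indicator E x * (w x)\<^sup>2)"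
proof -
  have wm: "w \<in> borel_measurable lebesgue" and w2: "integrable lebesgue (\<lambda>x. (w x)\<^sup>2)"
    and Dm: "Dw \<in> borel_measurable lebesgue" and D2: "integrable lebesgue (\<lambda>x. (norm (Dw x))\<^sup>2)"
    using w by (auto simp: H1_0_def H1_def in_Lp2_UNIV)
  obtain \<phi> where t: "\<And>k. test_function (\<phi> k)"
    and lim: "(\<lambda>k. LINT x|lebesgue. (w x - \<phi> k x)\<^sup>2 + (norm (Dw x - grad (\<phi> k) x))\<^sup>2) \<longlonglongrightarrow> 0"
    using w by (auto simp: H1_0_def)
  \<comment> \<open>The test-function version works with Borel sets, so \<open>E\<close> is replaced
    by the set where a Borel version of its indicator equals 1.\<close>
  obtain g where g: "g \<in> borel_measurable lborel" "AE x in lborel. indicat_real E x = g x"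
    using completion_ex_borel_measurable_real[of "indicat_real E" lborel] E by auto
  define E' where "E' = {x. g x = 1}"
  have E'[measurable]: "E' \<in> sets borel"
  proof -
    have "E' = g -` {1} \<inter> space lborel" by (auto simp: E'_def)
    then show ?thesis using measurable_sets[OF g(1), of "{1}"] by simp
  qed
  have EE: "AE x in lebesgue. x \<in> E \<longleftrightarrow> x \<in> E'"
    using AE_completion[OF g(2)] by eventually_elim (auto simp: E'_def indicator_def split: if_splits)
  have large': "k * measure lborel (ball x r) \<le> measure lborel (E' \<inter> ball x r)" if "x \<in> S" for x
  proof -
    have "measure lebesgue (E \<inter> ball x r) = measure lebesgue (E' \<inter> ball x r)"
      using E EE by (intro measure_eq_AE) (auto elim!: eventually_mono)
    then show ?thesis using large[OF that] by simp
  qed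
  define W where "W = (LINT x|lebesgue. indicator S x * (w x)\<^sup>2)"
  define D where "D = (LINT x|lebesgue. (norm (Dw x))\<^sup>2)"
  define F where "F = (LINT x|lebesgue. indicator E x * (w x)\<^sup>2)"
  define e where "e = (\<lambda>j. LINT x|lebesgue. (w x - \<phi> j x)\<^sup>2 + (norm (Dw x - grad (\<phi> j) x))\<^sup>2)"
  have Sl: "S \<in> sets lebesgue" "E' \<in> sets lebesgue" using S E' by auto
  have iw: "integrable lebesgue (\<lambda>x. indicator T x * (w x)\<^sup>2)" if "T \<in> sets lebesgue" for T
    using integrable_mult_indicator[OF that w2] by simp
  \<comment> \<open>All replacements of the limit by the \<open>j\<close>-th test function cost
    multiples of the single error \<open>e j\<close>, which tends to 0.\<close>
  have step: "k * W \<le> 8 * r\<^sup>2 * D + 8 * F + (2 + 8 * r\<^sup>2 + 8) * e j" for j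
  proof -
    note tm = test_function_borel[OF t[of j]]
    have gm: "grad (\<phi> j) \<in> borel_measurable borel" by (rule continuous_on_UNIV_borel[OF grad_continuous[OF t]])
    have p2: "integrable lebesgue (\<lambda>x. (\<phi> j x)\<^sup>2)"
      using test_function_square_integrable[OF t, of j] tm by (subst integrable_lebesgue_lborel) auto
    have g2: "integrable lebesgue (\<lambda>x. (norm (grad (\<phi> j) x))\<^sup>2)"
      using grad_square_integrable[OF t, of j] gm by (subst integrable_lebesgue_lborel) auto
    have ip: "integrable lebesgue (\<lambda>x. indicator T x * (\<phi> j x)\<^sup>2)" if "T \<in> sets lebesgue" for T
      using integrable_mult_indicator[OF that p2] by simp
    define d where "d = (\<lambda>x. (w x - \<phi> j x)\<^sup>2 + (norm (Dw x - grad (\<phi> j) x))\<^sup>2)"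
    note par = norm_diff_square_le
    have dm: "d \<in> borel_measurable lebesgue"
      unfolding d_def using wm tm Dm borel_imp_lebesgue[OF gm] by simp
    have di: "integrable lebesgue d"
    proof (rule Bochner_Integration.integrable_bound[OF _ dm])
      show "integrable lebesgue (\<lambda>x. (2 * (w x)\<^sup>2 + 2 * (\<phi> j x)\<^sup>2) + (2 * (norm (Dw x))\<^sup>2 + 2 * (norm (grad (\<phi> j) x))\<^sup>2))"
        using w2 p2 D2 g2 by simp
      show "AE x in lebesgue. norm (d x) \<le> norm ((2 * (w x)\<^sup>2 + 2 * (\<phi> j x)\<^sup>2) + (2 * (norm (Dw x))\<^sup>2 + 2 * (norm (grad (\<phi> j) x))\<^sup>2))"
      proof (rule AE_I2)
        fix x
        show "norm (d x) \<le> norm ((2 * (w x)\<^sup>2 + 2 * (\<phi> j x)\<^sup>2) + (2 * (norm (Dw x))\<^sup>2 + 2 * (norm (grad (\<phi> j) x))\<^sup>2))"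
          using par[of "w x" "\<phi> j x"] par[of "Dw x" "grad (\<phi> j) x"] by (simp add: d_def)
      qed
    qed
    have pt1: "(w x)\<^sup>2 \<le> 2 * (\<phi> j x)\<^sup>2 + 2 * d x" for x
    proof -
      have "(w x)\<^sup>2 \<le> 2 * (\<phi> j x)\<^sup>2 + 2 * (w x - \<phi> j x)\<^sup>2"
        using par[of "\<phi> j x" "\<phi> j x - w x"] by (simp add: power2_commute)
      then show ?thesis unfolding d_def distrib_left by (simp add: add_increasing2 flip: add.assoc)
    qed
    have pt2: "(\<phi> j x)\<^sup>2 \<le> 2 * (w x)\<^sup>2 + 2 * d x" for x
      using par[of "w x" "w x - \<phi> j x"]
      unfolding d_def distrib_left by (simp add: add_increasing2 flip: add.assoc)
    have pt3: "(norm (grad (\<phi> j) x))\<^sup>2 \<le> 2 * (norm (Dw x))\<^sup>2 + 2 * d x" for x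
    proof -
      have "(norm (grad (\<phi> j) x))\<^sup>2 \<le> 2 * (norm (Dw x))\<^sup>2 + 2 * (norm (Dw x - grad (\<phi> j) x))\<^sup>2"
        using par[of "Dw x" "Dw x - grad (\<phi> j) x"] by simp
      also have "\<dots> \<le> 2 * (norm (Dw x))\<^sup>2 + 2 * d x" by (simp add: d_def)
      finally show ?thesis .
    qed
    have d0: "0 \<le> d x" for x by (simp add: d_def)
    have e: "integral\<^sup>L lebesgue d = e j" by (simp add: e_def d_def)
    have 1: "W \<le> 2 * (LINT x|lebesgue. indicator S x * (\<phi> j x)\<^sup>2) + 2 * e j"
    proof -
      have "W \<le> (LINT x|lebesgue. 2 * (indicator S x * (\<phi> j x)\<^sup>2) + 2 * d x)"
        unfolding W_def
      proof (rule integral_mono)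
        fix x show "indicator S x * (w x)\<^sup>2 \<le> 2 * (indicator S x * (\<phi> j x)\<^sup>2) + 2 * d x"
          using pt1[of x] d0[of x] by (auto simp: indicator_def)
      qed (use iw[OF Sl(1)] ip[OF Sl(1)] di in auto)
      then show ?thesis using ip[OF Sl(1)] di e by simp
    qed
    have 2: "(LINT x|lebesgue. indicator E' x * (\<phi> j x)\<^sup>2) \<le> 2 * F + 2 * e j"
    proof -
      have "(LINT x|lebesgue. indicator E' x * (\<phi> j x)\<^sup>2) \<le> (LINT x|lebesgue. 2 * (indicator E x * (w x)\<^sup>2) + 2 * d x)"
      proof (rule integral_mono_AE)
        show "AE x in lebesgue. indicator E' x * (\<phi> j x)\<^sup>2 \<le> 2 * (indicator E x * (w x)\<^sup>2) + 2 * d x"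
          using EE
        proof eventually_elim
          case (elim x)
          then show ?case using pt2[of x] d0[of x] by (auto simp: indicator_def)
        qed
      qed (use iw[OF E] ip[OF Sl(2)] di in auto)
      then show ?thesis using iw[OF E] di e by (simp add: F_def)
    qed
    have 3: "(LINT x|lebesgue. (norm (grad (\<phi> j) x))\<^sup>2) \<le> 2 * D + 2 * e j"
    proof -
      have "(LINT x|lebesgue. (norm (grad (\<phi> j) x))\<^sup>2) \<le> (LINT x|lebesgue. 2 * (norm (Dw x))\<^sup>2 + 2 * d x)"
        by (rule integral_mono[OF g2 _ pt3]) (use D2 di in auto)
      then show ?thesis using D2 di e by (simp add: D_def)
    qed
    have tb: "(LINT x|lebesgue. indicator T x * (\<phi> j x)\<^sup>2) = (LINT x|lborel. indicator T x * (\<phi> j x)\<^sup>2)"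
      if "T \<in> sets borel" for T
      by (rule integral_lebesgue_lborel) (use tm that in simp)
    have gb: "(LINT x|lebesgue. (norm (grad (\<phi> j) x))\<^sup>2) = (LINT x|lborel. (norm (grad (\<phi> j) x))\<^sup>2)"
      by (rule integral_lebesgue_lborel) (use gm in simp)
    have "k * (LINT x|lebesgue. indicator S x * (\<phi> j x)\<^sup>2)
      \<le> 2 * r\<^sup>2 * (LINT x|lebesgue. (norm (grad (\<phi> j) x))\<^sup>2) + 2 * (LINT x|lebesgue. indicator E' x * (\<phi> j x)\<^sup>2)"
      unfolding tb[OF S] tb[OF E'] gb by (rule fixed_scale_test[OF t r k(1) E' S large'])
    also have "\<dots> \<le> 2 * r\<^sup>2 * (2 * D + 2 * e j) + 2 * (2 * F + 2 * e j)"
      using 2 3 by (intro add_mono mult_left_mono) auto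
    finally have 4: "k * (LINT x|lebesgue. indicator S x * (\<phi> j x)\<^sup>2) \<le> 2 * r\<^sup>2 * (2 * D + 2 * e j) + 2 * (2 * F + 2 * e j)" .
    have e0: "0 \<le> e j" unfolding e[symmetric] using d0 by (intro integral_nonneg_AE) auto
    have "k * W \<le> k * (2 * (LINT x|lebesgue. indicator S x * (\<phi> j x)\<^sup>2) + 2 * e j)"
      using 1 k by (intro mult_left_mono) auto
    also have "\<dots> = 2 * (k * (LINT x|lebesgue. indicator S x * (\<phi> j x)\<^sup>2)) + k * (2 * e j)" by (simp add: algebra_simps)
    also have "\<dots> \<le> 2 * (2 * r\<^sup>2 * (2 * D + 2 * e j) + 2 * (2 * F + 2 * e j)) + 1 * (2 * e j)"
      using 4 k e0 by (intro add_mono mult_left_mono mult_right_mono) auto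
    finally show ?thesis by (simp add: algebra_simps)
  qed
  have "(\<lambda>j. 8 * r\<^sup>2 * D + 8 * F + (2 + 8 * r\<^sup>2 + 8) * e j) \<longlonglongrightarrow> 8 * r\<^sup>2 * D + 8 * F + (2 + 8 * r\<^sup>2 + 8) * 0"
    unfolding e_def by (intro tendsto_intros lim)
  then have "k * W \<le> 8 * r\<^sup>2 * D + 8 * F + (2 + 8 * r\<^sup>2 + 8) * 0"
    by (rule LIMSEQ_le_const) (use step in blast)
  then show ?thesis by (simp add: W_def D_def F_def)
qed

section \<open>Energy estimates for weak solutions\<close>

lemma in_Lp_loc_1_integrable:
  fixes f :: "'a::euclidean_space \<Rightarrow> 'b::euclidean_space"
  assumes "integrable lebesgue f"
  shows "in_Lp_loc 1 f"
proof -
  have "set_integrable lebesgue K (\<lambda>x. norm (f x))" if "compact K" for K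
    unfolding set_integrable_def
    by (intro integrable_mult_indicator integrable_norm assms) (use that lmeasurable_compact in auto)
  moreover have "set_borel_measurable lebesgue K f" if "compact K" for K
    using assms that unfolding set_borel_measurable_def
    by (intro borel_measurable_scaleR borel_measurable_indicator) (use lmeasurable_compact in auto)
  ultimately show ?thesis by (simp add: in_Lp_loc_def in_Lp_def)
qed

lemma integrable_square_times_compact:
  fixes u :: "real^'n::finite \<Rightarrow> 'b::euclidean_space"
  assumes u: "in_Lp_loc 2 u" and \<eta>: "test_function \<eta>"
  shows "integrable lebesgue (\<lambda>x. (\<eta> x)\<^sup>2 * (norm (u x))\<^sup>2)"
proof -
  obtain R where R: "\<And>x. R < norm x \<Longrightarrow> \<eta> x = 0" using test_functionD(6)[OF \<eta>] by blast
  obtain B where B: "\<And>x. \<bar>\<eta> x\<bar> \<le> B" using test_function_bounded[OF \<eta>] by blast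
  have "set_integrable lebesgue (cball 0 R) (\<lambda>x. norm (u x) powr 2)"
    using u compact_cball[of "0 :: real^'n" R] unfolding in_Lp_loc_def in_Lp_def by simp
  then have i: "integrable lebesgue (\<lambda>x. indicat_real (cball 0 R) x * (norm (u x))\<^sup>2)"
    by (simp add: set_integrable_def)
  have "(\<eta> x)\<^sup>2 \<le> B\<^sup>2" for x
    using power_mono[OF B[of x], of 2] by simp
  then have "integrable lebesgue (\<lambda>x. (\<eta> x)\<^sup>2 * (indicat_real (cball 0 R) x * (norm (u x))\<^sup>2))"
    using test_function_borel(2)[OF \<eta>] by (intro integrable_bounded_mult[OF i, of _ "B\<^sup>2"]) auto
  moreover have "(\<lambda>x. (\<eta> x)\<^sup>2 * (indicat_real (cball 0 R) x * (norm (u x))\<^sup>2)) = (\<lambda>x. (\<eta> x)\<^sup>2 * (norm (u x))\<^sup>2)"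
    using R by (auto simp: fun_eq_iff indicator_def not_le)
  ultimately show ?thesis by simp
qed

lemma integrable_times_compact:
  fixes u :: "real^'n::finite \<Rightarrow> 'b::euclidean_space"
  assumes u: "in_Lp_loc 1 u" and \<eta>: "test_function \<eta>"
  shows "integrable lebesgue (\<lambda>x. \<eta> x *\<^sub>R u x)"
proof -
  obtain R where R: "\<And>x. R < norm x \<Longrightarrow> \<eta> x = 0" using test_functionD(6)[OF \<eta>] by blast
  obtain B where B: "\<And>x. \<bar>\<eta> x\<bar> \<le> B" using test_function_bounded[OF \<eta>] by blast
  have um: "u \<in> borel_measurable lebesgue" by (rule in_Lp_loc_measurable[OF u])
  have "set_integrable lebesgue (cball 0 R) (\<lambda>x. norm (u x) powr 1)"
    using u compact_cball[of "0 :: real^'n" R] unfolding in_Lp_loc_def in_Lp_def by simp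
  then have i: "integrable lebesgue (\<lambda>x. indicat_real (cball 0 R) x * norm (u x))"
    by (simp add: set_integrable_def)
  have "integrable lebesgue (\<lambda>x. \<eta> x * (indicat_real (cball 0 R) x * norm (u x)))"
    using test_function_borel(2)[OF \<eta>] B by (intro integrable_bounded_mult[OF i, of _ B]) auto
  then show ?thesis
  proof (rule Bochner_Integration.integrable_bound)
    show "AE x in lebesgue. norm (\<eta> x *\<^sub>R u x) \<le> norm (\<eta> x * (indicat_real (cball 0 R) x * norm (u x)))"
      using R by (auto intro!: AE_I2 simp: abs_mult indicator_def not_le)
  qed (use um test_function_borel(2)[OF \<eta>] in simp)
qed

lemma in_Lp_loc_2_ball:
  fixes u :: "'a::euclidean_space \<Rightarrow> 'b::euclidean_space"
  assumes "in_Lp_loc 2 u"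
  shows "set_integrable lebesgue (ball x r) (\<lambda>x. (norm (u x))\<^sup>2)"
proof -
  have "set_integrable lebesgue (cball x r) (\<lambda>x. norm (u x) powr 2)"
    using assms compact_cball[of x r] unfolding in_Lp_loc_def in_Lp_def by simp
  then have "set_integrable lebesgue (ball x r) (\<lambda>x. norm (u x) powr 2)"
    by (rule set_integrable_subset) auto
  then show ?thesis by simp
qed

lemma integrable_gradient_term:
  fixes u :: "real^'n::finite \<Rightarrow> real"
  assumes u2: "in_Lp_loc 2 u" and \<eta>: "test_function \<eta>"
  shows "integrable lebesgue (\<lambda>x. (u x)\<^sup>2 * (norm (grad \<eta> x))\<^sup>2)"
proof -
  have "integrable lebesgue (\<lambda>x. \<Sum>i\<in>UNIV. (partial_deriv i \<eta> x)\<^sup>2 * (norm (u x))\<^sup>2)"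
    by (intro Bochner_Integration.integrable_sum integrable_square_times_compact[OF u2] test_functionD(5)[OF \<eta>])
  then show ?thesis
    by (simp add: norm_vec_def L2_set_def sum_nonneg grad_def sum_distrib_left mult.commute)
qed

text \<open>The Leibniz rule follows from testing the weak gradient of \<open>u\<close> with
  \<open>\<eta>\<close> times the test function. The product has bounded support, and mollification
  then puts it in \<open>H1_0\<close>; this supplies the admissible functions for the
  equation.\<close>

lemma H1_0_product:
  fixes u :: "real^'n::finite \<Rightarrow> real"
  assumes H: "H1_loc u Du" and \<eta>: "test_function \<eta>"
  shows "H1_0 (\<lambda>x. \<eta> x * u x) (\<lambda>x. \<eta> x *\<^sub>R Du x + u x *\<^sub>R grad \<eta> x)"
proof -
  have u1: "in_Lp_loc 1 u" and D1: "in_Lp_loc 1 Du" and u2: "in_Lp_loc 2 u" and D2: "in_Lp_loc 2 Du"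
    and wg: "\<And>\<phi> i. test_function \<phi> \<Longrightarrow>
        (LINT x|lebesgue. u x * partial_deriv i \<phi> x) = - (LINT x|lebesgue. Du x $ i * \<phi> x)"
    using H by (auto simp: H1_loc_def has_weak_grad_def)
  have um: "u \<in> borel_measurable lebesgue" and Dm: "Du \<in> borel_measurable lebesgue"
    using in_Lp_loc_measurable[OF u1] in_Lp_loc_measurable[OF D1] by auto
  have \<eta>m: "\<eta> \<in> borel_measurable lebesgue" by (rule test_function_borel(2)[OF \<eta>])
  have gm: "grad \<eta> \<in> borel_measurable lebesgue"
    by (rule borel_imp_lebesgue[OF continuous_on_UNIV_borel[OF grad_continuous[OF \<eta>]]])
  have Di1: "integrable lebesgue (\<lambda>x. \<phi> x * Du x $ i)" if \<phi>: "test_function \<phi>" for \<phi> i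
    using integrable_bounded_linear[OF bounded_linear_vec_nth[of i] integrable_times_compact[OF D1 \<phi>]] by simp
  define w where "w = (\<lambda>x. \<eta> x * u x)"
  define Dw where "Dw = (\<lambda>x. \<eta> x *\<^sub>R Du x + u x *\<^sub>R grad \<eta> x)"
  have wm: "w \<in> borel_measurable lebesgue" and Dwm: "Dw \<in> borel_measurable lebesgue"
    unfolding w_def Dw_def using um Dm \<eta>m gm by simp_all
  have w2: "integrable lebesgue (\<lambda>x. (norm (w x))\<^sup>2)"
    using integrable_square_times_compact[OF u2 \<eta>] by (simp add: w_def power_mult_distrib)
  note ug2 = integrable_gradient_term[OF u2 \<eta>]
  have Dw2: "integrable lebesgue (\<lambda>x. (norm (Dw x))\<^sup>2)"
  proof (rule Bochner_Integration.integrable_bound)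
    show "integrable lebesgue (\<lambda>x. 2 * ((\<eta> x)\<^sup>2 * (norm (Du x))\<^sup>2) + 2 * ((u x)\<^sup>2 * (norm (grad \<eta> x))\<^sup>2))"
      using ug2 integrable_square_times_compact[OF D2 \<eta>] by simp
    show "AE x in lebesgue. norm ((norm (Dw x))\<^sup>2)
      \<le> norm (2 * ((\<eta> x)\<^sup>2 * (norm (Du x))\<^sup>2) + 2 * ((u x)\<^sup>2 * (norm (grad \<eta> x))\<^sup>2))"
    proof (rule AE_I2)
      fix x
      show "norm ((norm (Dw x))\<^sup>2)
        \<le> norm (2 * ((\<eta> x)\<^sup>2 * (norm (Du x))\<^sup>2) + 2 * ((u x)\<^sup>2 * (norm (grad \<eta> x))\<^sup>2))"
        using norm_diff_square_le[of "\<eta> x *\<^sub>R Du x" "- (u x *\<^sub>R grad \<eta> x)"]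
        by (simp add: Dw_def power_mult_distrib)
    qed
  qed (use Dwm in simp)
  obtain R where R: "\<And>x. R < norm x \<Longrightarrow> \<eta> x = 0" using test_functionD(6)[OF \<eta>] by blast
  obtain R' where R': "\<And>x. R' < norm x \<Longrightarrow> grad \<eta> x = 0" using grad_eq_0[OF \<eta>] by blast
  have supp: "AE x in lebesgue. max R R' < norm x \<longrightarrow> w x = 0 \<and> Dw x = 0"
    using R R' by (auto intro!: AE_I2 simp: w_def Dw_def)
  have wi: "integrable lebesgue w"
    unfolding w_def using integrable_times_compact[OF u1 \<eta>] by simp
  have Dwi: "integrable lebesgue Dw"
  proof (rule Bochner_Integration.integrable_bound[OF _ Dwm])
    show "integrable lebesgue (\<lambda>x. indicat_real (cball (0 :: real^'n) (max R R')) x + (norm (Dw x))\<^sup>2)"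
      using Dw2 by (intro Bochner_Integration.integrable_add integrable_real_indicator)
        (use emeasure_lborel_cball_finite in auto)
    show "AE x in lebesgue. norm (Dw x) \<le> norm (indicat_real (cball (0 :: real^'n) (max R R')) x + (norm (Dw x))\<^sup>2)"
      using supp
    proof eventually_elim
      case (elim x)
      have "norm (Dw x) \<le> 1 + (norm (Dw x))\<^sup>2"
        using zero_le_power2[of "norm (Dw x) - 1/2"] by (simp add: power2_eq_square algebra_simps)
      then show ?case using elim by (auto simp: indicator_def)
    qed
  qed
  have "(LINT x|lebesgue. w x * partial_deriv i \<phi> x) = - (LINT x|lebesgue. Dw x $ i * \<phi> x)"
    if \<phi>: "test_function \<phi>" for \<phi> i
  proof -
    note t = test_function_mult[OF \<eta> \<phi>] test_function_mult[OF test_functionD(5)[OF \<eta>] \<phi>]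
      test_function_mult[OF \<eta> test_functionD(5)[OF \<phi>]]
    have pd: "partial_deriv i (\<lambda>x. \<eta> x * \<phi> x) = (\<lambda>x. partial_deriv i \<eta> x * \<phi> x + \<eta> x * partial_deriv i \<phi> x)"
      by (rule partial_deriv_mult[OF test_functionD(2)[OF \<eta>] test_functionD(2)[OF \<phi>]])
    have i1: "integrable lebesgue (\<lambda>x. w x * partial_deriv i \<phi> x)"
      using integrable_times_compact[OF u1 t(3), of i] by (simp add: w_def mult_ac)
    have i2: "integrable lebesgue (\<lambda>x. u x * (partial_deriv i \<eta> x * \<phi> x))"
      using integrable_times_compact[OF u1 t(2), of i] by (simp add: mult_ac)
    have i3: "integrable lebesgue (\<lambda>x. Du x $ i * (\<eta> x * \<phi> x))"
      using Di1[OF t(1), of i] by (simp add: mult_ac)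
    have "(LINT x|lebesgue. w x * partial_deriv i \<phi> x) + (LINT x|lebesgue. u x * (partial_deriv i \<eta> x * \<phi> x))
      = (LINT x|lebesgue. u x * partial_deriv i (\<lambda>x. \<eta> x * \<phi> x) x)"
      using Bochner_Integration.integral_add[OF i1 i2] by (simp add: pd w_def algebra_simps)
    also have "\<dots> = - (LINT x|lebesgue. Du x $ i * (\<eta> x * \<phi> x))" by (rule wg[OF t(1)])
    finally have "(LINT x|lebesgue. w x * partial_deriv i \<phi> x)
      = - ((LINT x|lebesgue. Du x $ i * (\<eta> x * \<phi> x)) + (LINT x|lebesgue. u x * (partial_deriv i \<eta> x * \<phi> x)))"
      by simp
    also have "\<dots> = - (LINT x|lebesgue. Dw x $ i * \<phi> x)"
      using Bochner_Integration.integral_add[OF i3 i2] by (simp add: Dw_def grad_def algebra_simps)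
    finally show ?thesis .
  qed
  then have "H1 w Dw"
    unfolding H1_def has_weak_grad_def in_Lp2_UNIV
    using in_Lp_loc_1_integrable[OF wi] in_Lp_loc_1_integrable[OF Dwi] wm Dwm w2 Dw2 by blast
  then have "H1_0 w Dw" by (rule H1_0_compact_support[OF _ supp])
  then show ?thesis by (simp add: w_def[abs_def] Dw_def[abs_def])
qed

lemma grad_square:
  fixes \<eta> :: "real^'n::finite \<Rightarrow> real"
  assumes "test_function \<eta>"
  shows "grad (\<lambda>x. \<eta> x * \<eta> x) x = (2 * \<eta> x) *\<^sub>R grad \<eta> x"
  unfolding grad_def partial_deriv_mult[OF test_functionD(2)[OF assms] test_functionD(2)[OF assms]]
  by (simp add: vec_eq_iff)

text \<open>\<open>V\<close> is locally integrable, so a bounded factor of bounded support suffices.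
  Applied to the square of the cut-off solution, this is where local boundedness of \<open>u\<close>
  enters.\<close>

lemma integrable_mult_compact_support:
  fixes V f :: "real^'n::finite \<Rightarrow> real"
  assumes V: "V \<in> borel_measurable lebesgue" "\<And>r. set_integrable lebesgue (ball 0 r) V"
    and f: "f \<in> borel_measurable lebesgue" "\<And>x. R < norm x \<Longrightarrow> f x = 0"
    and bd: "\<And>x. norm x \<le> R \<Longrightarrow> \<bar>f x\<bar> \<le> B"
  shows "integrable lebesgue (\<lambda>x. V x * f x)"
proof -
  have "integrable lebesgue (\<lambda>x. indicat_real (ball 0 (R + 1)) x * V x)"
    using V(2)[of "R + 1"] by (simp add: set_integrable_def)
  moreover have "\<bar>f x\<bar> \<le> max 0 B" for x
    using bd[of x] f(2)[of x] by (cases "R < norm x") (auto simp: not_less)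
  ultimately have "integrable lebesgue (\<lambda>x. f x * (indicat_real (ball 0 (R + 1)) x * V x))"
    by (intro integrable_bounded_mult[OF _ f(1)])
  moreover have "(\<lambda>x. f x * (indicat_real (ball 0 (R + 1)) x * V x)) = (\<lambda>x. V x * f x)"
    using f(2) by (auto simp: fun_eq_iff indicator_def)
  ultimately show ?thesis by simp
qed

text \<open>The equation is tested with \<open>\<eta>\<^sup>2 * u\<close>. Half of the elliptic term
  absorbs the cross term by Young's inequality, and the potential energy is kept on the left because
  the fixed-scale estimate consumes it as well.\<close>

lemma Caccioppoli:
  fixes u :: "real^'n::finite \<Rightarrow> real"
  assumes lam: "0 < lam" and Lam: "0 \<le> Lam" and A: "bounded_elliptic lam Lam A"
    and H: "H1_loc u Du"
    and weak: "\<And>\<phi> D\<phi>. H1_0 \<phi> D\<phi> \<Longrightarrow> ess_compact_support \<phi> \<Longrightarrow>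
       has_bochner_integral lebesgue (\<lambda>x. (A x *v Du x) \<bullet> D\<phi> x + V x * u x * \<phi> x) 0"
    and V: "V \<in> borel_measurable lebesgue" "\<And>r. set_integrable lebesgue (ball 0 r) V"
    and bd: "\<And>R. \<exists>B. \<forall>x. norm x \<le> R \<longrightarrow> \<bar>u x\<bar> \<le> B" and \<eta>: "test_function \<eta>"
  shows "lam / 2 * (LINT x|lebesgue. (\<eta> x)\<^sup>2 * (norm (Du x))\<^sup>2) + (LINT x|lebesgue. V x * ((\<eta> x)\<^sup>2 * (u x)\<^sup>2))
    \<le> 2 * Lam\<^sup>2 / lam * (LINT x|lebesgue. (u x)\<^sup>2 * (norm (grad \<eta> x))\<^sup>2)"
    and "integrable lebesgue (\<lambda>x. V x * ((\<eta> x)\<^sup>2 * (u x)\<^sup>2))"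
proof -
  have u1: "in_Lp_loc 1 u" and u2: "in_Lp_loc 2 u" and D2: "in_Lp_loc 2 Du"
    using H by (auto simp: H1_loc_def has_weak_grad_def)
  have um: "u \<in> borel_measurable lebesgue" by (rule in_Lp_loc_measurable[OF u1])
  obtain R where R: "\<And>x. R < norm x \<Longrightarrow> \<eta> x = 0" using test_functionD(6)[OF \<eta>] by blast
  obtain B where B: "\<And>x. \<bar>\<eta> x\<bar> \<le> B" using test_function_bounded[OF \<eta>] by blast
  obtain Bu where Bu: "\<And>x. norm x \<le> R \<Longrightarrow> \<bar>u x\<bar> \<le> Bu" using bd[of R] by blast
  have t: "test_function (\<lambda>x. \<eta> x * \<eta> x)" by (rule test_function_mult[OF \<eta> \<eta>])
  define X where "X = (\<lambda>x. (\<eta> x)\<^sup>2 * (norm (Du x))\<^sup>2)"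
  define Z where "Z = (\<lambda>x. V x * ((\<eta> x)\<^sup>2 * (u x)\<^sup>2))"
  define Y where "Y = (\<lambda>x. (u x)\<^sup>2 * (norm (grad \<eta> x))\<^sup>2)"
  have iX: "integrable lebesgue X" unfolding X_def by (rule integrable_square_times_compact[OF D2 \<eta>])
  have iY: "integrable lebesgue Y" unfolding Y_def by (rule integrable_gradient_term[OF u2 \<eta>])
  show iZ': "integrable lebesgue (\<lambda>x. V x * ((\<eta> x)\<^sup>2 * (u x)\<^sup>2))"
  proof (rule integrable_mult_compact_support[OF V])
    show "(\<lambda>x. (\<eta> x)\<^sup>2 * (u x)\<^sup>2) \<in> borel_measurable lebesgue"
      using um test_function_borel(2)[OF \<eta>] by simp
    show "(\<eta> x)\<^sup>2 * (u x)\<^sup>2 = 0" if "R < norm x" for x using R[OF that] by simp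
    fix x :: "real^'n" assume "norm x \<le> R"
    then show "\<bar>(\<eta> x)\<^sup>2 * (u x)\<^sup>2\<bar> \<le> B\<^sup>2 * Bu\<^sup>2"
      using power_mono[OF B[of x], of 2] power_mono[OF Bu, of x 2] by (simp add: abs_mult mult_mono)
  qed
  then have iZ: "integrable lebesgue Z" by (simp add: Z_def[abs_def])
  define F where "F = (\<lambda>x. (A x *v Du x) \<bullet> ((\<eta> x * \<eta> x) *\<^sub>R Du x + u x *\<^sub>R ((2 * \<eta> x) *\<^sub>R grad \<eta> x)) + V x * u x * (\<eta> x * \<eta> x * u x))"
  have "ess_compact_support (\<lambda>x. \<eta> x * \<eta> x * u x)"
    unfolding ess_compact_support_def using R by (intro exI[of _ "cball 0 R"]) (auto intro!: AE_I2 simp: not_le)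
  from weak[OF H1_0_product[OF H t] this]
  have F: "has_bochner_integral lebesgue F 0"
    unfolding F_def grad_square[OF \<eta>] .
  then have iF: "integrable lebesgue F" and F0: "integral\<^sup>L lebesgue F = 0"
    by (auto simp: has_bochner_integral_iff)
  \<comment> \<open>The claim is a pointwise lower bound for the integrand of the weak formulation,
    whose integral is 0.\<close>
  have "AE x in lebesgue. lam / 2 * X x + Z x - 2 * Lam\<^sup>2 / lam * Y x \<le> F x"
    using A[unfolded bounded_elliptic_def, THEN conjunct2]
  proof eventually_elim
    case (elim x)
    define a where "a = \<bar>\<eta> x\<bar> * norm (Du x)"
    define b where "b = \<bar>u x\<bar> * norm (grad \<eta> x)"
    have 1: "lam * a\<^sup>2 \<le> (\<eta> x)\<^sup>2 * ((A x *v Du x) \<bullet> Du x)"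
      using mult_left_mono[OF elim[THEN conjunct2, rule_format, of "Du x"], of "(\<eta> x)\<^sup>2"]
      by (simp add: a_def power_mult_distrib mult_ac)
    have "\<bar>(A x *v Du x) \<bullet> grad \<eta> x\<bar> \<le> Lam * norm (Du x) * norm (grad \<eta> x)"
      using elim by blast
    then have "2 * (\<bar>u x\<bar> * \<bar>\<eta> x\<bar>) * \<bar>(A x *v Du x) \<bullet> grad \<eta> x\<bar> \<le> 2 * (\<bar>u x\<bar> * \<bar>\<eta> x\<bar>) * (Lam * norm (Du x) * norm (grad \<eta> x))"
      by (intro mult_left_mono) auto
    then have "\<bar>2 * (u x * \<eta> x) * ((A x *v Du x) \<bullet> grad \<eta> x)\<bar> \<le> 2 * (Lam * (a * b))"
      by (simp add: abs_mult a_def b_def mult_ac)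
    then have 2: "- (2 * (Lam * (a * b))) \<le> 2 * (u x * \<eta> x) * ((A x *v Du x) \<bullet> grad \<eta> x)" by linarith
    \<comment> \<open>Young's inequality, weighted so that exactly \<open>lam / 2\<close> of the
      elliptic term remains.\<close>
    have 3: "2 * (Lam * (a * b)) \<le> lam / 2 * a\<^sup>2 + 2 * Lam\<^sup>2 / lam * b\<^sup>2"
    proof -
      have "0 \<le> (lam * a - 2 * Lam * b)\<^sup>2 / (2 * lam)" using lam by simp
      also have "\<dots> = lam / 2 * a\<^sup>2 + 2 * Lam\<^sup>2 / lam * b\<^sup>2 - 2 * (Lam * (a * b))"
        using lam by (simp add: power2_eq_square field_simps)
      finally show ?thesis by simp
    qed
    have F: "F x = (\<eta> x)\<^sup>2 * ((A x *v Du x) \<bullet> Du x) + 2 * (u x * \<eta> x) * ((A x *v Du x) \<bullet> grad \<eta> x) + Z x"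
      by (simp add: F_def Z_def inner_add_right power2_eq_square algebra_simps)
    have XY: "X x = a\<^sup>2" "Y x = b\<^sup>2" by (simp_all add: X_def Y_def a_def b_def power_mult_distrib)
    have "lam * a\<^sup>2 = 2 * (lam / 2 * a\<^sup>2)" by simp
    then show ?case unfolding F XY using 1 2 3 by linarith
  qed
  then have "(LINT x|lebesgue. lam / 2 * X x + Z x - 2 * Lam\<^sup>2 / lam * Y x) \<le> integral\<^sup>L lebesgue F"
    using iX iY iZ iF by (intro integral_mono_AE) auto
  then have "lam / 2 * integral\<^sup>L lebesgue X + integral\<^sup>L lebesgue Z \<le> 2 * Lam\<^sup>2 / lam * integral\<^sup>L lebesgue Y"
    using iX iY iZ F0 by simp
  then show "lam / 2 * (LINT x|lebesgue. (\<eta> x)\<^sup>2 * (norm (Du x))\<^sup>2) + (LINT x|lebesgue. V x * ((\<eta> x)\<^sup>2 * (u x)\<^sup>2))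
    \<le> 2 * Lam\<^sup>2 / lam * (LINT x|lebesgue. (u x)\<^sup>2 * (norm (grad \<eta> x))\<^sup>2)"
    by (simp add: X_def Y_def Z_def)
qed

text \<open>The polynomial is that of the derivative of the profile with \<open>p = 1\<close>. With
  \<open>s = 1 / t\<close>, the bound \<open>(1 + s / 2)\<^sup>2 \<le> exp s\<close> controls
  \<open>s^2 exp(-s)\<close>.\<close>

lemma exp_bump_derivative_le: "\<bar>exp_bump [:0, 0, 1:] t\<bar> \<le> 4"
proof (cases "0 < t")
  case True
  define s where "s = 1 / t"
  have s: "0 < s" using True by (simp add: s_def)
  have "(1 + s / 2) ^ 2 \<le> exp s"
    using exp_ge_one_plus_x_over_n_power_n[of 2 s] s by simp
  moreover have "s\<^sup>2 \<le> 4 * (1 + s / 2)\<^sup>2" using s by (simp add: power2_eq_square algebra_simps)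
  ultimately have "s\<^sup>2 \<le> 4 * exp s" by linarith
  then have "s\<^sup>2 * exp (- s) \<le> 4" by (simp add: exp_minus field_simps)
  then show ?thesis using True by (simp add: exp_bump_def s_def power2_eq_square abs_mult)
qed (simp add: exp_bump_def)

text \<open>A lower bound on the inner ball is as good as a cut-off that equals 1 there.\<close>

lemma cutoff_props:
  fixes a :: "real^'n::finite"
  assumes R: "0 < R"
  shows "0 \<le> rbump 1 4 R a x" "rbump 1 4 R a x \<le> 1" "dist a x < R \<Longrightarrow> exp (- 1 / 3) \<le> rbump 1 4 R a x"
    "2 * R \<le> dist a x \<Longrightarrow> rbump 1 4 R a x = 0" "(norm (grad (rbump 1 4 R a) x))\<^sup>2 \<le> 256 / R\<^sup>2"
    "2 * R \<le> dist a x \<Longrightarrow> grad (rbump 1 4 R a) x = 0"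
proof -
  define t where "t = 4 - (norm (x - a))\<^sup>2 / R\<^sup>2"
  have d: "dist a x = norm (x - a)" by (simp add: dist_norm norm_minus_commute)
  show "0 \<le> rbump 1 4 R a x" by (rule rbump_1_nonneg)
  show "rbump 1 4 R a x \<le> 1" by (simp add: rbump_def exp_bump_def)
  show "exp (- 1 / 3) \<le> rbump 1 4 R a x" if "dist a x < R"
  proof -
    have "(norm (x - a))\<^sup>2 \<le> R\<^sup>2" using that d R by (intro power_mono) auto
    then have t: "3 \<le> t" using R by (simp add: t_def field_simps)
    then have "1 / t \<le> 1 / 3" by (intro divide_left_mono) auto
    with t show ?thesis by (simp add: rbump_def exp_bump_def t_def[symmetric])
  qed
  have z: "t \<le> 0" if "2 * R \<le> dist a x"
  proof -
    have "(2 * R)\<^sup>2 \<le> (norm (x - a))\<^sup>2" using that d R by (intro power_mono) auto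
    then show ?thesis using R by (simp add: t_def field_simps)
  qed
  then show "2 * R \<le> dist a x \<Longrightarrow> rbump 1 4 R a x = 0"
    by (simp add: rbump_def exp_bump_def t_def[symmetric])
  have g: "grad (rbump 1 4 R a) x = (exp_bump [:0, 0, 1:] t * (- 2 / R\<^sup>2)) *\<^sub>R (x - a)"
    by (simp add: grad_def partial_deriv_rbump vec_eq_iff rbump_def t_def pderiv_1 one_pCons)
  show "2 * R \<le> dist a x \<Longrightarrow> grad (rbump 1 4 R a) x = 0"
    using z by (simp add: g exp_bump_def)
  show "(norm (grad (rbump 1 4 R a) x))\<^sup>2 \<le> 256 / R\<^sup>2"
  proof (cases "2 * R \<le> dist a x")
    case True
    then show ?thesis using z by (simp add: g exp_bump_def)
  next
    case False
    \<comment> \<open>At most 4 from the profile, \<open>2 / R\<^sup>2\<close> from the chain rule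
      and a distance below \<open>2 * R\<close> give the bound \<open>16 / R\<close>.\<close>
    have "norm (grad (rbump 1 4 R a) x) = \<bar>exp_bump [:0, 0, 1:] t\<bar> * (2 / R\<^sup>2) * norm (x - a)"
      by (simp add: g abs_mult)
    also have "\<dots> \<le> 4 * (2 / R\<^sup>2) * (2 * R)"
      using False d R exp_bump_derivative_le[of t] by (intro mult_mono) auto
    also have "\<dots> = 16 / R" using R by (simp add: power2_eq_square)
    finally have "(norm (grad (rbump 1 4 R a) x))\<^sup>2 \<le> (16 / R)\<^sup>2" by (intro power_mono) auto
    then show ?thesis by (simp add: power_divide)
  qed
qed

text \<open>The set \<open>E\<close> of points with \<open>V \<ge> 1 / (2 * r\<^sup>2)\<close> turns
  the second term of the fixed-scale estimate into potential energy, so both terms are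
  \<open>r\<^sup>2\<close> times an energy. Caccioppoli's inequality bounds that energy by
  \<open>R\<close> to the power -2 times the integral over the doubled ball.\<close>

lemma energy_decay:
  fixes u :: "real^'n::finite \<Rightarrow> real"
  assumes lam: "0 < lam" and Lam: "0 \<le> Lam" and A: "bounded_elliptic lam Lam A"
    and H: "H1_loc u Du"
    and weak: "\<And>\<phi> D\<phi>. H1_0 \<phi> D\<phi> \<Longrightarrow> ess_compact_support \<phi> \<Longrightarrow>
       has_bochner_integral lebesgue (\<lambda>x. (A x *v Du x) \<bullet> D\<phi> x + V x * u x * \<phi> x) 0"
    and V: "V \<in> borel_measurable lebesgue" "\<And>r. set_integrable lebesgue (ball 0 r) V"
    and Vpos: "AE x in lebesgue. 0 < V x"
    and bd: "\<And>R. \<exists>B. \<forall>x. norm x \<le> R \<longrightarrow> \<bar>u x\<bar> \<le> B"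
    and R: "0 < R" and r: "0 < r" and k: "0 \<le> k" "k \<le> 1"
    and large: "\<And>x. x \<in> ball a R \<Longrightarrow>
      k * measure lebesgue (ball x r) \<le> measure lebesgue {y \<in> ball x r. 1 / (2 * r\<^sup>2) \<le> V y}"
  shows "k * (LINT x:ball a R|lebesgue. (u x)\<^sup>2)
    \<le> exp (2 / 3) * (4096 * (1 + 4 * Lam\<^sup>2 / lam\<^sup>2 + 2 * Lam\<^sup>2 / lam)) * (r / R)\<^sup>2 * (LINT x:ball a (2 * R)|lebesgue. (u x)\<^sup>2)"
proof -
  define \<eta> where "\<eta> = rbump 1 4 R a"
  note cp = cutoff_props[OF R, of a, folded \<eta>_def]
  have \<eta>: "test_function \<eta>" unfolding \<eta>_def by (rule test_function_rbump[OF R])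
  have u1: "in_Lp_loc 1 u" and u2: "in_Lp_loc 2 u" and D2: "in_Lp_loc 2 Du"
    using H by (auto simp: H1_loc_def has_weak_grad_def)
  have um: "u \<in> borel_measurable lebesgue" by (rule in_Lp_loc_measurable[OF u1])
  define w where "w = (\<lambda>x. \<eta> x * u x)"
  define Dw where "Dw = (\<lambda>x. \<eta> x *\<^sub>R Du x + u x *\<^sub>R grad \<eta> x)"
  have w: "H1_0 w Dw" unfolding w_def Dw_def by (rule H1_0_product[OF H \<eta>])
  then have Dwi: "integrable lebesgue (\<lambda>x. (norm (Dw x))\<^sup>2)" and wi: "integrable lebesgue (\<lambda>x. (w x)\<^sup>2)"
    by (auto simp: H1_0_def H1_def in_Lp2_UNIV)
  define E where "E = {y. 1 / (2 * r\<^sup>2) \<le> V y}"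
  have E: "E \<in> sets lebesgue"
  proof -
    have "E = V -` {1 / (2 * r\<^sup>2)..} \<inter> space lebesgue" by (auto simp: E_def)
    then show ?thesis using measurable_sets[OF V(1), of "{1 / (2 * r\<^sup>2)..}"] by simp
  qed
  have iu: "integrable lebesgue (\<lambda>x. indicator (ball b s) x * (u x)\<^sup>2)" for b s
    using in_Lp_loc_2_ball[OF u2, of b s] by (simp add: set_integrable_def)
  define X where "X = (LINT x|lebesgue. (\<eta> x)\<^sup>2 * (norm (Du x))\<^sup>2)"
  define Z where "Z = (LINT x|lebesgue. V x * ((\<eta> x)\<^sup>2 * (u x)\<^sup>2))"
  define Y where "Y = (LINT x|lebesgue. (u x)\<^sup>2 * (norm (grad \<eta> x))\<^sup>2)"
  \<comment> \<open>The summands bound \<open>Y\<close>, \<open>X\<close> and \<open>Z\<close> in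
    terms of \<open>Y\<close>: Caccioppoli's inequality gives
    \<open>4 * Lam\<^sup>2 / lam\<^sup>2\<close> for \<open>X\<close> and
    \<open>2 * Lam\<^sup>2 / lam\<close> for \<open>Z\<close>. The remaining 4096 is 16 times the
    256 of the cut-off, and \<open>exp (2 / 3)\<close> undoes its lower bound.\<close>
  define L where "L = 1 + 4 * Lam\<^sup>2 / lam\<^sup>2 + 2 * Lam\<^sup>2 / lam"
  have L: "0 \<le> L" using lam by (simp add: L_def)
  note iX = integrable_square_times_compact[OF D2 \<eta>]
  note iY = integrable_gradient_term[OF u2 \<eta>]
  note iZ = Caccioppoli(2)[OF lam Lam A H weak V bd \<eta>]
  have XZ: "lam / 2 * X + Z \<le> 2 * Lam\<^sup>2 / lam * Y"
    unfolding X_def Y_def Z_def by (rule Caccioppoli(1)[OF lam Lam A H weak V bd \<eta>])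
  have X0: "0 \<le> X" unfolding X_def by (intro integral_nonneg_AE AE_I2) simp
  have Z0: "0 \<le> Z" unfolding Z_def
    using Vpos by (intro integral_nonneg_AE) (auto elim!: eventually_mono)
  have "X + Y + Z \<le> L * Y"
  proof -
    have "lam / 2 * X \<le> 2 * Lam\<^sup>2 / lam * Y" using XZ Z0 by linarith
    then have "2 / lam * (lam / 2 * X) \<le> 2 / lam * (2 * Lam\<^sup>2 / lam * Y)"
      using lam by (intro mult_left_mono) auto
    then have "X \<le> 4 * Lam\<^sup>2 / lam\<^sup>2 * Y" using lam by (simp add: power2_eq_square)
    moreover have "0 \<le> lam / 2 * X" using lam X0 by simp
    then have "Z \<le> 2 * Lam\<^sup>2 / lam * Y" using XZ by linarith
    ultimately show ?thesis by (simp add: L_def distrib_right)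
  qed
  have kE: "k * measure lebesgue (ball x r) \<le> measure lebesgue (E \<inter> ball x r)" if "x \<in> ball a R" for x
  proof -
    have "{y \<in> ball x r. 1 / (2 * r\<^sup>2) \<le> V y} = E \<inter> ball x r" by (auto simp: E_def)
    then show ?thesis using large[OF that] by (simp only:)
  qed
  have main: "k * (LINT x|lebesgue. indicator (ball a R) x * (w x)\<^sup>2)
    \<le> 8 * r\<^sup>2 * (LINT x|lebesgue. (norm (Dw x))\<^sup>2) + 8 * (LINT x|lebesgue. indicator E x * (w x)\<^sup>2)"
    by (rule fixed_scale_H1_0[OF w r k E _ kE]) auto
  have DX: "(LINT x|lebesgue. (norm (Dw x))\<^sup>2) \<le> 2 * X + 2 * Y"
  proof -
    have "(LINT x|lebesgue. (norm (Dw x))\<^sup>2)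
      \<le> (LINT x|lebesgue. 2 * ((\<eta> x)\<^sup>2 * (norm (Du x))\<^sup>2) + 2 * ((u x)\<^sup>2 * (norm (grad \<eta> x))\<^sup>2))"
    proof (rule integral_mono[OF Dwi])
      fix x
      show "(norm (Dw x))\<^sup>2 \<le> 2 * ((\<eta> x)\<^sup>2 * (norm (Du x))\<^sup>2) + 2 * ((u x)\<^sup>2 * (norm (grad \<eta> x))\<^sup>2)"
        using norm_diff_square_le[of "\<eta> x *\<^sub>R Du x" "- (u x *\<^sub>R grad \<eta> x)"]
        by (simp add: Dw_def power_mult_distrib)
    qed (use iX iY in simp)
    then show ?thesis using iX iY by (simp add: X_def Y_def)
  qed
  have EZ: "(LINT x|lebesgue. indicator E x * (w x)\<^sup>2) \<le> 2 * r\<^sup>2 * Z"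
  proof -
    have "(LINT x|lebesgue. indicator E x * (w x)\<^sup>2) \<le> (LINT x|lebesgue. (2 * r\<^sup>2) * (V x * ((\<eta> x)\<^sup>2 * (u x)\<^sup>2)))"
    proof (rule integral_mono_AE)
      show "AE x in lebesgue. indicator E x * (w x)\<^sup>2 \<le> (2 * r\<^sup>2) * (V x * ((\<eta> x)\<^sup>2 * (u x)\<^sup>2))"
        using Vpos
      proof eventually_elim
        case (elim x)
        have "indicator E x \<le> 2 * r\<^sup>2 * V x"
          using elim r by (auto simp: E_def indicator_def field_simps)
        then have "indicator E x * (w x)\<^sup>2 \<le> (2 * r\<^sup>2 * V x) * (w x)\<^sup>2" by (intro mult_right_mono) auto
        then show ?case by (simp add: w_def power_mult_distrib mult_ac)
      qed
    qed (use iZ integrable_mult_indicator[OF E wi] in auto)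
    then show ?thesis using iZ by (simp add: Z_def)
  qed
  have YU: "Y \<le> 256 / R\<^sup>2 * (LINT x|lebesgue. indicator (ball a (2 * R)) x * (u x)\<^sup>2)"
  proof -
    have "Y \<le> (LINT x|lebesgue. 256 / R\<^sup>2 * (indicator (ball a (2 * R)) x * (u x)\<^sup>2))"
      unfolding Y_def
    proof (rule integral_mono[OF iY])
      show "integrable lebesgue (\<lambda>x. 256 / R\<^sup>2 * (indicator (ball a (2 * R)) x * (u x)\<^sup>2))"
        using iu by (rule integrable_mult_right)
      fix x
      show "(u x)\<^sup>2 * (norm (grad \<eta> x))\<^sup>2 \<le> 256 / R\<^sup>2 * (indicator (ball a (2 * R)) x * (u x)\<^sup>2)"
      proof (cases "dist a x < 2 * R")
        case True
        have "(u x)\<^sup>2 * (norm (grad \<eta> x))\<^sup>2 \<le> (u x)\<^sup>2 * (256 / R\<^sup>2)" by (rule mult_left_mono[OF cp(5)]) simp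
        with True show ?thesis by (simp add: mult.commute)
      qed (use cp(6) in simp)
    qed
    then show ?thesis by simp
  qed
  have WU: "exp (- 2 / 3) * (LINT x|lebesgue. indicator (ball a R) x * (u x)\<^sup>2) \<le> (LINT x|lebesgue. indicator (ball a R) x * (w x)\<^sup>2)"
  proof -
    have "(LINT x|lebesgue. exp (- 2 / 3) * (indicator (ball a R) x * (u x)\<^sup>2)) \<le> (LINT x|lebesgue. indicator (ball a R) x * (w x)\<^sup>2)"
    proof (rule integral_mono)
      show "integrable lebesgue (\<lambda>x. exp (- 2 / 3) * (indicator (ball a R) x * (u x)\<^sup>2))"
        using iu by (rule integrable_mult_right)
      show "integrable lebesgue (\<lambda>x. indicator (ball a R) x * (w x)\<^sup>2)"
        using integrable_mult_indicator[OF _ wi, of "ball a R"] by simp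
      fix x
      show "exp (- 2 / 3) * (indicator (ball a R) x * (u x)\<^sup>2) \<le> indicator (ball a R) x * (w x)\<^sup>2"
      proof (cases "dist a x < R")
        case True
        have "(exp (- 1 / 3))\<^sup>2 \<le> (\<eta> x)\<^sup>2" using cp(3)[OF True] by (intro power_mono) auto
        moreover have "(exp (- 1 / 3 :: real))\<^sup>2 = exp (- 2 / 3)" by (simp add: power2_eq_square flip: exp_add)
        ultimately show ?thesis using True by (simp add: w_def power_mult_distrib mult_right_mono)
      qed simp
    qed
    then show ?thesis by simp
  qed
  have "k * (exp (- 2 / 3) * (LINT x|lebesgue. indicator (ball a R) x * (u x)\<^sup>2))
    \<le> 8 * r\<^sup>2 * (2 * X + 2 * Y) + 8 * (2 * r\<^sup>2 * Z)"
  proof -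
    have "k * (exp (- 2 / 3) * (LINT x|lebesgue. indicator (ball a R) x * (u x)\<^sup>2))
        \<le> k * (LINT x|lebesgue. indicator (ball a R) x * (w x)\<^sup>2)"
      using WU k by (intro mult_left_mono) auto
    also note main
    also have "8 * r\<^sup>2 * (LINT x|lebesgue. (norm (Dw x))\<^sup>2) + 8 * (LINT x|lebesgue. indicator E x * (w x)\<^sup>2)
      \<le> 8 * r\<^sup>2 * (2 * X + 2 * Y) + 8 * (2 * r\<^sup>2 * Z)"
      using DX EZ by (intro add_mono mult_left_mono) auto
    finally show ?thesis .
  qed
  also have "\<dots> = 16 * r\<^sup>2 * (X + Y + Z)" by (simp add: algebra_simps)
  also have "\<dots> \<le> 16 * r\<^sup>2 * (L * Y)"
    using \<open>X + Y + Z \<le> L * Y\<close> by (intro mult_left_mono) auto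
  also have "\<dots> \<le> 16 * r\<^sup>2 * (L * (256 / R\<^sup>2 * (LINT x|lebesgue. indicator (ball a (2 * R)) x * (u x)\<^sup>2)))"
    using YU L by (intro mult_left_mono) auto
  finally have "exp (2 / 3) * (k * (exp (- 2 / 3) * (LINT x|lebesgue. indicator (ball a R) x * (u x)\<^sup>2)))
     \<le> exp (2 / 3) * (16 * r\<^sup>2 * (L * (256 / R\<^sup>2 * (LINT x|lebesgue. indicator (ball a (2 * R)) x * (u x)\<^sup>2))))"
    by (rule mult_left_mono) simp
  moreover have "exp (2 / 3) * (k * (exp (- 2 / 3) * t)) = k * t" for t :: real
    by (simp add: exp_minus field_simps)
  ultimately have "k * (LINT x|lebesgue. indicator (ball a R) x * (u x)\<^sup>2)
     \<le> exp (2 / 3) * (16 * r\<^sup>2 * (L * (256 / R\<^sup>2 * (LINT x|lebesgue. indicator (ball a (2 * R)) x * (u x)\<^sup>2))))"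
    by (simp only:)
  also have "\<dots> = exp (2 / 3) * (4096 * L) * (r / R)\<^sup>2 * (LINT x|lebesgue. indicator (ball a (2 * R)) x * (u x)\<^sup>2)"
    by (simp add: power_divide)
  finally show ?thesis by (simp add: L_def set_lebesgue_integral_def)
qed

section \<open>Upper bounds for the Agmon distance\<close>

text \<open>A polygonal path from \<open>y\<close> to the origin. Bounding \<open>m\<close> pointwise on each segment makes the
  cost of the path trivial to estimate, without any measurability of \<open>m\<close> along it.\<close>

definition chain :: "('a::euclidean_space \<Rightarrow> real) \<Rightarrow> real \<Rightarrow> nat \<Rightarrow> 'a \<Rightarrow> bool" where
  "chain m c N y \<longleftrightarrow> (\<exists>p. p 0 = y \<and> p N = 0 \<and>
     (\<forall>i<N. \<forall>z\<in>closed_segment (p i) (p (Suc i)). m z * norm (p (Suc i) - p i) \<le> c))"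

definition clamp01 :: "real \<Rightarrow> real" where
  "clamp01 t = max 0 (min 1 t)"

text \<open>Each increment is switched on linearly during its own time interval and then kept. In
  this closed form the Lipschitz bound is a sum of the bounds for the single terms.\<close>

definition polygon :: "(nat \<Rightarrow> 'a::euclidean_space) \<Rightarrow> nat \<Rightarrow> real \<Rightarrow> 'a" where
  "polygon p N t = p 0 + (\<Sum>i<N. clamp01 (real N * t - real i) *\<^sub>R (p (Suc i) - p i))"

lemma clamp01_Lipschitz: "\<bar>clamp01 s - clamp01 t\<bar> \<le> \<bar>s - t\<bar>"
  by (auto simp: clamp01_def)

lemma polygon_Lipschitz:
  "norm (polygon p N s - polygon p N t) \<le> (real N * (\<Sum>i<N. norm (p (Suc i) - p i))) * \<bar>s - t\<bar>"
proof -
  have "polygon p N s - polygon p N t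
    = (\<Sum>i<N. (clamp01 (real N * s - real i) - clamp01 (real N * t - real i)) *\<^sub>R (p (Suc i) - p i))"
    by (simp add: polygon_def sum_subtractf scaleR_left_diff_distrib)
  also have "norm \<dots> \<le> (\<Sum>i<N. norm ((clamp01 (real N * s - real i) - clamp01 (real N * t - real i)) *\<^sub>R (p (Suc i) - p i)))"
    by (rule norm_sum)
  also have "\<dots> \<le> (\<Sum>i<N. (real N * \<bar>s - t\<bar>) * norm (p (Suc i) - p i))"
  proof (rule sum_mono)
    fix i
    have "\<bar>clamp01 (real N * s - real i) - clamp01 (real N * t - real i)\<bar> \<le> \<bar>(real N * s - real i) - (real N * t - real i)\<bar>"
      by (rule clamp01_Lipschitz)
    also have "\<dots> = real N * \<bar>s - t\<bar>" by (simp add: right_diff_distrib[symmetric] abs_mult)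
    finally show "norm ((clamp01 (real N * s - real i) - clamp01 (real N * t - real i)) *\<^sub>R (p (Suc i) - p i))
      \<le> (real N * \<bar>s - t\<bar>) * norm (p (Suc i) - p i)"
      by (simp add: mult_right_mono)
  qed
  also have "\<dots> = (real N * (\<Sum>i<N. norm (p (Suc i) - p i))) * \<bar>s - t\<bar>"
    by (simp add: sum_distrib_left sum_distrib_right mult_ac)
  finally show ?thesis .
qed

lemma Lipschitz_abs_cont_on:
  fixes f :: "real \<Rightarrow> 'a::real_normed_vector"
  assumes L: "\<And>s t. norm (f s - f t) \<le> L * \<bar>s - t\<bar>"
  shows "abs_cont_on a b f"
  unfolding abs_cont_on_def
proof (intro allI impI)
  fix \<epsilon> :: real assume \<epsilon>: "0 < \<epsilon>"
  have L0: "0 \<le> L" using order_trans[OF norm_ge_zero L[of 1 0]] by simp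
  show "\<exists>\<delta>>0. \<forall>I. finite I \<and> (\<forall>(s, t)\<in>I. a \<le> s \<and> s \<le> t \<and> t \<le> b) \<and>
        disjoint_family_on (\<lambda>(s, t). {s<..<t}) I \<and> (\<Sum>(s, t)\<in>I. t - s) < \<delta> \<longrightarrow>
        (\<Sum>(s, t)\<in>I. norm (f t - f s)) < \<epsilon>"
  \<comment> \<open>The 1 added to \<open>L\<close> covers the case of a Lipschitz constant
    0.\<close>
  proof (intro exI[of _ "\<epsilon> / (L + 1)"] conjI allI impI)
    show "0 < \<epsilon> / (L + 1)" using \<epsilon> L0 by simp
    fix I :: "(real \<times> real) set"
    assume I: "finite I \<and> (\<forall>(s, t)\<in>I. a \<le> s \<and> s \<le> t \<and> t \<le> b) \<and>
        disjoint_family_on (\<lambda>(s, t). {s<..<t}) I \<and> (\<Sum>(s, t)\<in>I. t - s) < \<epsilon> / (L + 1)"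
    have "(\<Sum>(s, t)\<in>I. norm (f t - f s)) \<le> (\<Sum>(s, t)\<in>I. (L + 1) * (t - s))"
    proof (rule sum_mono, clarify)
      fix s t assume "(s, t) \<in> I"
      then have "s \<le> t" using I by auto
      have "norm (f t - f s) \<le> L * \<bar>t - s\<bar>" by (rule L)
      also have "\<dots> \<le> (L + 1) * (t - s)" using \<open>s \<le> t\<close> by (simp add: algebra_simps)
      finally show "norm (f t - f s) \<le> (L + 1) * (t - s)" .
    qed
    also have "\<dots> = (L + 1) * (\<Sum>(s, t)\<in>I. t - s)"
      by (simp add: sum_distrib_left case_prod_unfold)
    also have "\<dots> < \<epsilon>" using I L0 by (simp add: pos_less_divide_eq mult.commute)
    finally show "(\<Sum>(s, t)\<in>I. norm (f t - f s)) < \<epsilon>" .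
  qed
qed

text \<open>On the \<open>i\<close>-th time interval the earlier clamps equal 1 and telescope to
  \<open>p i\<close>, while the later ones equal 0. Both interval ends are included, so the lemma
  also yields the end points of the curve.\<close>

lemma polygon_piece:
  assumes "i < N" "real i \<le> real N * t" "real N * t \<le> real (Suc i)"
  shows "polygon p N t = p i + (real N * t - real i) *\<^sub>R (p (Suc i) - p i)"
proof -
  have tele: "p 0 + (\<Sum>j<i. p (Suc j) - p j) = p i"
    by (simp add: sum_lessThan_telescope)
  have "(\<Sum>j<N. clamp01 (real N * t - real j) *\<^sub>R (p (Suc j) - p j))
    = (\<Sum>j\<in>{..<N} - {i}. clamp01 (real N * t - real j) *\<^sub>R (p (Suc j) - p j))
      + clamp01 (real N * t - real i) *\<^sub>R (p (Suc i) - p i)"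
    using assms(1) by (subst sum.remove[of _ i]) (auto simp: add.commute)
  also have "clamp01 (real N * t - real i) = real N * t - real i"
    using assms by (simp add: clamp01_def)
  also have "(\<Sum>j\<in>{..<N} - {i}. clamp01 (real N * t - real j) *\<^sub>R (p (Suc j) - p j))
    = (\<Sum>j\<in>{..<N} - {i}. if j < i then p (Suc j) - p j else 0)"
  proof (rule sum.cong[OF refl])
    fix j assume j: "j \<in> {..<N} - {i}"
    show "clamp01 (real N * t - real j) *\<^sub>R (p (Suc j) - p j) = (if j < i then p (Suc j) - p j else 0)"
    proof (cases "j < i")
      case True
      then have "real j + 1 \<le> real i" by simp
      with True assms show ?thesis by (simp add: clamp01_def)
    next
      case False
      with j have "real i + 1 \<le> real j" by auto
      with False assms show ?thesis by (simp add: clamp01_def)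
    qed
  qed
  also have "\<dots> = (\<Sum>j<i. p (Suc j) - p j)"
    using assms(1) by (subst sum.inter_filter[symmetric]) (auto intro!: sum.cong)
  finally show ?thesis using tele by (simp add: polygon_def add.assoc[symmetric])
qed

text \<open>The polygon is a competitor in the infimum. Off the break points its velocity is
  \<open>N\<close> times an increment, so the integrand is at most \<open>N\<close> times the
  segment cost \<open>c\<close>; a bound of the integrand by a constant is all that the nonnegative
  integral requires.\<close>

lemma agmon_distance_chain:
  fixes V :: "'a::euclidean_space \<Rightarrow> real"
  assumes "chain (m_fun V) c N y" and c: "0 \<le> c"
  shows "agmon_distance V y 0 \<le> c * real N"
proof (cases "N = 0")
  case False
  then have N: "0 < N" by simp
  obtain p where p: "p 0 = y" "p N = 0"
    and cost: "\<And>i z. i < N \<Longrightarrow> z \<in> closed_segment (p i) (p (Suc i)) \<Longrightarrow> m_fun V z * norm (p (Suc i) - p i) \<le> c"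
    using assms(1) unfolding chain_def by blast
  let ?\<sigma> = "polygon p N"
  have end0: "?\<sigma> 0 = y"
    using polygon_piece[of 0 N 0 p] N p by simp
  have end1: "?\<sigma> 1 = 0"
    using polygon_piece[of "N - 1" N 1 p] N p by (simp add: of_nat_diff)
  have ac: "abs_cont_on 0 1 ?\<sigma>" by (rule Lipschitz_abs_cont_on[OF polygon_Lipschitz])
  have pt: "m_fun V (?\<sigma> t) * norm (vector_derivative ?\<sigma> (at t)) \<le> c * real N"
    if t: "0 \<le> t" "t \<le> 1" "real N * t \<notin> \<int>" for t
  proof -
    define i where "i = nat \<lfloor>real N * t\<rfloor>"
    have fl: "0 \<le> \<lfloor>real N * t\<rfloor>" using t by simp
    have lo: "real i < real N * t" "real N * t < real (Suc i)"
    proof -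
      have ri: "of_int \<lfloor>real N * t\<rfloor> = real i" using fl by (simp add: i_def)
      have "of_int \<lfloor>real N * t\<rfloor> \<noteq> real N * t" using t(3) by (metis Ints_of_int)
      moreover have "of_int \<lfloor>real N * t\<rfloor> \<le> real N * t" "real N * t < of_int \<lfloor>real N * t\<rfloor> + 1"
        by linarith+
      ultimately show "real i < real N * t" "real N * t < real (Suc i)" unfolding ri by linarith+
    qed
    have "real N * t \<le> real N * 1" using t by (intro mult_left_mono) auto
    with lo have iN: "i < N" by simp
    have "((\<lambda>s. p i + (real N * s - real i) *\<^sub>R (p (Suc i) - p i)) has_vector_derivative real N *\<^sub>R (p (Suc i) - p i)) (at t)"
      by (auto intro!: derivative_eq_intros)
    then have "(?\<sigma> has_vector_derivative real N *\<^sub>R (p (Suc i) - p i)) (at t)"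
    proof (rule has_vector_derivative_transform_within_open[where S = "{s. real i < real N * s \<and> real N * s < real (Suc i)}"])
      show "open {s. real i < real N * s \<and> real N * s < real (Suc i)}"
        by (intro open_Collect_conj open_Collect_less continuous_intros)
      show "p i + (real N * s - real i) *\<^sub>R (p (Suc i) - p i) = ?\<sigma> s"
        if "s \<in> {s. real i < real N * s \<and> real N * s < real (Suc i)}" for s
        using polygon_piece[OF iN, of s p] that by simp
    qed (use lo in simp)
    then have vd: "vector_derivative ?\<sigma> (at t) = real N *\<^sub>R (p (Suc i) - p i)"
      by (rule vector_derivative_at)
    have "?\<sigma> t = p i + (real N * t - real i) *\<^sub>R (p (Suc i) - p i)"
      using polygon_piece[OF iN, of t p] lo by simp
    also have "\<dots> = (1 - (real N * t - real i)) *\<^sub>R p i + (real N * t - real i) *\<^sub>R p (Suc i)"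
      by (simp add: algebra_simps)
    finally have "?\<sigma> t \<in> closed_segment (p i) (p (Suc i))"
      unfolding in_segment using lo by (intro exI[of _ "real N * t - real i"]) auto
    from cost[OF iN this] have "real N * (m_fun V (?\<sigma> t) * norm (p (Suc i) - p i)) \<le> real N * c"
      by (intro mult_left_mono) auto
    then show ?thesis by (simp add: vd mult_ac)
  qed
  \<comment> \<open>The break points are among the multiples of \<open>1 / N\<close>, a countable
    and hence null set, so the value of \<open>vector_derivative\<close> there is
    irrelevant.\<close>
  have "countable ((\<lambda>k. k / real N) ` \<int>)" by (intro countable_image countable_int)
  then have nul: "(\<lambda>k. k / real N) ` \<int> \<in> null_sets lebesgue"
    by (intro null_sets_completionI countable_imp_null_set_lborel)
  have ae: "AE t in lebesgue. real N * t \<notin> \<int>"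
    using AE_not_in[OF nul]
  proof eventually_elim
    case (elim t)
    show ?case
    proof
      assume "real N * t \<in> \<int>"
      then have "t \<in> (\<lambda>k. k / real N) ` \<int>" using N by (intro image_eqI[of _ _ "real N * t"]) auto
      with elim show False by simp
    qed
  qed
  have "(INF \<sigma> \<in> {\<sigma>. abs_cont_on 0 1 \<sigma> \<and> \<sigma> 0 = y \<and> \<sigma> 1 = 0}.
        \<integral>\<^sup>+t\<in>{0..1}. ennreal (m_fun V (\<sigma> t) * norm (vector_derivative \<sigma> (at t))) \<partial>lebesgue)
    \<le> (\<integral>\<^sup>+t\<in>{0..1}. ennreal (m_fun V (?\<sigma> t) * norm (vector_derivative ?\<sigma> (at t))) \<partial>lebesgue)"
    by (rule INF_lower) (use ac end0 end1 in simp)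
  also have "\<dots> \<le> (\<integral>\<^sup>+t. ennreal (c * real N) * indicator {0..1 :: real} t \<partial>lebesgue)"
  proof (rule nn_integral_mono_AE)
    show "AE t in lebesgue. ennreal (m_fun V (?\<sigma> t) * norm (vector_derivative ?\<sigma> (at t))) * indicator {0..1} t
      \<le> ennreal (c * real N) * indicator {0..1} t"
      using ae
    proof eventually_elim
      case (elim t)
      then show ?case using pt[of t] by (auto simp: indicator_def intro!: ennreal_leI)
    qed
  qed
  also have "\<dots> = ennreal (c * real N)" by (subst nn_integral_cmult_indicator) auto
  finally have "agmon_distance V y 0 \<le> enn2real (ennreal (c * real N))"
    unfolding agmon_distance_def by (intro enn2real_mono) auto
  then show ?thesis using c by simp
next
  case True
  \<comment> \<open>Without steps the start is already the origin, and the constant curve has cost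
    0; the argument above subdivides time into \<open>N > 0\<close> pieces.\<close>
  then have "y = 0" using assms(1) by (auto simp: chain_def)
  have "(INF \<sigma> \<in> {\<sigma>. abs_cont_on 0 1 \<sigma> \<and> \<sigma> 0 = y \<and> \<sigma> 1 = 0}.
        \<integral>\<^sup>+t\<in>{0..1}. ennreal (m_fun V (\<sigma> t) * norm (vector_derivative \<sigma> (at t))) \<partial>lebesgue)
    \<le> (\<integral>\<^sup>+t\<in>{0..1}. ennreal (m_fun V ((\<lambda>_. 0) t) * norm (vector_derivative (\<lambda>_. 0 :: 'a) (at t))) \<partial>lebesgue)"
    using \<open>y = 0\<close> Lipschitz_abs_cont_on[of "\<lambda>_. 0 :: 'a" 0 0 1] by (intro INF_lower) simp
  also have "\<dots> = 0" by (simp add: vector_derivative_const_at)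
  finally show ?thesis using True by (simp add: agmon_distance_def)
qed

lemma chain_step:
  assumes "chain m c N y" and "\<And>w. w \<in> closed_segment z y \<Longrightarrow> m w * norm (y - z) \<le> c"
  shows "chain m c (Suc N) z"
proof -
  obtain p where p: "p 0 = y" "p N = 0"
    "\<And>i z. i < N \<Longrightarrow> z \<in> closed_segment (p i) (p (Suc i)) \<Longrightarrow> m z * norm (p (Suc i) - p i) \<le> c"
    using assms(1) unfolding chain_def by blast
  define q where "q = (\<lambda>i. case i of 0 \<Rightarrow> z | Suc j \<Rightarrow> p j)"
  have "m w * norm (q (Suc i) - q i) \<le> c" if "i < Suc N" "w \<in> closed_segment (q i) (q (Suc i))" for i w
    using that p assms(2) by (cases i) (auto simp: q_def)
  then show ?thesis unfolding chain_def
    by (intro exI[of _ q]) (auto simp: q_def p)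
qed

text \<open>Cutting the radial segment finely enough makes every piece cheap as soon as
  \<open>m\<close> is bounded above along it. The number of pieces depends on \<open>y\<close> and
  the bound; the iteration only uses that it is finite.\<close>

lemma chain_exists:
  fixes y :: "'a::euclidean_space"
  assumes c: "0 < c" and M: "\<And>z. norm z \<le> norm y \<Longrightarrow> m z \<le> M"
  shows "\<exists>N. chain m c N y"
proof -
  obtain N0 :: nat where N0: "max M 0 * norm y / c \<le> real N0" using real_arch_simple by blast
  \<comment> \<open>The successor keeps \<open>N\<close> positive, also when \<open>y\<close> is
    already the origin.\<close>
  define N where "N = Suc N0"
  have "max M 0 * norm y / c \<le> real N" using N0 by (simp add: N_def)
  then have N: "max M 0 * norm y \<le> c * real N" using c by (simp add: pos_divide_le_eq mult.commute)
  define p where "p = (\<lambda>i. (1 - real i / real N) *\<^sub>R y)"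
  have "m z * norm (p (Suc i) - p i) \<le> c" if i: "i < N" and z: "z \<in> closed_segment (p i) (p (Suc i))" for i z
  proof -
    have pn: "norm (p j) \<le> norm y" if "j \<le> N" for j
    proof -
      have "0 \<le> 1 - real j / real N" "1 - real j / real N \<le> 1" using that by (auto simp: N_def)
      then show ?thesis by (simp add: p_def mult_left_le_one_le)
    qed
    have "closed_segment (p i) (p (Suc i)) \<subseteq> cball 0 (norm y)"
      using i pn by (intro closed_segment_subset) auto
    with z have "m z \<le> max M 0" using M[of z] by (auto simp: le_max_iff_disj)
    moreover have "norm (p (Suc i) - p i) = norm y / real N"
    proof -
      have "p (Suc i) - p i = (- 1 / real N) *\<^sub>R y"
        by (simp add: p_def scaleR_left_diff_distrib[symmetric] add_divide_distrib)
      then show ?thesis by simp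
    qed
    ultimately have "m z * norm (p (Suc i) - p i) \<le> max M 0 * (norm y / real N)"
      by (simp add: mult_right_mono divide_right_mono)
    also have "\<dots> \<le> c" using N by (simp add: N_def pos_divide_le_eq)
    finally show ?thesis .
  qed
  moreover have "p 0 = y" "p N = 0" by (auto simp: p_def N_def)
  ultimately show ?thesis unfolding chain_def by blast
qed

section \<open>Decay along chains\<close>

text \<open>Averaging the integrals over the balls of radius \<open>t\<close> replaces a covering argument.\<close>

lemma average_over_balls:
  fixes f :: "'a::euclidean_space \<Rightarrow> real"
  assumes f: "f \<in> borel_measurable lebesgue" "\<And>x. 0 \<le> f x" "\<And>x r. set_integrable lebesgue (ball x r) f"
    and t: "0 < t" "t \<le> R" and K: "0 \<le> K"
    and bd: "\<And>z. z \<in> ball x (3 * R) \<Longrightarrow> (LINT y:ball z t|lebesgue. f y) \<le> K"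
  shows "measure lebesgue (ball x t) * (LINT y:ball x (2 * R)|lebesgue. f y) \<le> K * measure lebesgue (ball x (3 * R))"
proof -
  \<comment> \<open>A Borel version makes Tonelli's theorem available on \<open>lborel\<close>; its
    possible negative values on a null set are removed by \<open>ennreal\<close>.\<close>
  obtain g0 where g0: "g0 \<in> borel_measurable lborel" "AE y in lborel. f y = g0 y"
    using completion_ex_borel_measurable_real[OF f(1)] by blast
  define g where "g = (\<lambda>y. ennreal (g0 y))"
  have g[measurable]: "g \<in> borel_measurable borel" using g0(1) by (simp add: g_def)
  have fg: "AE y in lebesgue. ennreal (f y) = g y"
    using AE_completion[OF g0(2)] by eventually_elim (simp add: g_def)
  have I: "(\<integral>\<^sup>+y. indicator (ball z s) y * g y \<partial>lborel) = ennreal (LINT y:ball z s|lebesgue. f y)" for z s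
  proof -
    have "(\<integral>\<^sup>+y. indicator (ball z s) y * g y \<partial>lborel) = (\<integral>\<^sup>+y. indicator (ball z s) y * g y \<partial>lebesgue)"
      by (rule nn_integral_completion[symmetric])
    also have "\<dots> = (\<integral>\<^sup>+y. ennreal (indicat_real (ball z s) y *\<^sub>R f y) \<partial>lebesgue)"
      by (rule nn_integral_cong_AE) (use fg in \<open>auto simp: indicator_def elim!: eventually_mono\<close>)
    also have "\<dots> = ennreal (LINT y:ball z s|lebesgue. f y)"
      unfolding set_lebesgue_integral_def
      by (rule nn_integral_eq_integral) (use f in \<open>auto simp: set_integrable_def\<close>)
    finally show ?thesis .
  qed
  have e: "emeasure lborel (ball z s) = ennreal (measure lebesgue (ball z s))" for z :: 'a and s
    using emeasure_lborel_ball_finite[of z s] by (subst emeasure_eq_ennreal_measure) auto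
  have mt: "measure lebesgue (ball y t) = measure lebesgue (ball x t)" for y :: 'a
    using measure_lebesgue_ball[of t y] measure_lebesgue_ball[of t x] t by simp
  define Q where "Q = (\<lambda>z y :: 'a. if dist z y < t then 1 else 0 :: ennreal)"
  have [measurable]: "case_prod Q \<in> borel_measurable (lborel \<Otimes>\<^sub>M lborel)"
    unfolding Q_def by measurable
  have Qb: "Q z y = indicator (ball z t) y" "Q z y = indicator (ball y t) z" for z y
    by (auto simp: Q_def indicator_def dist_commute)
  define S where "S = ball x (2 * R)"
  define T where "T = ball x (3 * R)"
  have [measurable]: "S \<in> sets borel" "T \<in> sets borel" by (auto simp: S_def T_def)
  \<comment> \<open>Here \<open>t \<le> R\<close> matters: centres within \<open>t\<close> of the
    ball of radius \<open>2 * R\<close> stay in the one of radius \<open>3 * R\<close>, where the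
    hypothesis holds.\<close>
  have sub: "z \<in> T" if "y \<in> S" "dist z y < t" for y z
    using that t dist_triangle[of x z y] by (simp add: S_def T_def dist_commute)
  have "ennreal (measure lebesgue (ball x t)) * ennreal (LINT y:ball x (2 * R)|lebesgue. f y)
    = (\<integral>\<^sup>+y. ennreal (measure lebesgue (ball x t)) * (indicator S y * g y) \<partial>lborel)"
    unfolding I[symmetric] S_def by (rule nn_integral_cmult[symmetric]) (auto intro!: borel_measurable_times_ennreal borel_measurable_indicator)
  also have "\<dots> = (\<integral>\<^sup>+y. (\<integral>\<^sup>+z. Q z y * (indicator S y * g y) \<partial>lborel) \<partial>lborel)"
  proof (rule nn_integral_cong)
    fix y
    have "(\<integral>\<^sup>+z. Q z y * (indicator S y * g y) \<partial>lborel) = (\<integral>\<^sup>+z. Q z y \<partial>lborel) * (indicator S y * g y)"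
      by (rule nn_integral_multc) measurable
    also have "(\<integral>\<^sup>+z. Q z y \<partial>lborel) = ennreal (measure lebesgue (ball x t))"
      unfolding Qb(2) using e[of y t] mt[of y] by simp
    finally show "ennreal (measure lebesgue (ball x t)) * (indicator S y * g y) = (\<integral>\<^sup>+z. Q z y * (indicator S y * g y) \<partial>lborel)"
      by simp
  qed
  also have "\<dots> \<le> (\<integral>\<^sup>+y. (\<integral>\<^sup>+z. indicator T z * (Q z y * g y) \<partial>lborel) \<partial>lborel)"
    by (intro nn_integral_mono) (use sub in \<open>auto simp: Q_def indicator_def\<close>)
  also have "\<dots> = (\<integral>\<^sup>+z. (\<integral>\<^sup>+y. indicator T z * (Q z y * g y) \<partial>lborel) \<partial>lborel)"
    by (rule lborel_pair.Fubini') measurable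
  also have "\<dots> \<le> (\<integral>\<^sup>+z. ennreal K * indicator T z \<partial>lborel)"
  proof (rule nn_integral_mono)
    fix z
    have "(\<integral>\<^sup>+y. indicator T z * (Q z y * g y) \<partial>lborel) = indicator T z * (\<integral>\<^sup>+y. Q z y * g y \<partial>lborel)"
      by (rule nn_integral_cmult) measurable
    also have "(\<integral>\<^sup>+y. Q z y * g y \<partial>lborel) = ennreal (LINT y:ball z t|lebesgue. f y)"
      unfolding Qb(1) by (rule I)
    also have "indicator T z * \<dots> \<le> ennreal K * indicator T z"
      using bd[of z] by (auto simp: T_def indicator_def intro!: ennreal_leI)
    finally show "(\<integral>\<^sup>+y. indicator T z * (Q z y * g y) \<partial>lborel) \<le> ennreal K * indicator T z" .
  qed
  also have "\<dots> = ennreal K * ennreal (measure lebesgue (ball x (3 * R)))"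
    using e[of x "3 * R"] by (simp add: nn_integral_cmult_indicator T_def)
  finally show ?thesis
    using K f(2) by (simp add: ennreal_mult[symmetric] set_lebesgue_integral_def del: measure_completion)
qed

text \<open>One step of the iteration. The exponent in \<open>T = D ^ Suc j\<close> is spent
  exactly: one \<open>D\<close> on moving the centre within the ball, and \<open>D ^ j\<close> on
  halving the radius \<open>j\<close> times. The factor \<open>(1 / 2 ^ j)\<^sup>2\<close> then
  beats the overlap constant, which does not depend on \<open>j\<close>.\<close>

lemma mean_square_contraction:
  fixes u V :: "real^'n::finite \<Rightarrow> real"
  assumes reg: "psi_regular D G k V" and T: "T = D ^ Suc j"
    and energy: "\<And>a R r. 0 < R \<Longrightarrow> 0 < r \<Longrightarrow>
      (\<And>x. x \<in> ball a R \<Longrightarrow> min k 1 * measure lebesgue (ball x r) \<le> measure lebesgue {y \<in> ball x r. 1 / (2 * r\<^sup>2) \<le> V y}) \<Longrightarrow>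
      min k 1 * (LINT x:ball a R|lebesgue. (u x)\<^sup>2) \<le> C0 * (r / R)\<^sup>2 * (LINT x:ball a (2 * R)|lebesgue. (u x)\<^sup>2)"
    and C0: "0 \<le> C0"
    and j: "C0 * (1 / 2 ^ j)\<^sup>2 * (3 * (G (2 * D\<^sup>2))\<^sup>2) ^ CARD('n) \<le> min k 1 / 2"
    and u: "u \<in> borel_measurable lebesgue" "\<And>x r. set_integrable lebesgue (ball x r) (\<lambda>x. (u x)\<^sup>2)"
    and rho: "\<And>x. 0 < rho x" "\<And>x. T \<le> psi_fun V x (rho x)" "\<And>x. psi_fun V x (rho x) \<le> D * T"
    and b: "0 \<le> b" "\<And>z. dist x z < 3 * rho x \<Longrightarrow>
      (LINT y:ball z (rho z)|lebesgue. (u y)\<^sup>2) \<le> b * measure lebesgue (ball z (rho z))"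
  shows "(LINT y:ball x (rho x)|lebesgue. (u y)\<^sup>2) \<le> b / 2 * measure lebesgue (ball x (rho x))"
proof -
  note P = psi_regularD[OF reg]
  define K where "K = G (2 * D\<^sup>2)"
  have K: "1 \<le> K" using P(2) by (simp add: K_def)
  define R where "R = rho x"
  have R: "0 < R" by (simp add: R_def rho)
  have Tpos: "0 < T" using P(1) by (simp add: T)
  define r where "r = R / 2 ^ j"
  have r: "0 < r" using R by (simp add: r_def)
  define U where "U = (\<lambda>s. LINT y:ball x s|lebesgue. (u y)\<^sup>2)"
  define w where "w = measure lebesgue (ball x R)"
  have w: "0 < w" unfolding w_def by (rule measure_lebesgue_ball_pos[OF R])
  have vol: "measure lebesgue (ball z (s * R)) = s ^ CARD('n) * w" if "0 \<le> s" for s :: real and z :: "real^'n"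
    using measure_lebesgue_ball_scale[of R s z x] R that unfolding w_def by (simp del: measure_completion)
  have "min k 1 * U R \<le> C0 * (r / R)\<^sup>2 * U (2 * R)"
    unfolding U_def
  proof (rule energy[OF R r])
    fix y assume y: "y \<in> ball x R"
    have iter: "psi_fun V y (2 ^ i * r) \<le> D ^ i * psi_fun V y r" for i
    proof (induction i)
      case (Suc i)
      have "psi_fun V y (2 * (2 ^ i * r)) \<le> D * psi_fun V y (2 ^ i * r)"
        by (rule P(8)) (use r in simp)
      also have "\<dots> \<le> D * (D ^ i * psi_fun V y r)"
        using Suc P(1) by (intro mult_left_mono) auto
      finally show ?case by (simp add: mult_ac)
    qed simp
    have "T \<le> psi_fun V x R" by (simp add: R_def rho)
    also have "\<dots> \<le> D * psi_fun V y R"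
      by (rule P(9)[OF R]) (use y R in \<open>simp add: dist_commute\<close>)
    also have "\<dots> \<le> D * (D ^ j * psi_fun V y r)"
      using iter[of j] P(1) by (intro mult_left_mono) (auto simp: r_def)
    finally have "T * 1 \<le> T * psi_fun V y r" by (simp add: T mult_ac)
    \<comment> \<open>In terms of the average this says
      \<open>ball_average y r V \<ge> 1 / r\<^sup>2\<close>, so half the average reaches the level
      required by the energy estimate.\<close>
    then have "1 \<le> psi_fun V y r" using Tpos by (simp only: mult_le_cancel_left_pos)
    then have avg: "1 / (2 * r\<^sup>2) \<le> ball_average y r V / 2"
      using r by (simp add: psi_fun_def field_simps)
    have "min k 1 * measure lebesgue (ball y r) \<le> k * measure lebesgue (ball y r)"
      by (intro mult_right_mono) auto
    also have "\<dots> \<le> measure lebesgue {z \<in> ball y r. ball_average y r V / 2 \<le> V z}" by (rule P(11)[OF r])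
    also have "\<dots> \<le> measure lebesgue {z \<in> ball y r. 1 / (2 * r\<^sup>2) \<le> V z}"
      by (intro measure_mono_fmeasurable fmeasurableI2[OF fmeasurable_ball[of y r]] superlevel_in_ball P(4))
        (use avg in \<open>auto intro: order_trans\<close>)
    finally show "min k 1 * measure lebesgue (ball y r) \<le> measure lebesgue {z \<in> ball y r. 1 / (2 * r\<^sup>2) \<le> V z}" .
  qed
  also have "r / R = 1 / 2 ^ j" using R by (simp add: r_def)
  finally have 1: "min k 1 * U R \<le> C0 * (1 / 2 ^ j)\<^sup>2 * U (2 * R)" .
  \<comment> \<open>The small radius \<open>R / K\<close> is at most \<open>rho z\<close> for every
    relevant \<open>z\<close>, so each small ball lies in the critical ball of its centre.
    Conversely that critical ball has radius at most \<open>K * R\<close>. The two comparisons give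
    \<open>K\<^sup>2\<close>, and the averaging region gives 3, each to the power of the
    dimension.\<close>
  have "measure lebesgue (ball x (1 / K * R)) * U (2 * R) \<le> (b * (K ^ CARD('n) * w)) * measure lebesgue (ball x (3 * R))"
    unfolding U_def
  proof (rule average_over_balls)
    show "0 < 1 / K * R" "1 / K * R \<le> R" using K R by (auto simp: field_simps)
    show "0 \<le> b * (K ^ CARD('n) * w)" using b(1) K w by simp
    fix z assume z: "z \<in> ball x (3 * R)"
    have cmp: "R \<le> K * rho z" "rho z \<le> K * R"
      using critical_radius_compare[OF reg Tpos, of "rho x" x "rho z" z] rho z by (auto simp: K_def R_def)
    have "(LINT y:ball z (1 / K * R)|lebesgue. (u y)\<^sup>2) \<le> (LINT y:ball z (rho z)|lebesgue. (u y)\<^sup>2)"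
      using cmp K by (intro mass_subset(2)[OF u(2)] subset_ball) (auto simp: field_simps)
    also have "\<dots> \<le> b * measure lebesgue (ball z (rho z))" by (rule b(2)) (use z in \<open>simp add: R_def\<close>)
    also have "\<dots> \<le> b * measure lebesgue (ball z (K * R))"
      using b(1) cmp by (intro mult_left_mono measure_mono_fmeasurable subset_ball) auto
    finally show "(LINT y:ball z (1 / K * R)|lebesgue. (u y)\<^sup>2) \<le> b * (K ^ CARD('n) * w)"
      using K by (simp add: vol del: measure_completion)
  qed (use u in auto)
  moreover have "measure lebesgue (ball x (1 / K * R)) = (1 / K) ^ CARD('n) * w"
    by (rule vol) (use K in simp)
  moreover have "measure lebesgue (ball x (3 * R)) = 3 ^ CARD('n) * w" by (rule vol) simp
  ultimately have "(1 / K) ^ CARD('n) * w * U (2 * R) \<le> (b * (K ^ CARD('n) * w)) * (3 ^ CARD('n) * w)"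
    by (simp only:)
  then have "K ^ CARD('n) * ((1 / K) ^ CARD('n) * w * U (2 * R)) \<le> K ^ CARD('n) * ((b * (K ^ CARD('n) * w)) * (3 ^ CARD('n) * w))"
    using K by (intro mult_left_mono) auto
  also have "K ^ CARD('n) * ((1 / K) ^ CARD('n) * w * U (2 * R)) = w * U (2 * R)"
    using K by (simp add: power_divide)
  also have "K ^ CARD('n) * ((b * (K ^ CARD('n) * w)) * (3 ^ CARD('n) * w)) = w * ((3 * K\<^sup>2) ^ CARD('n) * b * w)"
    by (simp add: power_mult_distrib power2_eq_square mult_ac)
  finally have 2: "U (2 * R) \<le> (3 * K\<^sup>2) ^ CARD('n) * b * w" using w by (simp only: mult_le_cancel_left_pos)
  have "C0 * (1 / 2 ^ j)\<^sup>2 * U (2 * R) \<le> C0 * (1 / 2 ^ j)\<^sup>2 * ((3 * K\<^sup>2) ^ CARD('n) * b * w)"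
    using 2 C0 by (intro mult_left_mono) auto
  also have "\<dots> = (C0 * (1 / 2 ^ j)\<^sup>2 * (3 * K\<^sup>2) ^ CARD('n)) * (b * w)" by (simp add: mult_ac)
  also have "\<dots> \<le> (min k 1 / 2) * (b * w)"
    using j b(1) w unfolding K_def by (intro mult_right_mono) auto
  finally have "min k 1 * U R \<le> min k 1 * (b / 2 * w)" using 1 by simp
  moreover have "0 < min k 1" using P(3) by simp
  ultimately have "U R \<le> b / 2 * w" by (simp only: mult_le_cancel_left_pos)
  then show ?thesis by (simp add: U_def R_def w_def)
qed

text \<open>A single ball around the origin suffices, with its own value of \<open>psi_fun\<close>
  as the level \<open>T\<close>. The bound depends on \<open>V\<close>; it serves local boundedness
  of \<open>u\<close> and the existence of chains, where no uniformity is required.\<close>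

lemma m_fun_bounded:
  assumes reg: "psi_regular D G k V"
  shows "\<exists>M. \<forall>z. norm z \<le> S \<longrightarrow> m_fun V z \<le> M"
proof -
  define R where "R = max S 0 + 1"
  have R: "0 < R" by (simp add: R_def)
  have "0 < psi_fun V 0 R" by (rule psi_regularD(7)[OF reg R])
  then have "m_fun V z \<le> G (D * psi_fun V 0 R) / R" if "norm z \<le> S" for z
    using that R by (intro m_fun_le[OF reg, of _ _ 0]) (auto simp: R_def)
  then show ?thesis by blast
qed

lemma iterated_bound_eq_0:
  fixes x :: real
  assumes "\<And>i. x \<le> B * (q / 2) ^ i" "0 \<le> q" "q < 2"
  shows "x \<le> 0"
proof -
  have "(\<lambda>i. B * (q / 2) ^ i) \<longlonglongrightarrow> B * 0"
    using assms(2,3) by (intro tendsto_intros LIMSEQ_realpow_zero) auto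
  then have "x \<le> B * 0" by (rule LIMSEQ_le_const) (use assms(1) in blast)
  then show ?thesis by simp
qed

text \<open>By the Lindeloef property countably many of the balls cover the space, so only countably
  many exceptional null sets are combined.\<close>

lemma AE_zero_of_local:
  fixes u :: "'a::euclidean_space \<Rightarrow> real"
  assumes "\<And>y. 0 < rho y" "\<And>y. AE x in lebesgue. x \<in> ball y (rho y) \<longrightarrow> u x = 0"
  shows "AE x in lebesgue. u x = 0"
proof -
  obtain F where F: "F \<subseteq> range (\<lambda>y. ball y (rho y))" "countable F" "\<Union>F = \<Union>(range (\<lambda>y. ball y (rho y)))"
    by (rule Lindelof[of "range (\<lambda>y. ball y (rho y))"]) auto
  have "AE x in lebesgue. \<forall>B\<in>F. x \<in> B \<longrightarrow> u x = 0"
    by (rule AE_ball_countable'[OF _ F(2)]) (use F(1) assms(2) in auto)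
  then show ?thesis
  proof eventually_elim
    case (elim x)
    have "x \<in> \<Union>F" unfolding F(3) using assms(1)[of x] by (intro UnionI[of "ball x (rho x)"]) auto
    with elim show ?case by blast
  qed
qed

theorem corollary1p2:
  fixes lam Lam C_V :: real and p :: ennreal
  assumes "0 < lam" and "lam \<le> 1" and "1 \<le> Lam"
    and "ennreal (real CARD('n::finite) / 2) \<le> p" and "1 < p"
  shows "\<exists>\<gamma>\<^sub>0>0. \<forall>(A :: real^'n \<Rightarrow> real^'n^'n) (V :: real^'n \<Rightarrow> real) (u :: real^'n \<Rightarrow> real).
           bounded_elliptic lam Lam A \<longrightarrow> reverse_Holder p C_V V \<longrightarrow> weak_solution A V u \<longrightarrow>
           (\<exists>\<gamma>\<^sub>1<\<gamma>\<^sub>0. \<exists>C>0. \<forall>x. \<bar>u x\<bar> \<le> C * exp (\<gamma>\<^sub>1 * agmon_distance V x 0)) \<longrightarrow>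
           (AE x in lebesgue. u x = 0)"
proof (cases "\<exists>V :: real^'n \<Rightarrow> real. reverse_Holder p C_V V")
  case False
  \<comment> \<open>If no weight exists the claim is vacuous and any positive constant will
    do.\<close>
  then show ?thesis by (intro exI[of _ 1]) auto
next
  case True
  obtain D G k where regular: "\<And>V :: real^'n \<Rightarrow> real. reverse_Holder p C_V V \<Longrightarrow> psi_regular D G k V"
    using reverse_Holder_regular[where 'a = "real^'n", of p C_V] assms by auto
  \<comment> \<open>The signs and lower bounds of \<open>D\<close>, \<open>G\<close> and
    \<open>k\<close> are part of \<open>psi_regular\<close>, which is only available for an actual
    weight. An auxiliary \<open>V0\<close> provides them while the threshold is still to be
    chosen.\<close>
  from True regular obtain V0 :: "real^'n \<Rightarrow> real" where "psi_regular D G k V0" by blast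
  note P0 = psi_regularD(1-3)[OF this]
  define C0 where "C0 = exp (2 / 3) * (4096 * (1 + 4 * Lam\<^sup>2 / lam\<^sup>2 + 2 * Lam\<^sup>2 / lam))"
  have C0: "0 \<le> C0" using assms by (simp add: C0_def)
  define Q where "Q = C0 * (3 * (G (2 * D\<^sup>2))\<^sup>2) ^ CARD('n)"
  have Q: "0 \<le> Q" using C0 by (simp add: Q_def)
  have k1: "0 < min k 1" using P0 by simp
  \<comment> \<open>\<open>Q\<close> is the energy constant times the overlap constant, and the
    squared radius ratio is \<open>(1 / 4) ^ j\<close>. The 1 added to \<open>Q\<close> avoids a
    division by 0.\<close>
  have "0 < min k 1 / 2 / (Q + 1)" using k1 Q by simp
  then obtain j where "(1 / 4) ^ j < min k 1 / 2 / (Q + 1)"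
    using real_arch_pow_inv[of "min k 1 / 2 / (Q + 1)" "1 / 4"] by auto
  then have q1: "(Q + 1) * (1 / 4) ^ j < min k 1 / 2"
    using Q by (subst (asm) pos_less_divide_eq) (linarith, simp only: mult.commute)
  have q2: "Q * (1 / 4) ^ j \<le> (Q + 1) * (1 / 4) ^ j" by (intro mult_right_mono) auto
  have q3: "(1 / 2 ^ j)\<^sup>2 = (1 / 4 :: real) ^ j" by (simp add: power_divide power2_eq_square flip: power_mult_distrib)
  have q4: "C0 * (1 / 2 ^ j)\<^sup>2 * (3 * (G (2 * D\<^sup>2))\<^sup>2) ^ CARD('n) = Q * (1 / 2 ^ j)\<^sup>2"
    by (simp only: Q_def mult_ac)
  have j: "C0 * (1 / 2 ^ j)\<^sup>2 * (3 * (G (2 * D\<^sup>2))\<^sup>2) ^ CARD('n) \<le> min k 1 / 2"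
    unfolding q4 using order_trans[OF q2 less_imp_le[OF q1]] unfolding q3 .
  define T where "T = D ^ Suc j"
  have T: "0 < T" using P0 by (simp add: T_def)
  \<comment> \<open>A step is shorter than \<open>3 * rho y\<close>, and on it \<open>m_fun\<close>
    is at most \<open>G (D * (D * T)) / rho y\<close>: the critical radius has level
    \<open>D * T\<close>, and \<open>m_fun_le\<close> adds another \<open>D\<close>.\<close>
  define c where "c = 3 * G (D * (D * T))"
  have c: "0 < c" using P0(2)[of "D * (D * T)"] by (simp add: c_def)
  show ?thesis
  proof (intro exI[of _ "ln 2 / (2 * c)"] conjI allI impI)
    show "0 < ln 2 / (2 * c)" using c by simp
    fix A :: "real^'n \<Rightarrow> real^'n^'n" and V u :: "real^'n \<Rightarrow> real"
    assume A: "bounded_elliptic lam Lam A" and RH: "reverse_Holder p C_V V" and sol: "weak_solution A V u"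
      and growth: "\<exists>\<gamma>\<^sub>1<ln 2 / (2 * c). \<exists>C>0. \<forall>x. \<bar>u x\<bar> \<le> C * exp (\<gamma>\<^sub>1 * agmon_distance V x 0)"
    have reg: "psi_regular D G k V" by (rule regular[OF RH])
    note P = psi_regularD[OF reg]
    obtain \<gamma>1 C where \<gamma>1: "\<gamma>1 < ln 2 / (2 * c)" and C: "0 < C"
      and gr: "\<And>x. \<bar>u x\<bar> \<le> C * exp (\<gamma>1 * agmon_distance V x 0)" using growth by blast
    \<comment> \<open>The given rate may be negative; only a nonnegative one allows the distance to
      be replaced by an upper bound.\<close>
    define \<gamma> where "\<gamma> = max 0 \<gamma>1"
    have \<gamma>: "0 \<le> \<gamma>" "\<gamma> < ln 2 / (2 * c)" using \<gamma>1 c by (auto simp: \<gamma>_def)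
    have chain_bound: "\<bar>u y\<bar> \<le> C * exp (\<gamma> * (c' * real N))" if "chain (m_fun V) c' N y" "0 \<le> c'" for c' N y
    proof -
      have "\<gamma>1 * agmon_distance V y 0 \<le> \<gamma> * agmon_distance V y 0"
        by (intro mult_right_mono) (auto simp: \<gamma>_def agmon_distance_def)
      also have "\<dots> \<le> \<gamma> * (c' * real N)"
        using agmon_distance_chain[OF that] \<gamma>(1) by (rule mult_left_mono)
      finally have "C * exp (\<gamma>1 * agmon_distance V y 0) \<le> C * exp (\<gamma> * (c' * real N))" using C by simp
      with gr[of y] show ?thesis by linarith
    qed
    \<comment> \<open>The growth bound combined with a chain of one straight segment to the origin
      makes \<open>u\<close> locally bounded, as the energy estimate requires.\<close>
    have bdd: "\<exists>B. \<forall>x. norm x \<le> S \<longrightarrow> \<bar>u x\<bar> \<le> B" for S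
    proof -
      obtain M where M: "\<And>z. norm z \<le> S \<Longrightarrow> m_fun V z \<le> M" using m_fun_bounded[OF reg, of S] by blast
      have "\<bar>u y\<bar> \<le> C * exp (\<gamma> * (max M 0 * max S 0 * real 1))" if y: "norm y \<le> S" for y
      proof (rule chain_bound)
        have "chain (m_fun V) (max M 0 * max S 0) 0 0" by (auto simp: chain_def)
        then have "chain (m_fun V) (max M 0 * max S 0) (Suc 0) y"
        proof (rule chain_step)
          fix w assume w: "w \<in> closed_segment y 0"
          have "norm w \<le> norm y" using segment_bound(2)[OF w] by simp
          then have "m_fun V w \<le> max M 0" using M[of w] y by auto
          then show "m_fun V w * norm (0 - y) \<le> max M 0 * max S 0"
            using y by (intro mult_mono) auto
        qed
        then show "chain (m_fun V) (max M 0 * max S 0) 1 y" by simp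
      qed simp
      then show ?thesis by blast
    qed
    obtain Du where H: "H1_loc u Du" and weak: "\<And>\<phi> D\<phi>. H1_0 \<phi> D\<phi> \<Longrightarrow> ess_compact_support \<phi> \<Longrightarrow>
       has_bochner_integral lebesgue (\<lambda>x. (A x *v Du x) \<bullet> D\<phi> x + V x * u x * \<phi> x) 0"
      using sol unfolding weak_solution_def by blast
    have u2: "in_Lp_loc 2 u" using H by (simp add: H1_loc_def)
    have um: "u \<in> borel_measurable lebesgue" by (rule in_Lp_loc_measurable[OF u2])
    have ui: "set_integrable lebesgue (ball x r) (\<lambda>x. (u x)\<^sup>2)" for x r
      using in_Lp_loc_2_ball[OF u2] by simp
    have energy: "min k 1 * (LINT x:ball a R|lebesgue. (u x)\<^sup>2) \<le> C0 * (r / R)\<^sup>2 * (LINT x:ball a (2 * R)|lebesgue. (u x)\<^sup>2)"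
      if "0 < R" "0 < r" "\<And>x. x \<in> ball a R \<Longrightarrow>
        min k 1 * measure lebesgue (ball x r) \<le> measure lebesgue {y \<in> ball x r. 1 / (2 * r\<^sup>2) \<le> V y}" for a R r
      unfolding C0_def
      by (rule energy_decay[OF assms(1) _ A H weak P(4) P(6) P(5) bdd that(1,2) _ _ that(3)])
        (use k1 assms in auto)
    have "\<forall>x. \<exists>R>0. T \<le> psi_fun V x R \<and> psi_fun V x R \<le> D * T"
      using critical_radius_exists[OF reg T] by blast
    from choice[OF this] obtain rho where rho: "\<And>x. 0 < rho x" "\<And>x. T \<le> psi_fun V x (rho x)"
      "\<And>x. psi_fun V x (rho x) \<le> D * T" by blast
    have DT: "0 < D * T" using P(1) T by simp
    have next_chain: "chain (m_fun V) c (Suc N) z" if "chain (m_fun V) c N y" "dist y z < 3 * rho y" for N y z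
    proof (rule chain_step[OF that(1)])
      fix w assume "w \<in> closed_segment z y"
      then have "dist y w \<le> dist y z" using segment_bound(2)[of w z y] by (simp add: dist_norm norm_minus_commute)
      then have "m_fun V w \<le> G (D * (D * T)) / rho y"
        using that(2) by (intro m_fun_le[OF reg DT rho(1) rho(3)]) linarith
      moreover have "norm (y - z) \<le> 3 * rho y" using that(2) by (simp add: dist_norm)
      moreover have "0 \<le> G (D * (D * T))" using P(2)[of "D * (D * T)"] by linarith
      ultimately have "m_fun V w * norm (y - z) \<le> G (D * (D * T)) / rho y * (3 * rho y)"
        using rho(1)[of y] by (intro mult_mono) (auto intro!: divide_nonneg_pos)
      also have "\<dots> = c" using rho(1)[of y] by (simp add: c_def)
      finally show "m_fun V w * norm (y - z) \<le> c" .
    qed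
    \<comment> \<open>The growth of the squared bound on \<open>u\<close> per step. The choice of
      the threshold is exactly the condition \<open>q < 2\<close>.\<close>
    define q where "q = exp (2 * \<gamma> * c)"
    have q: "0 \<le> q" "q < 2"
    proof -
      have "2 * \<gamma> * c < ln 2" using \<gamma>(2) c by (simp add: pos_less_divide_eq mult_ac)
      then have "exp (2 * \<gamma> * c) < exp (ln 2)" by (subst exp_less_cancel_iff)
      then show "q < 2" by (simp add: q_def)
    qed (simp add: q_def)
    \<comment> \<open>In the exponent, \<open>N\<close> counts the steps from \<open>y\<close> to
      the origin, the 1 is the step from \<open>y\<close> to a point of its critical ball, and
      \<open>i\<close> counts the successive neighbours. Each of these lengthens the chain by one
      while the contraction contributes a factor 1/2.\<close>
    have decay: "(LINT x:ball y (rho y)|lebesgue. (u x)\<^sup>2) \<le> C\<^sup>2 * q ^ (N + 1 + i) / 2 ^ i * measure lebesgue (ball y (rho y))"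
      if "chain (m_fun V) c N y" for N y i
      using that
    proof (induction i arbitrary: N y)
      case 0
      have pt: "(u x)\<^sup>2 \<le> C\<^sup>2 * q ^ (N + 1)" if "x \<in> ball y (rho y)" for x
      proof -
        have "chain (m_fun V) c (Suc N) x" by (rule next_chain[OF 0]) (use that rho(1)[of y] in simp)
        then have "\<bar>u x\<bar> \<le> C * exp (\<gamma> * (c * real (Suc N)))" by (rule chain_bound) (use c in simp)
        then have "\<bar>u x\<bar>\<^sup>2 \<le> (C * exp (\<gamma> * (c * real (Suc N))))\<^sup>2" by (intro power_mono) auto
        also have "\<dots> = C\<^sup>2 * q ^ (N + 1)"
          unfolding q_def power_mult_distrib by (simp add: algebra_simps flip: exp_of_nat_mult exp_double exp_add)
        finally show ?thesis by simp
      qed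
      have "set_integrable lebesgue (ball y (rho y)) (\<lambda>x. C\<^sup>2 * q ^ (N + 1))"
        by (rule set_integrable_bounded[where M = "\<bar>C\<^sup>2 * q ^ (N + 1)\<bar>"]) auto
      then have "(LINT x:ball y (rho y)|lebesgue. (u x)\<^sup>2) \<le> (LINT x:ball y (rho y)|lebesgue. C\<^sup>2 * q ^ (N + 1))"
        using pt by (intro set_integral_mono[OF ui]) auto
      also have "\<dots> = C\<^sup>2 * q ^ (N + 1) * measure lebesgue (ball y (rho y))"
        by (simp add: set_lebesgue_integral_def)
      finally show ?case by simp
    next
      case (Suc i)
      have "(LINT x:ball y (rho y)|lebesgue. (u x)\<^sup>2) \<le> (C\<^sup>2 * q ^ (Suc N + 1 + i) / 2 ^ i) / 2 * measure lebesgue (ball y (rho y))"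
        by (rule mean_square_contraction[OF reg T_def energy C0 j um ui rho])
          (use Suc.IH[OF next_chain[OF Suc.prems]] q in auto)
      then show ?case by (simp add: mult_ac)
    qed
    have zero: "AE x in lebesgue. x \<in> ball y (rho y) \<longrightarrow> u x = 0" for y
    proof -
      obtain M where "\<And>z. norm z \<le> norm y \<Longrightarrow> m_fun V z \<le> M" using m_fun_bounded[OF reg, of "norm y"] by blast
      then obtain N where N: "chain (m_fun V) c N y" using chain_exists[OF c] by blast
      \<comment> \<open>For fixed \<open>y\<close> and \<open>N\<close> the bound is a constant
        times \<open>(q / 2) ^ i\<close>, so letting \<open>i\<close> tend to infinity removes the
        dependence on the length of the initial chain.\<close>
      have "(LINT x:ball y (rho y)|lebesgue. (u x)\<^sup>2) \<le> 0"
      proof (rule iterated_bound_eq_0[OF _ q])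
        fix i
        show "(LINT x:ball y (rho y)|lebesgue. (u x)\<^sup>2) \<le> (C\<^sup>2 * q ^ (N + 1) * measure lebesgue (ball y (rho y))) * (q / 2) ^ i"
          using decay[OF N, of i] by (simp add: power_add power_divide mult_ac)
      qed
      moreover have "0 \<le> (LINT x:ball y (rho y)|lebesgue. (u x)\<^sup>2)"
        unfolding set_lebesgue_integral_def by (intro integral_nonneg_AE AE_I2) simp
      ultimately have "(LINT x:ball y (rho y)|lebesgue. (u x)\<^sup>2) = 0" by (rule antisym)
      then have "(LINT x|lebesgue. indicat_real (ball y (rho y)) x *\<^sub>R (u x)\<^sup>2) = 0"
        by (simp only: set_lebesgue_integral_def)
      then have "AE x in lebesgue. indicat_real (ball y (rho y)) x *\<^sub>R (u x)\<^sup>2 = 0"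
        using ui[of y "rho y"] unfolding set_integrable_def
        by (subst (asm) integral_nonneg_eq_0_iff_AE) auto
      then show ?thesis by eventually_elim (auto simp: indicator_def split: if_splits)
    qed
    show "AE x in lebesgue. u x = 0" by (rule AE_zero_of_local[OF rho(1) zero])
  qed
qed

end
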